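(* Let $b$ be a prime, let $s,d,\alpha,m\in\mathbb N$ (positive integers), let $0\le t\le m$ be an integer, and put $N=b^m$, $M=m-t$, $\rho=\min(\alpha,d)$. There is a constant $C_{b,s,\alpha,d}>0$, depending only on $b,s,\alpha,d$ (in particular independent of $m$ and $f$), such that the following holds. Let $P=\{z_0,\ldots,z_{N-1}\}\subset[0,1)^{ds}$ be a digital $(t,m,ds)$-net in base $b$, and let $$\widehat I_N(f)=\frac1N\sum_{n=0}^{N-1}f\bigl(\mathcal D_d(\Pi(z_n))\bigr)$$ be its order-$d$ nested-uniformly scrambled and interlaced estimator. Then, for every $f\in\mathcal H_{s,\alpha}$, $$\operatorname{Var}[\widehat I_N(f)]\le C_{b,s,\alpha,d}\,\|f\|_{\mathcal H_{s,\alpha}}^2\,b^{-(2\rho+1)M}(M+2)^{ds-1}.$$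
   Context: Base-$b$ expansions of points in $[0,1)$ are chosen to be the ones not eventually equal to $b-1$. Digital net: let $\mathbb F_b$ be the field with $b$ elements, identified with $\{0,\ldots,b-1\}$, and let $C_1,\ldots,C_{ds}\in\mathbb F_b^{m\times m}$. For $0\le n<b^m$ with base-$b$ digit vector $\vec n=(n_0,\ldots,n_{m-1})^\top$, let $(z_{n,j,1},\ldots,z_{n,j,m})^\top=C_j\vec n$, $z_{n,j}=\sum_{a=1}^m z_{n,j,a}b^{-a}$, and $z_n=(z_{n,1},\ldots,z_{n,ds})$. The point set $\{z_0,\ldots,z_{b^m-1}\}$ is a digital $(t,m,ds)$-net in base $b$ if for all integers $c_1,\ldots,c_{ds}\ge0$ with $c_1+\cdots+c_{ds}=m-t$, the system consisting of the first $c_j$ rows of $C_j$, $j=1,\ldots,ds$, is linearly independent over $\mathbb F_b$. Nested uniform (Owen) scrambling $\Pi$: for each coordinate $j\in\{1,\ldots,ds\}$ and each finite digit string $(a_1,\ldots,a_r)$, $r\ge0$, there is a uniformly distributed random permutation $\pi_{j;a_1,\ldots,a_r}$ of $\{0,\ldots,b-1\}$; all of these permutations are mutually independent. If $z_j=\sum_{a\ge1}z_{j,a}b^{-a}$, the $j$-th coordinate of $\Pi(z)$ has digits $\pi_{j;z_{j,1},\ldots,z_{j,r-1}}(z_{j,r})$, $r\ge1$. The same random permutations are applied to all points of $P$. Digit interlacing $\mathcal D_d:[0,1)^{ds}\to[0,1)^s$: with $z_j=\sum_{a\ge1}z_{j,a}b^{-a}$, $$\mathcal D_d(z)_i=\sum_{a=1}^\infty\sum_{r=1}^d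 z_{(i-1)d+r,a}\,b^{-r-(a-1)d},\qquad 1\le i\le s.$$ Sobolev space: for $u\subseteq\{1,\ldots,s\}$ let $f_u(x_u)=\int_{[0,1]^{s-|u|}}f(x)\,\mathrm dx_{-u}$ (integrating out the variables not in $u$), and $I(f)=\int_{[0,1]^s}f(x)\,\mathrm dx$. For smooth $f$ on $[0,1]^s$, $$\|f\|_{\mathcal H_{s,\alpha}}^2=|I(f)|^2+\sum_{\emptyset\ne u\subseteq\{1,\ldots,s\}}\ \sum_{\boldsymbol\nu_u\in\{1,\ldots,\alpha\}^u}\int_{[0,1]^{|u|}}|\partial^{\boldsymbol\nu_u}f_u(x_u)|^2\,\mathrm dx_u.$$ $\mathcal H_{s,\alpha}$ is the completion of the smooth functions in this norm; since $\|f\|_{L_2}\le\|f\|_{\mathcal H_{s,\alpha}}$, it is embedded in $L_2([0,1]^s)$. Variance is $\operatorname{Var}[X]=\mathbb E|X-\mathbb E X|^2$, over the randomness of $\Pi$. *)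

theory Defs
  imports "HOL-Probability.Probability" "HOL-Number_Theory.Number_Theory"
begin

text \<open>
  Coordinates are numbered from 1, as in the mathematical text. A point of \<open>[0,1]\<^sup>u\<close> for a finite set
  \<open>u\<close> of coordinates is an extensional function on \<open>u\<close>, that is, an element of
  \<open>u \<rightarrow>\<^sub>E {0..1}\<close>.
\<close>


section \<open>Digital nets\<close>

text \<open>
  For \<open>a \<ge> 1\<close> and \<open>x \<in> [0,1)\<close>, the \<open>a\<close>-th digit in the base-\<open>b\<close> expansion of \<open>x\<close> that is not
  eventually equal to \<open>b - 1\<close>.
\<close>

definition digit :: "nat \<Rightarrow> real \<Rightarrow> nat \<Rightarrow> nat" where
  "digit b x a = nat \<lfloor>x * real b ^ a\<rfloor> mod b"

text \<open>
  \<open>C j a k\<close> is the entry of the \<open>j\<close>-th generating matrix in row \<open>a \<in> {1..m}\<close> and column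
  \<open>k \<in> {0..<m}\<close>; the column \<open>k\<close> is multiplied with the digit \<open>n\<^sub>k\<close> of \<open>n\<close>. For prime \<open>b\<close> the field with
  \<open>b\<close> elements is \<open>{0..<b}\<close> with arithmetic modulo \<open>b\<close>.
\<close>

definition net_digit :: "nat \<Rightarrow> nat \<Rightarrow> (nat \<Rightarrow> nat \<Rightarrow> nat \<Rightarrow> nat) \<Rightarrow> nat \<Rightarrow> nat \<Rightarrow> nat \<Rightarrow> nat" where
  "net_digit b m C n j a = (\<Sum>k<m. C j a k * (n div b ^ k mod b)) mod b"

definition net_point :: "nat \<Rightarrow> nat \<Rightarrow> (nat \<Rightarrow> nat \<Rightarrow> nat \<Rightarrow> nat) \<Rightarrow> nat \<Rightarrow> nat \<Rightarrow> real" where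
  "net_point b m C n j = (\<Sum>a=1..m. real (net_digit b m C n j a) / real b ^ a)"

text \<open>
  Linear independence over the field with \<open>b\<close> elements of the family (not the set) consisting of the
  first \<open>c j\<close> rows of \<open>C j\<close>, for \<open>j = 1, \<dots>, q\<close>.
\<close>

definition rows_independent ::
    "nat \<Rightarrow> nat \<Rightarrow> nat \<Rightarrow> (nat \<Rightarrow> nat \<Rightarrow> nat \<Rightarrow> nat) \<Rightarrow> (nat \<Rightarrow> nat) \<Rightarrow> bool" where
  "rows_independent b m q C c \<longleftrightarrow>
     (\<forall>l :: nat \<Rightarrow> nat \<Rightarrow> nat.
        (\<forall>k<m. [(\<Sum>j=1..q. \<Sum>a=1..c j. l j a * C j a k) = 0] (mod b)) \<longrightarrow>
        (\<forall>j\<in>{1..q}. \<forall>a\<in>{1..c j}. [l j a = 0] (mod b)))"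

definition digital_net :: "nat \<Rightarrow> nat \<Rightarrow> nat \<Rightarrow> nat \<Rightarrow> (nat \<Rightarrow> nat \<Rightarrow> nat \<Rightarrow> nat) \<Rightarrow> bool" where
  "digital_net b t m q C \<longleftrightarrow>
     (\<forall>j\<in>{1..q}. \<forall>a\<in>{1..m}. \<forall>k<m. C j a k < b) \<and>
     (\<forall>c :: nat \<Rightarrow> nat. (\<Sum>j=1..q. c j) = m - t \<longrightarrow> rows_independent b m q C c)"


section \<open>Nested uniform scrambling and digit interlacing\<close>

text \<open>
  One independent uniform permutation of \<open>{0..<b}\<close> for each coordinate \<open>j \<in> {1..q}\<close> and each finite
  digit string.
\<close>

definition scramble_space :: "nat \<Rightarrow> nat \<Rightarrow> (nat \<times> nat list \<Rightarrow> nat \<Rightarrow> nat) measure" where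
  "scramble_space b q =
     Pi\<^sub>M ({1..q} \<times> lists {..<b}) (\<lambda>_. measure_pmf (pmf_of_set {p. p permutes {..<b}}))"

definition scramble ::
    "nat \<Rightarrow> (nat \<times> nat list \<Rightarrow> nat \<Rightarrow> nat) \<Rightarrow> (nat \<Rightarrow> real) \<Rightarrow> nat \<Rightarrow> real" where
  "scramble b \<pi> z j =
     (\<Sum>r. real (\<pi> (j, map (digit b (z j)) [1..<Suc r]) (digit b (z j) (Suc r))) / real b ^ Suc r)"

definition interlace :: "nat \<Rightarrow> nat \<Rightarrow> nat \<Rightarrow> (nat \<Rightarrow> real) \<Rightarrow> nat \<Rightarrow> real" where
  "interlace b s d z =
     (\<lambda>i\<in>{1..s}. \<Sum>a. \<Sum>r=1..d. real (digit b (z ((i - 1) * d + r)) (Suc a)) / real b ^ (r + a * d))"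

definition estimator ::
    "nat \<Rightarrow> nat \<Rightarrow> nat \<Rightarrow> nat \<Rightarrow> (nat \<Rightarrow> nat \<Rightarrow> nat \<Rightarrow> nat) \<Rightarrow> ((nat \<Rightarrow> real) \<Rightarrow> complex) \<Rightarrow>
     (nat \<times> nat list \<Rightarrow> nat \<Rightarrow> nat) \<Rightarrow> complex" where
  "estimator b s d m C f \<pi> =
     (\<Sum>n<b ^ m. f (interlace b s d (scramble b \<pi> (net_point b m C n)))) / of_nat (b ^ m)"

definition complex_variance :: "'a measure \<Rightarrow> ('a \<Rightarrow> complex) \<Rightarrow> real" where
  "complex_variance M X = (LINT w|M. (cmod (X w - (LINT v|M. X v)))\<^sup>2)"


section \<open>The Sobolev space\<close>

definition cube :: "nat set \<Rightarrow> (nat \<Rightarrow> real) measure" where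
  "cube u = Pi\<^sub>M u (\<lambda>_. restrict_space lborel {0..1})"

text \<open>At the faces of the cube the derivative is one-sided.\<close>

definition partial :: "nat \<Rightarrow> ((nat \<Rightarrow> real) \<Rightarrow> complex) \<Rightarrow> (nat \<Rightarrow> real) \<Rightarrow> complex" where
  "partial i f x = vector_derivative (\<lambda>t. f (x(i := t))) (at (x i) within {0..1})"

text \<open>Smooth on the closed cube: all iterated partial derivatives exist and are continuous.\<close>

definition smooth_on_cube :: "nat \<Rightarrow> ((nat \<Rightarrow> real) \<Rightarrow> complex) \<Rightarrow> bool" where
  "smooth_on_cube s f \<longleftrightarrow>
     (\<forall>js\<in>lists {1..s}.
        continuous_on ({1..s} \<rightarrow>\<^sub>E {0..1}) (foldr partial js f) \<and>
        (\<forall>i\<in>{1..s}. \<forall>x\<in>{1..s} \<rightarrow>\<^sub>E {0..1}.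
           (\<lambda>t. foldr partial js f (x(i := t))) differentiable (at (x i) within {0..1})))"

definition mixed_partial ::
    "nat set \<Rightarrow> (nat \<Rightarrow> nat) \<Rightarrow> ((nat \<Rightarrow> real) \<Rightarrow> complex) \<Rightarrow> (nat \<Rightarrow> real) \<Rightarrow> complex" where
  "mixed_partial u \<nu> f = foldr (\<lambda>i g. (partial i ^^ \<nu> i) g) (sorted_list_of_set u) f"

definition marginal ::
    "nat \<Rightarrow> nat set \<Rightarrow> ((nat \<Rightarrow> real) \<Rightarrow> complex) \<Rightarrow> (nat \<Rightarrow> real) \<Rightarrow> complex" where
  "marginal s u f x = (LINT y|cube ({1..s} - u). f (merge u ({1..s} - u) (x, y)))"

definition smooth_norm :: "nat \<Rightarrow> nat \<Rightarrow> ((nat \<Rightarrow> real) \<Rightarrow> complex) \<Rightarrow> real" where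
  "smooth_norm s \<alpha> f =
     sqrt ((cmod (LINT x|cube {1..s}. f x))\<^sup>2 +
       (\<Sum>u\<in>Pow {1..s} - {{}}. \<Sum>\<nu>\<in>u \<rightarrow>\<^sub>E {1..\<alpha>}.
          LINT x|cube u. (cmod (mixed_partial u \<nu> (marginal s u f) x))\<^sup>2))"

definition square_integrable :: "nat \<Rightarrow> ((nat \<Rightarrow> real) \<Rightarrow> complex) \<Rightarrow> bool" where
  "square_integrable s f \<longleftrightarrow>
     f \<in> borel_measurable (cube {1..s}) \<and> integrable (cube {1..s}) (\<lambda>x. (cmod (f x))\<^sup>2)"

text \<open>
  An element of the completion is represented by a Cauchy sequence \<open>F\<close> of smooth functions; its norm is
  the limit of the norms of the \<open>F k\<close>, and its image under the embedding into \<open>L\<^sub>2\<close> is the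
  \<open>L\<^sub>2\<close>-limit of \<open>F\<close>. The relation below states that \<open>f\<close> is (a representative of) the \<open>L\<^sub>2\<close>-function
  given by an element of the completion whose norm is \<open>c\<close>.
\<close>

definition has_sobolev_norm :: "nat \<Rightarrow> nat \<Rightarrow> ((nat \<Rightarrow> real) \<Rightarrow> complex) \<Rightarrow> real \<Rightarrow> bool" where
  "has_sobolev_norm s \<alpha> f c \<longleftrightarrow>
     square_integrable s f \<and>
     (\<exists>F. (\<forall>k. smooth_on_cube s (F k)) \<and>
          (\<forall>e>0. \<exists>K. \<forall>k\<ge>K. \<forall>l\<ge>K. smooth_norm s \<alpha> (\<lambda>x. F k x - F l x) < e) \<and>
          (\<lambda>k. LINT x|cube {1..s}. (cmod (F k x - f x))\<^sup>2) \<longlonglongrightarrow> 0 \<and>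
          (\<lambda>k. smooth_norm s \<alpha> (F k)) \<longlonglongrightarrow> c)"

end

theory Submission
  imports Defs
begin

text \<open>
  Truncate every scrambled coordinate to its first \<open>L\<close> digits and expand the integrand in
  Walsh functions of these digits; the truncation error vanishes as \<open>L\<close> grows. Walsh functions with
  different frequencies stay uncorrelated after averaging over the scrambled net, the average
  vanishes almost surely when the levels (highest nonzero digit positions) of a nonzero frequency sum
  to at most \<open>m - t\<close>, and otherwise its second moment is at most \<open>b\<^sup>d\<^sup>s / b\<^bsup>m - t\<^esup>\<close>.

  The Walsh coefficients of a smooth integrand decay because turning one scrambled digit
  cyclically leaves the law of the scrambled point unchanged, multiplies the Walsh functions by a root of unity
  different from 1, and translates one coordinate of the interlaced point by a small amount. Differencing
  in at most \<open>\<alpha>\<close> digits per coordinate and applying Bessel's inequality to the resulting iterated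
  difference bounds the sum of the squared coefficients over all frequencies with given levels. Summing over
  the levels gives the bound for smooth functions, and approximation in \<open>L\<^sub>2\<close> extends it to the
  Sobolev space.
\<close>

section \<open>Integration on the cube\<close>

text \<open>The exponent \<open>(2 * min \<alpha> d + 1) * M\<close> with \<open>M = m - t\<close>
  has two sources. One factor \<open>b ^ M\<close> is the gain of a net mean. The others come from
  the coefficients: the digit at position \<open>(j, a)\<close> lies about \<open>d * a\<close>
  places deep in its interlaced coordinate, so turning it moves the point by about
  \<open>1 / b ^ (d * a)\<close>; with at most \<alpha> differences in a group of \<open>d\<close>
  coordinates, the depths add up to at least \<open>min \<alpha> d\<close> times the sum of the
  levels, up to a constant. The power of \<open>M + 2\<close> counts level vectors of a given sum. A
  turned digit wraps around, so the step of a difference depends on the scrambling. It takes only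
  two values, and summing over all choices of values restores fixed steps. A frequency supported on
  the groups in \<open>u\<close> sees only the marginal of the integrand on \<open>u\<close>, and
  one to \<alpha> differences in each group of \<open>u\<close> produce exactly a derivative that
  occurs in the Sobolev norm. The truncated integrand is a step function, so decay is proved for the
  coefficients of the smooth integrand only; Bessel's inequality controls the discrepancy.\<close>

abbreviation unit_interval :: "real measure" where
  "unit_interval \<equiv> restrict_space lborel {0..1}"

lemma prob_space_unit_interval: "prob_space unit_interval"
  by (rule prob_spaceI) (simp add: emeasure_restrict_space space_restrict_space)

lemma space_unit_interval [simp]: "space unit_interval = {0..1}"
  by (simp add: space_restrict_space)

interpretation cube: product_prob_space "\<lambda>_::nat. unit_interval" J for J
  by (intro product_prob_spaceI prob_space_unit_interval)

lemma prob_space_cube: "prob_space (cube u)"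
  unfolding cube_def by (rule cube.prob_space_axioms)

lemma space_cube [simp]: "space (cube u) = u \<rightarrow>\<^sub>E {0..1}"
  by (simp add: cube_def space_PiM)

lemma measurable_cube_coordinate [measurable]: "i \<in> u \<Longrightarrow> (\<lambda>x. x i) \<in> borel_measurable (cube u)"
  unfolding cube_def
  by (rule measurable_compose[OF measurable_component_singleton, where g="\<lambda>t. t"])
     (auto intro: measurable_restrict_space1)

text \<open>A shift may leave the cube, so shifted functions are made measurable on the full product
  of Borel spaces and then pulled back along this inclusion.\<close>

lemma measurable_cube_ident: "(\<lambda>x. x) \<in> measurable (cube u) (PiM u (\<lambda>_. borel))"
  by (rule measurable_PiM_single') (auto simp: PiE_iff)

lemma measurable_PiM_cubeI:
  assumes "f \<in> measurable M (PiM u (\<lambda>_. borel))" "f \<in> space M \<rightarrow> u \<rightarrow>\<^sub>E {0..1}"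
  shows "f \<in> measurable M (cube u)"
  unfolding cube_def
proof (rule measurable_PiM_single')
  fix i assume i: "i \<in> u"
  have "(\<lambda>x. f x i) \<in> borel_measurable M"
    by (rule measurable_compose[OF assms(1)]) (use i in simp)
  then show "(\<lambda>x. f x i) \<in> measurable M unit_interval"
    using assms(2) i by (intro measurable_restrict_space2) (auto simp: PiE_iff Pi_iff)
qed (use assms(2) in \<open>auto simp: PiE_iff Pi_iff\<close>)

lemma sets_cube_PiM_borel: "u \<rightarrow>\<^sub>E {0..1} \<in> sets (PiM u (\<lambda>_::nat. borel::real measure))"
  if "finite u"
  using that by (intro sets_PiM_I_finite) auto

text \<open>Outside \<open>u\<close> an extensional function takes the single value
  \<open>undefined\<close>, so the cube is a product over all of \<open>nat\<close> of compact sets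
  and Tychonoff's theorem applies.\<close>

lemma compact_cube: "compact (u \<rightarrow>\<^sub>E {0..1::real})" for u :: "nat set"
proof -
  have eq: "u \<rightarrow>\<^sub>E {0..1::real} = PiE UNIV (\<lambda>i. if i \<in> u then {0..1} else {undefined})"
    by (auto simp: PiE_def extensional_def Pi_iff split: if_splits)
  have "compactin (product_topology (\<lambda>_. euclidean) UNIV) (u \<rightarrow>\<^sub>E {0..1::real})"
    unfolding eq compactin_PiE by simp
  then show ?thesis
    by (simp add: euclidean_product_topology)
qed

text \<open>Continuity refers to the product topology on \<open>nat \<Rightarrow> real\<close>. Its
  Borel sets are those of \<open>PiM UNIV\<close>, so measurability is obtained by embedding the
  cube there.\<close>

lemma borel_measurable_continuous_on_cube:
  fixes f :: "(nat \<Rightarrow> real) \<Rightarrow> complex"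
  assumes "continuous_on (u \<rightarrow>\<^sub>E {0..1}) f"
  shows "f \<in> borel_measurable (cube u)"
proof -
  have 1: "(\<lambda>x. x) \<in> measurable (cube u) (PiM UNIV (\<lambda>_::nat. borel::real measure))"
  proof (rule measurable_PiM_single')
    fix i :: nat
    show "(\<lambda>x. x i) \<in> borel_measurable (cube u)"
    proof (cases "i \<in> u")
      case False
      then have "(\<lambda>x. x i) \<in> borel_measurable (cube u) \<longleftrightarrow> (\<lambda>x. undefined :: real) \<in> borel_measurable (cube u)"
        by (intro measurable_cong) (auto simp: PiE_iff extensional_def)
      then show ?thesis by simp
    qed simp
  qed auto
  have "(\<lambda>x. x) \<in> measurable (cube u) (restrict_space borel (u \<rightarrow>\<^sub>E {0..1}))"
    using 1 by (intro measurable_restrict_space2)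
      (auto simp: measurable_cong_sets[OF refl sets_PiM_equal_borel])
  then show ?thesis
    using measurable_compose borel_measurable_continuous_on_restrict[OF assms] by blast
qed

lemma bounded_continuous_on_cube:
  fixes f :: "(nat \<Rightarrow> real) \<Rightarrow> complex"
  assumes "continuous_on (u \<rightarrow>\<^sub>E {0..1}) f"
  obtains B where "\<And>x. x \<in> u \<rightarrow>\<^sub>E {0..1} \<Longrightarrow> cmod (f x) \<le> B"
proof -
  have "bounded (f ` (u \<rightarrow>\<^sub>E {0..1}))"
    by (rule compact_imp_bounded[OF compact_continuous_image[OF assms compact_cube]])
  then show ?thesis
    using that by (auto simp: bounded_iff)
qed

text \<open>Jensen's inequality for the square. With the right side in \<open>ennreal\<close>,
  \<open>v\<close> may be any measurable function: an infinite second moment makes the bound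
  trivial.\<close>

lemma (in prob_space) cmod_expectation_square_le:
  fixes v :: "'a \<Rightarrow> complex"
  assumes [measurable]: "v \<in> borel_measurable M"
  shows "ennreal ((cmod (expectation v))\<^sup>2) \<le> (\<integral>\<^sup>+x. ennreal ((cmod (v x))\<^sup>2) \<partial>M)"
proof (cases "(\<integral>\<^sup>+x. ennreal ((cmod (v x))\<^sup>2) \<partial>M) < \<infinity>")
  case True
  then have i2: "integrable M (\<lambda>x. (cmod (v x))\<^sup>2)"
    by (intro integrableI_bounded) auto
  have i1: "integrable M (\<lambda>x. cmod (v x))"
    by (rule square_integrable_imp_integrable[OF _ i2]) measurable
  have "(cmod (expectation v))\<^sup>2 \<le> (expectation (\<lambda>x. cmod (v x)))\<^sup>2"
    by (intro power_mono integral_norm_bound) auto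
  also have "\<dots> \<le> expectation (\<lambda>x. (cmod (v x))\<^sup>2)"
    using variance_positive[of "\<lambda>x. cmod (v x)"] variance_eq[OF i1 i2] by simp
  finally have "ennreal ((cmod (expectation v))\<^sup>2) \<le> ennreal (expectation (\<lambda>x. (cmod (v x))\<^sup>2))"
    by (rule ennreal_leI)
  also have "\<dots> = (\<integral>\<^sup>+x. ennreal ((cmod (v x))\<^sup>2) \<partial>M)"
    by (intro nn_integral_eq_integral[symmetric] i2) auto
  finally show ?thesis .
next
  case False
  then have "(\<integral>\<^sup>+x. ennreal ((cmod (v x))\<^sup>2) \<partial>M) = \<top>"
    by (metis less_top infinity_ennreal_def)
  then show ?thesis by simp
qed

text \<open>Only an inequality, since the translate may leave the cube.\<close>

lemma nn_integral_cube_shift_le: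
  assumes u: "finite u" "i \<in> u"
    and f: "f \<in> borel_measurable (PiM u (\<lambda>_. borel))"
    and out: "\<And>x. x \<notin> u \<rightarrow>\<^sub>E {0..1} \<Longrightarrow> f x = 0"
  shows "(\<integral>\<^sup>+x. f (x(i := x i + c)) \<partial>cube u) \<le> (\<integral>\<^sup>+x. f x \<partial>cube u)"
proof -
  define v where "v = u - {i}"
  have v: "finite v" "i \<notin> v" "u = insert i v"
    using u by (auto simp: v_def)
  have upd: "(\<lambda>x. x(i := x i + c)) \<in> measurable (cube u) (PiM u (\<lambda>_. borel))"
  proof (rule measurable_PiM_single')
    fix j assume "j \<in> u"
    then show "(\<lambda>x. (x(i := x i + c)) j) \<in> borel_measurable (cube u)"
      using u by (cases "j = i") auto
  qed (use u in \<open>auto simp: PiE_iff extensional_def\<close>)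
  have f1: "f \<in> borel_measurable (cube u)"
    using measurable_compose[OF measurable_cube_ident f] by simp
  have f2: "(\<lambda>x. f (x(i := x i + c))) \<in> borel_measurable (cube u)"
    using measurable_compose[OF upd f] .
  have "(\<integral>\<^sup>+x. f (x(i := x i + c)) \<partial>cube u)
      = (\<integral>\<^sup>+x. (\<integral>\<^sup>+t. f (x(i := t + c)) \<partial>unit_interval) \<partial>cube v)"
    unfolding cube_def v(3) using v f2
    by (subst cube.product_nn_integral_insert) (auto simp: cube_def)
  also have "\<dots> \<le> (\<integral>\<^sup>+x. (\<integral>\<^sup>+t. f (x(i := t)) \<partial>unit_interval) \<partial>cube v)"
  proof (rule nn_integral_mono)
    fix x assume "x \<in> space (cube v)"
    then have x: "x \<in> v \<rightarrow>\<^sub>E {0..1}" by simp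
    define g where "g t = f (x(i := t))" for t
    have "(\<lambda>t. x(i := t)) \<in> measurable borel (PiM u (\<lambda>_. borel))"
    proof (rule measurable_PiM_single')
      fix j assume "j \<in> u"
      then show "(\<lambda>t. (x(i := t)) j) \<in> borel_measurable borel"
        by (cases "j = i") auto
    qed (use x v in \<open>auto simp: PiE_iff extensional_def\<close>)
    then have g[measurable]: "g \<in> borel_measurable borel"
      unfolding g_def using measurable_compose f by blast
    have g0: "g t = 0" if "t \<notin> {0..1}" for t
      unfolding g_def using that v by (intro out) (auto simp: PiE_iff)
    \<comment> \<open>Enlarge the domain to the whole line, where translation preserves Lebesgue
      measure, and return to the interval, off which \<open>g\<close> vanishes.\<close>
    have "(\<integral>\<^sup>+t. g (t + c) \<partial>unit_interval) \<le> (\<integral>\<^sup>+t. g (t + c) \<partial>lborel)"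
      by (subst nn_integral_restrict_space) (auto intro!: nn_integral_mono simp: indicator_def)
    also have "\<dots> = (\<integral>\<^sup>+t. g t \<partial>lborel)"
      using nn_integral_real_affine[OF g, of 1 c] by (simp add: add.commute)
    also have "\<dots> = (\<integral>\<^sup>+t. g t \<partial>unit_interval)"
      by (subst nn_integral_restrict_space) (auto intro!: nn_integral_cong simp: indicator_def g0)
    finally show "(\<integral>\<^sup>+t. f (x(i := t + c)) \<partial>unit_interval) \<le> (\<integral>\<^sup>+t. f (x(i := t)) \<partial>unit_interval)"
      by (simp add: g_def)
  qed
  also have "\<dots> = (\<integral>\<^sup>+x. f x \<partial>cube u)"
    unfolding cube_def v(3) using v f1
    by (subst cube.product_nn_integral_insert) (auto simp: cube_def)
  finally show ?thesis .
qed

section \<open>Iterated differences of smooth functions\<close>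

text \<open>The notion of \<open>smooth_on_cube\<close> over an arbitrary set of coordinates,
  because marginals live on cubes over subsets of \<open>{1..s}\<close>.\<close>

definition cube_smooth :: "nat set \<Rightarrow> ((nat \<Rightarrow> real) \<Rightarrow> complex) \<Rightarrow> bool" where
  "cube_smooth u f \<longleftrightarrow>
     (\<forall>js\<in>lists u.
        continuous_on (u \<rightarrow>\<^sub>E {0..1}) (foldr partial js f) \<and>
        (\<forall>i\<in>u. \<forall>x\<in>u \<rightarrow>\<^sub>E {0..1}.
           (\<lambda>t. foldr partial js f (x(i := t))) differentiable (at (x i) within {0..1})))"

lemma smooth_on_cube_iff: "smooth_on_cube s f \<longleftrightarrow> cube_smooth {1..s} f"
  by (simp add: smooth_on_cube_def cube_smooth_def)

lemma cube_smooth_foldr: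
  assumes "cube_smooth u f" "is \<in> lists u"
  shows "cube_smooth u (foldr partial is f)"
proof -
  have "foldr partial js (foldr partial is f) = foldr partial (js @ is) f" for js
    by simp
  then show ?thesis
    using assms unfolding cube_smooth_def by (metis append_in_lists_conv)
qed

lemma cube_smooth_partial: "cube_smooth u f \<Longrightarrow> i \<in> u \<Longrightarrow> cube_smooth u (partial i f)"
  using cube_smooth_foldr[of u f "[i]"] by simp

lemma cube_smooth_continuous: "cube_smooth u f \<Longrightarrow> continuous_on (u \<rightarrow>\<^sub>E {0..1}) f"
  unfolding cube_smooth_def by (metis foldr_Nil id_apply lists.Nil)

lemma cube_smooth_has_vector_derivative:
  assumes f: "cube_smooth u f" and i: "i \<in> u" and x: "x(i := t) \<in> u \<rightarrow>\<^sub>E {0..1}"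
  shows "((\<lambda>t. f (x(i := t))) has_vector_derivative partial i f (x(i := t))) (at t within {0..1})"
proof -
  have "(\<lambda>t. f (x(i := t))) differentiable (at t within {0..1})"
    using bspec[OF conjunct2[OF bspec[OF f[unfolded cube_smooth_def], of "[]"]] i] x
    by (auto dest!: bspec[of _ _ "x(i := t)"])
  then show ?thesis
    by (simp add: vector_derivative_works partial_def)
qed

text \<open>The recursion moves the point and keeps the function, so that it runs parallel to
  \<open>turn_differences\<close>, where the moves come from the scrambling.\<close>

fun iterated_difference ::
    "(nat \<times> real) list \<Rightarrow> ((nat \<Rightarrow> real) \<Rightarrow> complex) \<Rightarrow> (nat \<Rightarrow> real) \<Rightarrow> complex" where
  "iterated_difference [] g x = g x"
| "iterated_difference ((i, h) # hs) g x =
     iterated_difference hs g (x(i := x i + h)) - iterated_difference hs g x"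

text \<open>The points all of whose \<open>2 ^ length hs\<close> partial shifts stay in the cube, so
  that the iterated difference evaluates \<open>g\<close> only there.\<close>

fun shift_domain :: "nat set \<Rightarrow> (nat \<times> real) list \<Rightarrow> (nat \<Rightarrow> real) set" where
  "shift_domain u [] = u \<rightarrow>\<^sub>E {0..1}"
| "shift_domain u ((i, h) # hs) = {x \<in> shift_domain u hs. x(i := x i + h) \<in> shift_domain u hs}"

lemma shift_domain_subset: "shift_domain u hs \<subseteq> u \<rightarrow>\<^sub>E {0..1}"
  by (induction u hs rule: shift_domain.induct) auto

text \<open>Puts the whole segment between a point and its shift into the domain, as the fundamental
  theorem of calculus requires. A step in the coordinate \<open>i\<close> itself translates the
  segment, a step elsewhere changes only the base point.\<close>

lemma shift_domain_convex:
  assumes "i \<in> u" "x(i := a) \<in> shift_domain u hs" "x(i := b) \<in> shift_domain u hs" "t \<in> {a..b}"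
  shows "x(i := t) \<in> shift_domain u hs"
  using assms
proof (induction hs arbitrary: x a b t)
  case Nil
  have "a \<in> {0..1}" "b \<in> {0..1}"
    using Nil.prems(1) PiE_mem[OF Nil.prems(2)[unfolded shift_domain.simps], of i]
      PiE_mem[OF Nil.prems(3)[unfolded shift_domain.simps], of i] by simp_all
  with Nil.prems(4) have "t \<in> {0..1}" by auto
  with Nil.prems(2) \<open>i \<in> u\<close> show ?case
    by (fastforce simp: PiE_iff extensional_def split: if_splits)
next
  case (Cons p hs)
  obtain j h where p: "p = (j, h)" by force
  have "x(i := t) \<in> shift_domain u hs"
    using Cons.prems p by (intro Cons.IH[of x a b t]) simp_all
  moreover have "(x(i := t))(j := (x(i := t)) j + h) \<in> shift_domain u hs"
  proof (cases "j = i")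
    case True
    have "x(i := a + h) \<in> shift_domain u hs"
      using Cons.prems(2)
      unfolding p True shift_domain.simps mem_Collect_eq fun_upd_upd fun_upd_same by (rule conjunct2)
    moreover have "x(i := b + h) \<in> shift_domain u hs"
      using Cons.prems(3)
      unfolding p True shift_domain.simps mem_Collect_eq fun_upd_upd fun_upd_same by (rule conjunct2)
    moreover have "t + h \<in> {a + h..b + h}"
      using Cons.prems(4) by simp
    ultimately have "x(i := t + h) \<in> shift_domain u hs"
      by (rule Cons.IH[OF \<open>i \<in> u\<close>])
    then show ?thesis
      unfolding True fun_upd_upd fun_upd_same .
  next
    case False
    then have tw: "(x(i := c))(j := (x(i := c)) j + h) = x(j := x j + h, i := c)" for c
      by (auto simp: fun_eq_iff)
    have "x(j := x j + h, i := a) \<in> shift_domain u hs"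
      using Cons.prems(2) unfolding p shift_domain.simps mem_Collect_eq tw by (rule conjunct2)
    moreover have "x(j := x j + h, i := b) \<in> shift_domain u hs"
      using Cons.prems(3) unfolding p shift_domain.simps mem_Collect_eq tw by (rule conjunct2)
    ultimately show ?thesis
      unfolding tw using Cons.prems(4) by (rule Cons.IH[OF \<open>i \<in> u\<close>])
  qed
  ultimately show ?case
    unfolding p shift_domain.simps mem_Collect_eq by (rule conjI)
qed

text \<open>Differentiation commutes with differencing. The set \<open>T\<close> is arbitrary
  because a step in the differentiated coordinate replaces it by a translate.\<close>

lemma has_vector_derivative_iterated_difference:
  assumes "cube_smooth u g" "i \<in> u"
    and "\<And>t. t \<in> T \<Longrightarrow> x(i := t) \<in> shift_domain u hs" and "t \<in> T"
  shows "((\<lambda>t. iterated_difference hs g (x(i := t))) has_vector_derivative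
            iterated_difference hs (partial i g) (x(i := t))) (at t within T)"
  using assms(3,4)
proof (induction hs arbitrary: x t T)
  case Nil
  have mem: "x(i := t) \<in> u \<rightarrow>\<^sub>E {0..1}" if "t \<in> T" for t
    using Nil.prems(1)[OF that] unfolding shift_domain.simps .
  have "T \<subseteq> {0..1}"
  proof
    fix t assume "t \<in> T"
    then show "t \<in> {0..1}"
      using PiE_mem[OF mem \<open>i \<in> u\<close>] by (simp del: atLeastAtMost_iff)
  qed
  moreover have "((\<lambda>t. g (x(i := t))) has_vector_derivative partial i g (x(i := t))) (at t within {0..1})"
    using assms(1,2) Nil.prems(2) mem by (intro cube_smooth_has_vector_derivative[of u])
  ultimately show ?case
    unfolding iterated_difference.simps by (rule has_vector_derivative_within_subset[rotated])
next
  case (Cons p hs)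
  obtain j h where p: "p = (j, h)" by force
  have 1: "((\<lambda>t. iterated_difference hs g (x(i := t))) has_vector_derivative
            iterated_difference hs (partial i g) (x(i := t))) (at t within T)"
    using Cons.prems p by (intro Cons.IH[of T x t]) simp_all
  have 2: "((\<lambda>t. iterated_difference hs g ((x(i := t))(j := (x(i := t)) j + h))) has_vector_derivative
            iterated_difference hs (partial i g) ((x(i := t))(j := (x(i := t)) j + h))) (at t within T)"
  proof (cases "j = i")
    case False
    have "x(j := x j + h, i := t') \<in> shift_domain u hs" if "t' \<in> T" for t'
      using Cons.prems(1)[OF that] False
      unfolding p shift_domain.simps mem_Collect_eq by (metis fun_upd_twist fun_upd_other)
    from Cons.IH[of T "x(j := x j + h)" t, OF this Cons.prems(2)]
    have "((\<lambda>t. iterated_difference hs g (x(j := x j + h, i := t))) has_vector_derivative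
            iterated_difference hs (partial i g) (x(j := x j + h, i := t))) (at t within T)" .
    moreover have "(x(i := t))(j := (x(i := t)) j + h) = x(j := x j + h, i := t)" for t
      using False by (auto simp: fun_eq_iff)
    ultimately show ?thesis by (simp only:)
  next
    case True
    define F where "F t = iterated_difference hs g (x(i := t))" for t
    have "x(i := t') \<in> shift_domain u hs" if t': "t' \<in> (\<lambda>t. t + h) ` T" for t'
    proof -
      obtain t where "t \<in> T" "t' = t + h" using t' by auto
      then show ?thesis
        using Cons.prems(1)[of t] unfolding p True shift_domain.simps mem_Collect_eq fun_upd_upd fun_upd_same
        by metis
    qed
    then have "(F has_vector_derivative iterated_difference hs (partial i g) (x(i := t + h)))
        (at (t + h) within (\<lambda>t. t + h) ` T)"
      unfolding F_def by (rule Cons.IH) (use Cons.prems(2) in auto)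
    moreover have "((\<lambda>t. t + h) has_vector_derivative 1) (at t within T)"
      by (auto intro!: derivative_eq_intros)
    ultimately have "(F \<circ> (\<lambda>t. t + h) has_vector_derivative
        1 *\<^sub>R iterated_difference hs (partial i g) (x(i := t + h))) (at t within T)"
      using vector_diff_chain_within by blast
    then show ?thesis
      using True by (simp add: F_def comp_def)
  qed
  show ?case
    using has_vector_derivative_diff[OF 2 1] unfolding p iterated_difference.simps .
qed

text \<open>The fundamental theorem of calculus trades the outermost difference for a derivative.
  Running through the segment with \<theta> in the unit interval treats both signs of
  \<open>h\<close> alike and makes the integral a mean, ready for Jensen's inequality.\<close>

lemma iterated_difference_Cons_eq_integral:
  assumes g: "cube_smooth u g" and i: "i \<in> u" and x: "x \<in> shift_domain u ((i, h) # hs)"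
  shows "\<And>\<theta>. \<theta> \<in> {0..1} \<Longrightarrow> x(i := x i + \<theta> * h) \<in> shift_domain u hs" (is "\<And>\<theta>. _ \<Longrightarrow> ?in \<theta>")
    and "iterated_difference ((i, h) # hs) g x =
           (LINT \<theta>|unit_interval. h *\<^sub>R iterated_difference hs (partial i g) (x(i := x i + \<theta> * h)))"
    and "(\<lambda>\<theta>. iterated_difference hs (partial i g) (x(i := x i + \<theta> * h))) \<in> borel_measurable unit_interval"
proof -
  have x0: "x(i := x i) \<in> shift_domain u hs" and x1: "x(i := x i + h) \<in> shift_domain u hs"
    using x by simp_all
  show mem: "?in \<theta>" if \<theta>: "\<theta> \<in> {0..1}" for \<theta>
  proof (cases "h \<ge> 0")
    case True
    have "x i + \<theta> * h \<in> {x i..x i + h}"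
      using \<theta> True by (auto intro: mult_left_le_one_le)
    then show ?thesis
      by (rule shift_domain_convex[OF i x0 x1])
  next
    case False
    have "x i + \<theta> * h \<in> {x i + h..x i}"
      using \<theta> False mult_left_le_one_le[of "-h" \<theta>] by (simp add: mult_nonneg_nonpos)
    then show ?thesis
      by (rule shift_domain_convex[OF i x1 x0])
  qed
  define G where "G g \<theta> = iterated_difference hs g (x(i := x i + \<theta> * h))" for g \<theta>
  have deriv: "(G g has_vector_derivative h *\<^sub>R G (partial i g) \<theta>) (at \<theta> within {0..1})"
    if g: "cube_smooth u g" and \<theta>: "\<theta> \<in> {0..1}" for g \<theta>
  proof -
    define T where "T = (\<lambda>\<theta>. x i + \<theta> * h) ` {0..1}"
    have "((\<lambda>t. iterated_difference hs g (x(i := t))) has_vector_derivative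
            G (partial i g) \<theta>) (at (x i + \<theta> * h) within T)"
      unfolding G_def using g i \<theta> mem
      by (intro has_vector_derivative_iterated_difference[of u]) (auto simp: T_def)
    moreover have "((\<lambda>\<theta>. x i + \<theta> * h) has_vector_derivative h) (at \<theta> within {0..1})"
      by (auto intro!: derivative_eq_intros)
    ultimately have "((\<lambda>t. iterated_difference hs g (x(i := t))) \<circ> (\<lambda>\<theta>. x i + \<theta> * h)
        has_vector_derivative h *\<^sub>R G (partial i g) \<theta>) (at \<theta> within {0..1})"
      unfolding T_def using vector_diff_chain_within by blast
    then show ?thesis
      by (simp add: G_def[abs_def] comp_def)
  qed
  have cont: "continuous_on {0..1} (G (partial i g))"
    using deriv[OF cube_smooth_partial[OF g i]]
    unfolding continuous_on_eq_continuous_within by (blast intro: has_vector_derivative_continuous)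
  have "(LINT \<theta>|lborel. indicator {0..1} \<theta> *\<^sub>R (h *\<^sub>R G (partial i g) \<theta>)) = G g 1 - G g 0"
    using cont deriv[OF g] by (intro integral_FTC_Icc) (auto intro!: continuous_intros)
  then show "iterated_difference ((i, h) # hs) g x =
           (LINT \<theta>|unit_interval. h *\<^sub>R iterated_difference hs (partial i g) (x(i := x i + \<theta> * h)))"
    by (subst integral_restrict_space) (auto simp: G_def)
  show "(\<lambda>\<theta>. iterated_difference hs (partial i g) (x(i := x i + \<theta> * h))) \<in> borel_measurable unit_interval"
    using borel_measurable_continuous_on_restrict[OF cont]
    unfolding G_def by (subst measurable_cong_sets[OF _ refl]) (auto simp: sets_restrict_space)
qed

lemma measurable_fun_upd_PiM:
  assumes "i \<in> u"
  shows "(\<lambda>(x, c). x(i := x i + c)) \<in>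
    measurable (PiM u (\<lambda>_. borel) \<Otimes>\<^sub>M borel) (PiM u (\<lambda>_::nat. borel :: real measure))"
proof (rule measurable_PiM_single')
  fix j assume [measurable]: "j \<in> u"
  have [measurable]: "i \<in> u" by fact
  show "(\<lambda>\<omega>. (case \<omega> of (x, c) \<Rightarrow> x(i := x i + c)) j) \<in>
    borel_measurable (PiM u (\<lambda>_. borel) \<Otimes>\<^sub>M (borel :: real measure))"
    by (cases "j = i") (auto simp: case_prod_beta)
qed (use assms in \<open>auto simp: space_pair_measure space_PiM PiE_iff extensional_def\<close>)

lemma measurable_fun_upd_PiM_const:
  assumes "i \<in> u"
  shows "(\<lambda>x. x(i := x i + c)) \<in> measurable (PiM u (\<lambda>_. borel)) (PiM u (\<lambda>_::nat. borel :: real measure))"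
  using measurable_compose[OF _ measurable_fun_upd_PiM[OF assms], of "\<lambda>x. (x, c)" "PiM u (\<lambda>_. borel)"]
  by simp

lemma sets_shift_domain:
  assumes "finite u" "fst ` set hs \<subseteq> u"
  shows "shift_domain u hs \<in> sets (PiM u (\<lambda>_. borel))"
  using assms(2)
proof (induction hs)
  case Nil
  show ?case using sets_cube_PiM_borel[OF assms(1)] by simp
next
  case (Cons p hs)
  obtain i h where p: "p = (i, h)" by force
  have i: "i \<in> u" and S: "shift_domain u hs \<in> sets (PiM u (\<lambda>_. borel))"
    using Cons p by auto
  have sub: "shift_domain u hs \<subseteq> space (PiM u (\<lambda>_. borel))"
    using sets.sets_into_space[OF S] .
  have "(\<lambda>x. x(i := x i + h)) -` shift_domain u hs \<inter> space (PiM u (\<lambda>_. borel)) \<in> sets (PiM u (\<lambda>_. borel))"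
    using measurable_sets[OF measurable_fun_upd_PiM_const[OF i] S] .
  moreover have "shift_domain u (p # hs) =
      shift_domain u hs \<inter> ((\<lambda>x. x(i := x i + h)) -` shift_domain u hs \<inter> space (PiM u (\<lambda>_. borel)))"
    using sub by (auto simp: p)
  ultimately show ?case using S by auto
qed

text \<open>\<open>g\<close> is unconstrained off the cube, so measurability is asserted only after
  cutting down to the shift domain.\<close>

lemma measurable_iterated_difference:
  assumes "finite u" "fst ` set hs \<subseteq> u" "continuous_on (u \<rightarrow>\<^sub>E {0..1}) g"
  shows "(\<lambda>x. indicator (shift_domain u hs) x *\<^sub>R iterated_difference hs g x)
            \<in> borel_measurable (PiM u (\<lambda>_. borel))"
  using assms(2)
proof (induction hs)
  case Nil
  have id: "(\<lambda>x. x) \<in> measurable (restrict_space (PiM u (\<lambda>_. borel)) (u \<rightarrow>\<^sub>E {0..1})) (cube u)"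
    by (intro measurable_PiM_cubeI measurable_restrict_space1) (auto simp: space_restrict_space)
  have "g \<in> borel_measurable (restrict_space (PiM u (\<lambda>_. borel)) (u \<rightarrow>\<^sub>E {0..1}))"
    using measurable_compose[OF id borel_measurable_continuous_on_cube[OF assms(3)]] .
  then show ?case
    using sets_cube_PiM_borel[OF assms(1)]
    by (subst (asm) borel_measurable_restrict_space_iff) auto
next
  case (Cons p hs)
  obtain i h where p: "p = (i, h)" by force
  have i: "i \<in> u" and hs: "fst ` set hs \<subseteq> u" using Cons p by auto
  let ?I = "\<lambda>x. indicator (shift_domain u hs) x *\<^sub>R iterated_difference hs g x"
  have m: "?I \<in> borel_measurable (PiM u (\<lambda>_. borel))"
    using Cons hs by simp
  have m': "(\<lambda>x. ?I (x(i := x i + h))) \<in> borel_measurable (PiM u (\<lambda>_. borel))"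
    by (rule measurable_compose[OF measurable_fun_upd_PiM_const[OF i] m])
  have "shift_domain u (p # hs) \<in> sets (PiM u (\<lambda>_. borel))"
    using sets_shift_domain assms(1) Cons.prems by blast
  then have "(\<lambda>x. indicator (shift_domain u (p # hs)) x *\<^sub>R (?I (x(i := x i + h)) - ?I x))
      \<in> borel_measurable (PiM u (\<lambda>_. borel))"
    using m m' by measurable
  moreover have "indicator (shift_domain u (p # hs)) x *\<^sub>R (?I (x(i := x i + h)) - ?I x)
      = indicator (shift_domain u (p # hs)) x *\<^sub>R iterated_difference (p # hs) g x" for x
    by (auto simp: p indicator_def)
  ultimately show ?case by simp
qed

text \<open>In mean square each difference costs its step and becomes a derivative: Jensen's
  inequality bounds the mean over \<theta>, Tonelli moves the \<theta>-integral outside, and there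
  the translation by \<open>\<theta> * h\<close> does not increase the integral. The list is
  reversed because the derivative belonging to the head is taken first.\<close>

lemma nn_integral_iterated_difference_le:
  assumes u: "finite u" "fst ` set hs \<subseteq> u" and g: "cube_smooth u g"
  shows "(\<integral>\<^sup>+x. ennreal ((cmod (indicator (shift_domain u hs) x *\<^sub>R iterated_difference hs g x))\<^sup>2) \<partial>cube u)
     \<le> ennreal ((\<Prod>(i, h)\<leftarrow>hs. h)\<^sup>2) *
        (\<integral>\<^sup>+x. ennreal ((cmod (foldr partial (rev (map fst hs)) g x))\<^sup>2) \<partial>cube u)"
  using u(2) g
proof (induction hs arbitrary: g)
  case Nil
  then show ?case
    by (auto intro!: nn_integral_mono simp: indicator_def)
next
  case (Cons p hs)
  obtain i h where p: "p = (i, h)" by force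
  have i: "i \<in> u" and hs: "fst ` set hs \<subseteq> u" using Cons p by auto
  interpret U: prob_space unit_interval by (rule prob_space_unit_interval)
  interpret C: prob_space "cube u" by (rule prob_space_cube)
  interpret CU: pair_sigma_finite "cube u" unit_interval ..
  have sm: "cube_smooth u (partial i g)"
    by (rule cube_smooth_partial) (use Cons.prems i in auto)
  define Q where "Q x = ennreal ((cmod (indicator (shift_domain u hs) x *\<^sub>R
      iterated_difference hs (partial i g) x))\<^sup>2)" for x
  have Q[measurable]: "Q \<in> borel_measurable (PiM u (\<lambda>_. borel))"
    unfolding Q_def using measurable_iterated_difference[OF u(1) hs cube_smooth_continuous[OF sm]]
    by measurable
  \<comment> \<open>The indicator in \<open>Q\<close> provides the vanishing off the cube that the
    translation bound demands.\<close>
  have Q0: "Q x = 0" if "x \<notin> u \<rightarrow>\<^sub>E {0..1}" for x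
    using that shift_domain_subset[of u hs] by (auto simp: Q_def indicator_def)
  have "(\<lambda>(x, \<theta>). (x, \<theta> * h)) \<in> measurable (cube u \<Otimes>\<^sub>M unit_interval) (PiM u (\<lambda>_. borel) \<Otimes>\<^sub>M borel)"
  proof -
    have [measurable]: "(\<lambda>\<theta>. \<theta>) \<in> measurable unit_interval borel"
      by (auto intro: measurable_restrict_space1)
    have [measurable]: "(\<lambda>x. x) \<in> measurable (cube u) (PiM u (\<lambda>_. borel))"
      by (rule measurable_cube_ident)
    have 1: "(\<lambda>z. fst z) \<in> measurable (cube u \<Otimes>\<^sub>M unit_interval) (PiM u (\<lambda>_. borel))"
      by (rule measurable_compose[OF measurable_fst]) measurable
    have 2: "(\<lambda>z. snd z) \<in> measurable (cube u \<Otimes>\<^sub>M unit_interval) borel"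
      by (rule measurable_compose[OF measurable_snd]) measurable
    show ?thesis
      unfolding case_prod_beta using 1 2 by measurable
  qed
  from measurable_compose[OF measurable_compose[OF this measurable_fun_upd_PiM[OF i]] Q]
  have Qm: "(\<lambda>(x, \<theta>). Q (x(i := x i + \<theta> * h))) \<in> borel_measurable (cube u \<Otimes>\<^sub>M unit_interval)"
    by (simp add: case_prod_beta)
  have "ennreal ((cmod (indicator (shift_domain u (p # hs)) x *\<^sub>R iterated_difference (p # hs) g x))\<^sup>2)
      \<le> (\<integral>\<^sup>+\<theta>. ennreal (h\<^sup>2) * Q (x(i := x i + \<theta> * h)) \<partial>unit_interval)" for x
  proof (cases "x \<in> shift_domain u (p # hs)")
    case True
    note eq = iterated_difference_Cons_eq_integral[OF Cons.prems(2) i True[unfolded p]]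
    have "ennreal ((cmod (iterated_difference (p # hs) g x))\<^sup>2) \<le>
        (\<integral>\<^sup>+\<theta>. ennreal ((cmod (h *\<^sub>R iterated_difference hs (partial i g) (x(i := x i + \<theta> * h))))\<^sup>2) \<partial>unit_interval)"
      unfolding p eq(2) using eq(3)
      by (intro prob_space.cmod_expectation_square_le prob_space_unit_interval borel_measurable_scaleR
          borel_measurable_const)
    also have "\<dots> = (\<integral>\<^sup>+\<theta>. ennreal (h\<^sup>2) * Q (x(i := x i + \<theta> * h)) \<partial>unit_interval)"
      using eq(1) by (intro nn_integral_cong)
        (auto simp: Q_def power_mult_distrib ennreal_mult indicator_def)
    finally show ?thesis using True by simp
  qed simp
  then have "(\<integral>\<^sup>+x. ennreal ((cmod (indicator (shift_domain u (p # hs)) x *\<^sub>R iterated_difference (p # hs) g x))\<^sup>2) \<partial>cube u)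
      \<le> (\<integral>\<^sup>+x. (\<integral>\<^sup>+\<theta>. ennreal (h\<^sup>2) * Q (x(i := x i + \<theta> * h)) \<partial>unit_interval) \<partial>cube u)"
    by (rule nn_integral_mono)
  also have "\<dots> = (\<integral>\<^sup>+\<theta>. (\<integral>\<^sup>+x. ennreal (h\<^sup>2) * Q (x(i := x i + \<theta> * h)) \<partial>cube u) \<partial>unit_interval)"
    using Qm by (intro CU.Fubini'[symmetric]) (auto simp: case_prod_beta)
  also have "\<dots> \<le> (\<integral>\<^sup>+\<theta>. ennreal (h\<^sup>2) * (\<integral>\<^sup>+x. Q x \<partial>cube u) \<partial>unit_interval)"
  proof (rule nn_integral_mono)
    fix \<theta>
    have "(\<lambda>x. Q (x(i := x i + \<theta> * h))) \<in> borel_measurable (cube u)"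
      by (rule measurable_compose[OF measurable_cube_ident
          measurable_compose[OF measurable_fun_upd_PiM_const[OF i] Q]])
    then show "(\<integral>\<^sup>+x. ennreal (h\<^sup>2) * Q (x(i := x i + \<theta> * h)) \<partial>cube u) \<le> ennreal (h\<^sup>2) * (\<integral>\<^sup>+x. Q x \<partial>cube u)"
      using nn_integral_cube_shift_le[OF u(1) i Q Q0, of "\<theta> * h"]
      by (simp add: nn_integral_cmult mult_left_mono)
  qed
  also have "\<dots> = ennreal (h\<^sup>2) * (\<integral>\<^sup>+x. Q x \<partial>cube u)"
    by (simp add: prob_space.emeasure_space_1[OF prob_space_unit_interval, simplified])
  also have "(\<integral>\<^sup>+x. Q x \<partial>cube u) \<le> ennreal ((\<Prod>(i, h)\<leftarrow>hs. h)\<^sup>2) *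
        (\<integral>\<^sup>+x. ennreal ((cmod (foldr partial (rev (map fst hs)) (partial i g) x))\<^sup>2) \<partial>cube u)"
    unfolding Q_def by (rule Cons.IH[OF hs sm])
  finally show ?case
    by (simp add: p power_mult_distrib ennreal_mult mult.assoc mult_left_mono)
qed

section \<open>Marginals of smooth functions\<close>

text \<open>Quotients can be tested along sequences, which is the form in which dominated
  convergence yields derivatives of marginals.\<close>

lemma has_vector_derivative_within_iff_quotient:
  fixes f :: "real \<Rightarrow> 'a::real_normed_vector"
  shows "(f has_vector_derivative D) (at x within S) \<longleftrightarrow>
           ((\<lambda>y. (f y - f x) /\<^sub>R (y - x)) \<longlongrightarrow> D) (at x within S)"
proof -
  have "((\<lambda>y. norm ((f y - f x) - (y - x) *\<^sub>R D) / norm (y - x)) \<longlongrightarrow> 0) (at x within S) \<longleftrightarrow>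
        ((\<lambda>y. norm ((f y - f x) /\<^sub>R (y - x) - D)) \<longlongrightarrow> 0) (at x within S)"
  proof (rule Lim_cong_within[OF refl refl refl])
    fix y assume "y \<noteq> x"
    then have "(f y - f x) /\<^sub>R (y - x) - D = ((f y - f x) - (y - x) *\<^sub>R D) /\<^sub>R (y - x)"
      by (simp add: scaleR_diff_right)
    then show "norm ((f y - f x) - (y - x) *\<^sub>R D) / norm (y - x) = norm ((f y - f x) /\<^sub>R (y - x) - D)"
      by (simp add: divide_inverse mult.commute)
  qed
  then show ?thesis
    unfolding has_vector_derivative_def has_derivative_iff_norm
    by (simp add: bounded_linear_scaleR_left tendsto_norm_zero_iff LIM_zero_iff)
qed

lemma merge_mem_cube:
  "x \<in> u \<rightarrow>\<^sub>E {0..1::real} \<Longrightarrow> y \<in> v \<rightarrow>\<^sub>E {0..1} \<Longrightarrow> merge u v (x, y) \<in> (u \<union> v) \<rightarrow>\<^sub>E {0..1}"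
  by (auto simp: merge_def PiE_iff extensional_def)

lemma fun_upd_mem_cube:
  "x \<in> u \<rightarrow>\<^sub>E {0..1::real} \<Longrightarrow> i \<in> u \<Longrightarrow> t \<in> {0..1} \<Longrightarrow> x(i := t) \<in> u \<rightarrow>\<^sub>E {0..1}"
  by (auto simp: PiE_iff extensional_def)

lemma merge_fun_upd: "i \<in> u \<Longrightarrow> merge u v (x(i := t), y) = (merge u v (x, y))(i := t)"
  by (auto simp: merge_def fun_eq_iff)

lemma continuous_on_merge_fst: "continuous_on X (\<lambda>x. merge u v (x, y :: nat \<Rightarrow> real))"
proof (rule continuous_on_coordinatewise_then_product)
  fix i
  have "continuous_on X (\<lambda>x :: nat \<Rightarrow> real. x i)"
    by (rule continuous_on_subset[OF continuous_on_product_coordinates]) simp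
  then show "continuous_on X (\<lambda>x. merge u v (x, y) i)"
    by (cases "i \<in> u") (simp_all add: merge_def)
qed

lemma continuous_on_merge_snd: "continuous_on X (\<lambda>y. merge u v (x :: nat \<Rightarrow> real, y))"
proof (rule continuous_on_coordinatewise_then_product)
  fix i
  have "continuous_on X (\<lambda>y :: nat \<Rightarrow> real. y i)"
    by (rule continuous_on_subset[OF continuous_on_product_coordinates]) simp
  then show "continuous_on X (\<lambda>y. merge u v (x, y) i)"
    by (cases "i \<in> u"; cases "i \<in> v") (simp_all add: merge_def)
qed

context
  fixes s :: nat and u :: "nat set"
  assumes u: "u \<subseteq> {1..s}"
begin

lemma merge_mem_unit_cube:
  assumes "x \<in> u \<rightarrow>\<^sub>E {0..1::real}" "y \<in> ({1..s} - u) \<rightarrow>\<^sub>E {0..1}"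
  shows "merge u ({1..s} - u) (x, y) \<in> {1..s} \<rightarrow>\<^sub>E {0..1}"
proof -
  have "u \<union> ({1..s} - u) = {1..s}" using u by blast
  then show ?thesis using merge_mem_cube[OF assms] by metis
qed

lemma measurable_marginal_integrand:
  fixes f :: "(nat \<Rightarrow> real) \<Rightarrow> complex"
  assumes "continuous_on ({1..s} \<rightarrow>\<^sub>E {0..1}) f" "x \<in> u \<rightarrow>\<^sub>E {0..1}"
  shows "(\<lambda>y. f (merge u ({1..s} - u) (x, y))) \<in> borel_measurable (cube ({1..s} - u))"
proof (rule borel_measurable_continuous_on_cube)
  have "continuous_on (({1..s} - u) \<rightarrow>\<^sub>E {0..1}) (f \<circ> (\<lambda>y. merge u ({1..s} - u) (x, y)))"
    by (intro continuous_on_compose continuous_on_merge_snd continuous_on_subset[OF assms(1)]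
        image_subsetI merge_mem_unit_cube assms(2))
  then show "continuous_on (({1..s} - u) \<rightarrow>\<^sub>E {0..1}) (\<lambda>y. f (merge u ({1..s} - u) (x, y)))"
    by (simp add: comp_def)
qed

lemma continuous_on_marginal:
  assumes f: "continuous_on ({1..s} \<rightarrow>\<^sub>E {0..1}) f"
  shows "continuous_on (u \<rightarrow>\<^sub>E {0..1}) (marginal s u f)"
proof (rule continuous_on_sequentiallyI)
  fix X :: "nat \<Rightarrow> nat \<Rightarrow> real" and a
  assume X: "\<forall>n. X n \<in> u \<rightarrow>\<^sub>E {0..1}" and a: "a \<in> u \<rightarrow>\<^sub>E {0..1}" and lim: "X \<longlonglongrightarrow> a"
  interpret C: prob_space "cube ({1..s} - u)" by (rule prob_space_cube)
  obtain B where B: "\<And>x. x \<in> {1..s} \<rightarrow>\<^sub>E {0..1} \<Longrightarrow> cmod (f x) \<le> B"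
    using bounded_continuous_on_cube[OF f] by metis
  show "(\<lambda>n. marginal s u f (X n)) \<longlonglongrightarrow> marginal s u f a"
    unfolding marginal_def
  proof (rule integral_dominated_convergence[where w = "\<lambda>_. B"])
    show "AE y in cube ({1..s} - u). (\<lambda>n. f (merge u ({1..s} - u) (X n, y))) \<longlonglongrightarrow>
        f (merge u ({1..s} - u) (a, y))"
    proof (rule AE_I2)
      fix y assume y: "y \<in> space (cube ({1..s} - u))"
      have "continuous_on (u \<rightarrow>\<^sub>E {0..1}) (f \<circ> (\<lambda>x. merge u ({1..s} - u) (x, y)))"
        using y unfolding space_cube
        by (intro continuous_on_compose continuous_on_merge_fst continuous_on_subset[OF f]
            image_subsetI merge_mem_unit_cube)
      then have "((f \<circ> (\<lambda>x. merge u ({1..s} - u) (x, y))) \<circ> X) \<longlonglongrightarrow> (f \<circ> (\<lambda>x. merge u ({1..s} - u) (x, y))) a"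
        using X a lim unfolding continuous_on_sequentially by blast
      then show "(\<lambda>n. f (merge u ({1..s} - u) (X n, y))) \<longlonglongrightarrow> f (merge u ({1..s} - u) (a, y))"
        by (simp add: comp_def)
    qed
    show "AE y in cube ({1..s} - u). cmod (f (merge u ({1..s} - u) (X n, y))) \<le> B" for n
      using X by (intro AE_I2 B merge_mem_unit_cube) auto
    show "(\<lambda>y. f (merge u ({1..s} - u) (X n, y))) \<in> borel_measurable (cube ({1..s} - u))" for n
      using X by (intro measurable_marginal_integrand f) blast
  qed (simp_all only: measurable_marginal_integrand[OF f a] C.integrable_const)
qed

text \<open>Differentiation under the integral sign. By the mean value inequality the difference
  quotients are dominated by a bound of \<open>partial i f\<close>, which is continuous on a compact
  cube.\<close>

lemma has_vector_derivative_marginal: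
  assumes f: "cube_smooth {1..s} f" and i: "i \<in> u" and x: "x(i := t) \<in> u \<rightarrow>\<^sub>E {0..1}"
  shows "((\<lambda>t. marginal s u f (x(i := t))) has_vector_derivative
            marginal s u (partial i f) (x(i := t))) (at t within {0..1})"
  unfolding has_vector_derivative_within_iff_quotient
proof (rule Lim_within_LIMSEQ, intro allI impI)
  fix S :: "nat \<Rightarrow> real" assume S: "(\<forall>n. S n \<noteq> t \<and> S n \<in> {0..1}) \<and> S \<longlonglongrightarrow> t"
  let ?v = "{1..s} - u"
  interpret C: prob_space "cube ?v" by (rule prob_space_cube)
  have i1: "i \<in> {1..s}" using i u by auto
  have cf: "continuous_on ({1..s} \<rightarrow>\<^sub>E {0..1}) f" "continuous_on ({1..s} \<rightarrow>\<^sub>E {0..1}) (partial i f)"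
    using f i1 by (auto intro!: cube_smooth_continuous cube_smooth_partial)
  obtain B where B: "\<And>x. x \<in> {1..s} \<rightarrow>\<^sub>E {0..1} \<Longrightarrow> cmod (partial i f x) \<le> B"
    using bounded_continuous_on_cube[OF cf(2)] by metis
  have tin: "t \<in> {0..1}"
    using PiE_mem[OF x i] by (simp del: atLeastAtMost_iff)
  have xin: "x(i := r) \<in> u \<rightarrow>\<^sub>E {0..1}" if "r \<in> {0..1}" for r
    using fun_upd_mem_cube[OF x i that] by (simp only: fun_upd_upd)
  have mem: "merge u ?v (x(i := r), y) \<in> {1..s} \<rightarrow>\<^sub>E {0..1}"
    if "r \<in> {0..1}" "y \<in> ?v \<rightarrow>\<^sub>E {0..1}" for r y
    by (intro merge_mem_unit_cube xin that)
  define F where "F y r = f (merge u ?v (x(i := r), y))" for y r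
  define F' where "F' y r = partial i f (merge u ?v (x(i := r), y))" for y r
  have deriv: "(F y has_vector_derivative F' y r) (at r within {0..1})"
    if "r \<in> {0..1}" "y \<in> ?v \<rightarrow>\<^sub>E {0..1}" for r y
    using cube_smooth_has_vector_derivative[OF f i1, of "merge u ?v (x, y)" r] mem[OF that]
    unfolding F_def F'_def merge_fun_upd[OF i] .
  have int: "integrable (cube ?v) (\<lambda>y. F y r)" if "r \<in> {0..1}" for r
  proof -
    obtain B where "\<And>x. x \<in> {1..s} \<rightarrow>\<^sub>E {0..1} \<Longrightarrow> cmod (f x) \<le> B"
      using bounded_continuous_on_cube[OF cf(1)] by metis
    then show ?thesis
      unfolding F_def
      by (intro C.integrable_const_bound[of _ B] AE_I2 measurable_marginal_integrand cf xin that)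
         (simp only: mem[OF that] space_cube)
  qed
  have lim: "(\<lambda>n. LINT y|cube ?v. (F y (S n) - F y t) /\<^sub>R (S n - t)) \<longlonglongrightarrow> (LINT y|cube ?v. F' y t)"
  proof (rule integral_dominated_convergence[where w = "\<lambda>_. B"])
    show "(\<lambda>y. F' y t) \<in> borel_measurable (cube ?v)"
      unfolding F'_def by (intro measurable_marginal_integrand cf xin tin)
    have "(\<lambda>y. F y r) \<in> borel_measurable (cube ?v)" if "r \<in> {0..1}" for r
      unfolding F_def by (intro measurable_marginal_integrand cf xin that)
    then show "(\<lambda>y. (F y (S n) - F y t) /\<^sub>R (S n - t)) \<in> borel_measurable (cube ?v)" for n
      using S tin by (intro borel_measurable_scaleR borel_measurable_diff) auto
    show "AE y in cube ?v. (\<lambda>n. (F y (S n) - F y t) /\<^sub>R (S n - t)) \<longlonglongrightarrow> F' y t"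
    proof (rule AE_I2)
      fix y assume y: "y \<in> space (cube ?v)"
      have "((\<lambda>r. (F y r - F y t) /\<^sub>R (r - t)) \<longlongrightarrow> F' y t) (at t within {0..1})"
        using deriv[of t y] tin y unfolding has_vector_derivative_within_iff_quotient by simp
      then have "((\<lambda>r. (F y r - F y t) /\<^sub>R (r - t)) \<circ> S) \<longlonglongrightarrow> F' y t"
        using S unfolding tendsto_at_iff_sequentially by blast
      then show "(\<lambda>n. (F y (S n) - F y t) /\<^sub>R (S n - t)) \<longlonglongrightarrow> F' y t"
        by (simp add: comp_def)
    qed
    show "AE y in cube ?v. norm ((F y (S n) - F y t) /\<^sub>R (S n - t)) \<le> B" for n
    proof (rule AE_I2)
      fix y assume y: "y \<in> space (cube ?v)"
      have "cmod (F y (S n) - F y t) \<le> B * norm (S n - t)"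
      proof (rule differentiable_bound[of "{0..1}" "F y" "\<lambda>r h. h *\<^sub>R F' y r"])
        show "(F y has_derivative (\<lambda>h. h *\<^sub>R F' y r)) (at r within {0..1})" if "r \<in> {0..1}" for r
          using deriv[OF that, of y] y unfolding has_vector_derivative_def by simp
        show "onorm (\<lambda>h. h *\<^sub>R F' y r) \<le> B" if "r \<in> {0..1}" for r
        proof (rule onorm_le)
          fix h
          have "cmod (F' y r) \<le> B"
            using B[OF mem[OF that]] y unfolding F'_def space_cube .
          then show "cmod (h *\<^sub>R F' y r) \<le> B * norm h"
            using mult_left_mono[of "cmod (F' y r)" B "\<bar>h\<bar>"] by (simp add: mult.commute)
        qed
      qed (use S tin in auto)
      then show "norm ((F y (S n) - F y t) /\<^sub>R (S n - t)) \<le> B"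
        using S by (simp add: divide_simps)
    qed
  qed (rule C.integrable_const)
  have quot: "(LINT y|cube ?v. (F y (S n) - F y t) /\<^sub>R (S n - t)) =
      (marginal s u f (x(i := S n)) - marginal s u f (x(i := t))) /\<^sub>R (S n - t)" for n
  proof -
    have "S n \<in> {0..1}" using S by blast
    from int[OF this] int[OF tin] show ?thesis
      unfolding marginal_def F_def[symmetric] by simp
  qed
  have limit: "(LINT y|cube ?v. F' y t) = marginal s u (partial i f) (x(i := t))"
    by (simp add: marginal_def F'_def)
  show "(\<lambda>n. (marginal s u f (x(i := S n)) - marginal s u f (x(i := t))) /\<^sub>R (S n - t))
      \<longlonglongrightarrow> marginal s u (partial i f) (x(i := t))"
    using lim unfolding quot limit .
qed

text \<open>The equality is confined to the cube, where derivatives are controlled. It can still be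
  differentiated, because \<open>partial\<close> looks only at coordinate segments inside the
  cube.\<close>

lemma foldr_partial_marginal:
  assumes f: "cube_smooth {1..s} f"
  shows "js \<in> lists u \<Longrightarrow> x \<in> u \<rightarrow>\<^sub>E {0..1} \<Longrightarrow>
    foldr partial js (marginal s u f) x = marginal s u (foldr partial js f) x"
proof (induction js arbitrary: x)
  case (Cons i js)
  have i: "i \<in> u" and js: "js \<in> lists u" using Cons.prems by auto
  let ?g = "foldr partial js f"
  have sm: "cube_smooth {1..s} ?g"
    using cube_smooth_foldr[OF f] js u by (meson in_lists_conv_set subsetD)
  have xi: "x i \<in> {0..1}" using Cons.prems(2) i by blast
  have "x(i := x i) \<in> u \<rightarrow>\<^sub>E {0..1}"
    using Cons.prems(2) by simp
  note deriv = has_vector_derivative_marginal[OF sm i this, unfolded fun_upd_triv]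
  have eq: "foldr partial js (marginal s u f) (x(i := t)) = marginal s u ?g (x(i := t))"
    if "t \<in> {0..1}" for t
    by (intro Cons.IH js fun_upd_mem_cube Cons.prems(2) i that)
  have "((\<lambda>t. foldr partial js (marginal s u f) (x(i := t))) has_vector_derivative
      marginal s u (partial i ?g) x) (at (x i) within {0..1})"
    by (rule has_vector_derivative_transform[OF xi eq deriv])
  then have "partial i (foldr partial js (marginal s u f)) x = marginal s u (partial i ?g) x"
    unfolding partial_def[of i "foldr partial js (marginal s u f)"] using xi
    by (intro vector_derivative_within_closed_interval) auto
  then show ?case by simp
qed simp

lemma cube_smooth_marginal:
  assumes f: "cube_smooth {1..s} f"
  shows "cube_smooth u (marginal s u f)"
  unfolding cube_smooth_def
proof (intro ballI conjI)
  fix js assume js: "js \<in> lists u"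
  have sm: "cube_smooth {1..s} (foldr partial js f)"
    using cube_smooth_foldr[OF f] js u by (meson in_lists_conv_set subsetD)
  have "continuous_on (u \<rightarrow>\<^sub>E {0..1}) (marginal s u (foldr partial js f))"
    by (intro continuous_on_marginal cube_smooth_continuous sm)
  then show "continuous_on (u \<rightarrow>\<^sub>E {0..1}) (foldr partial js (marginal s u f))"
    by (rule continuous_on_eq) (simp add: foldr_partial_marginal[OF f js])
  fix i and x :: "nat \<Rightarrow> real" assume i: "i \<in> u" and x: "x \<in> u \<rightarrow>\<^sub>E {0..1}"
  have xi: "x i \<in> {0..1}" using x i by blast
  have "x(i := x i) \<in> u \<rightarrow>\<^sub>E {0..1}"
    using x by simp
  note deriv = has_vector_derivative_marginal[OF sm i this, unfolded fun_upd_triv]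
  have eq: "foldr partial js (marginal s u f) (x(i := t)) = marginal s u (foldr partial js f) (x(i := t))"
    if "t \<in> {0..1}" for t
    by (intro foldr_partial_marginal[OF f js] fun_upd_mem_cube x i that)
  have "((\<lambda>t. foldr partial js (marginal s u f) (x(i := t))) has_vector_derivative
      marginal s u (partial i (foldr partial js f)) x) (at (x i) within {0..1})"
    by (rule has_vector_derivative_transform[OF xi eq deriv])
  then show "(\<lambda>t. foldr partial js (marginal s u f) (x(i := t))) differentiable (at (x i) within {0..1})"
    by (rule differentiableI_vector)
qed

end

section \<open>Bounded random variables and orthogonality\<close>

text \<open>A class closed under sums, products and conjugation whose members are integrable on
  every probability space; integrability goals become syntactic.\<close>

definition bounded_measurable :: "'a measure \<Rightarrow> ('a \<Rightarrow> complex) \<Rightarrow> bool" where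
  "bounded_measurable M f \<longleftrightarrow> f \<in> borel_measurable M \<and> (\<exists>B. \<forall>x\<in>space M. cmod (f x) \<le> B)"

lemma bounded_measurableI:
  "f \<in> borel_measurable M \<Longrightarrow> (\<And>x. x \<in> space M \<Longrightarrow> cmod (f x) \<le> B) \<Longrightarrow> bounded_measurable M f"
  by (auto simp: bounded_measurable_def)

lemma bounded_measurable_const: "bounded_measurable M (\<lambda>_. c)"
  by (auto simp: bounded_measurable_def)

lemma bounded_measurable_mult:
  assumes "bounded_measurable M f" "bounded_measurable M g"
  shows "bounded_measurable M (\<lambda>x. f x * g x)"
proof -
  obtain B C where *: "\<forall>x\<in>space M. cmod (f x) \<le> B" "\<forall>x\<in>space M. cmod (g x) \<le> C"
    using assms by (auto simp: bounded_measurable_def)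
  show ?thesis
  proof (rule bounded_measurableI[where B = "B * C"])
    show "(\<lambda>x. f x * g x) \<in> borel_measurable M"
      using assms by (auto simp: bounded_measurable_def)
    fix x assume "x \<in> space M"
    then have "cmod (f x) \<le> B" "cmod (g x) \<le> C" using * by auto
    moreover have "0 \<le> B" using \<open>cmod (f x) \<le> B\<close> norm_ge_zero order_trans by blast
    ultimately show "cmod (f x * g x) \<le> B * C"
      by (simp add: norm_mult mult_mono)
  qed
qed

lemma bounded_measurable_add:
  assumes "bounded_measurable M f" "bounded_measurable M g"
  shows "bounded_measurable M (\<lambda>x. f x + g x)"
proof -
  obtain B C where *: "\<forall>x\<in>space M. cmod (f x) \<le> B" "\<forall>x\<in>space M. cmod (g x) \<le> C"
    using assms by (auto simp: bounded_measurable_def)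
  show ?thesis
  proof (rule bounded_measurableI[where B = "B + C"])
    show "(\<lambda>x. f x + g x) \<in> borel_measurable M"
      using assms by (auto simp: bounded_measurable_def)
    show "cmod (f x + g x) \<le> B + C" if "x \<in> space M" for x
      using * that by (blast intro: norm_triangle_mono)
  qed
qed

lemma bounded_measurable_cnj:
  assumes "bounded_measurable M f"
  shows "bounded_measurable M (\<lambda>x. cnj (f x))"
proof -
  have "cnj \<in> borel_measurable borel"
    by (rule borel_measurable_continuous_onI) (rule continuous_on_cnj[OF continuous_on_id])
  with assms show ?thesis
    unfolding bounded_measurable_def using measurable_compose[of f M borel cnj borel] by auto
qed

lemma bounded_measurable_diff:
  assumes "bounded_measurable M f" "bounded_measurable M g"
  shows "bounded_measurable M (\<lambda>x. f x - g x)"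
  using bounded_measurable_add[OF assms(1) bounded_measurable_mult[OF bounded_measurable_const assms(2)],
      of "-1"] by simp

lemma bounded_measurable_divide:
  "bounded_measurable M f \<Longrightarrow> bounded_measurable M (\<lambda>x. f x / c)"
  unfolding divide_inverse by (rule bounded_measurable_mult[OF _ bounded_measurable_const])

lemma bounded_measurable_sum:
  "(\<And>k. k \<in> K \<Longrightarrow> bounded_measurable M (f k)) \<Longrightarrow> bounded_measurable M (\<lambda>x. \<Sum>k\<in>K. f k x)"
  by (induction K rule: infinite_finite_induct)
     (auto intro: bounded_measurable_const bounded_measurable_add)

lemmas bounded_measurable_intros =
  bounded_measurable_const bounded_measurable_mult bounded_measurable_add bounded_measurable_cnj
  bounded_measurable_diff bounded_measurable_divide bounded_measurable_sum

context prob_space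
begin

lemma integrable_bounded_measurable: "bounded_measurable M f \<Longrightarrow> integrable M f"
  by (auto simp: bounded_measurable_def intro: integrable_const_bound)

lemma integrable_cmod_square_bounded_measurable:
  assumes "bounded_measurable M f"
  shows "integrable M (\<lambda>x. (cmod (f x))\<^sup>2)"
proof -
  have "integrable M (\<lambda>x. f x * cnj (f x))"
    by (intro integrable_bounded_measurable bounded_measurable_intros assms)
  then have "integrable M (\<lambda>x. Re (f x * cnj (f x)))"
    by (rule integrable_Re)
  then show ?thesis
    by (simp add: complex_mult_cnj cmod_power2)
qed

lemma of_real_expectation_cmod_square:
  assumes "bounded_measurable M f"
  shows "complex_of_real (expectation (\<lambda>x. (cmod (f x))\<^sup>2)) = expectation (\<lambda>x. f x * cnj (f x))"
proof -
  have "f x * cnj (f x) = complex_of_real ((cmod (f x))\<^sup>2)" for x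
    by (rule complex_norm_square[symmetric])
  then show ?thesis by (simp del: of_real_power)
qed

text \<open>Pythagoras for functions that are orthogonal but not normalised, as the net means will
  be.\<close>

lemma expectation_cmod_square_orthogonal_sum:
  assumes K: "finite K" and S: "\<And>k. k \<in> K \<Longrightarrow> bounded_measurable M (S k)"
    and orth: "\<And>k l. k \<in> K \<Longrightarrow> l \<in> K \<Longrightarrow> k \<noteq> l \<Longrightarrow> expectation (\<lambda>x. S k x * cnj (S l x)) = 0"
  shows "expectation (\<lambda>x. (cmod (\<Sum>k\<in>K. c k * S k x))\<^sup>2) = (\<Sum>k\<in>K. (cmod (c k))\<^sup>2 * expectation (\<lambda>x. (cmod (S k x))\<^sup>2))"
proof -
  have bm: "bounded_measurable M (\<lambda>x. \<Sum>k\<in>K. c k * S k x)"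
    by (intro bounded_measurable_intros S)
  have int: "integrable M (\<lambda>x. c k * cnj (c l) * (S k x * cnj (S l x)))" if "k \<in> K" "l \<in> K" for k l
    by (intro integrable_bounded_measurable bounded_measurable_intros S that)
  have "complex_of_real (expectation (\<lambda>x. (cmod (\<Sum>k\<in>K. c k * S k x))\<^sup>2)) =
     expectation (\<lambda>x. \<Sum>k\<in>K. \<Sum>l\<in>K. c k * cnj (c l) * (S k x * cnj (S l x)))"
    unfolding of_real_expectation_cmod_square[OF bm] by (simp add: sum_product mult_ac)
  also have "\<dots> = (\<Sum>k\<in>K. \<Sum>l\<in>K. c k * cnj (c l) * expectation (\<lambda>x. S k x * cnj (S l x)))"
    using int by (subst Bochner_Integration.integral_sum) (auto intro!: sum.cong)
  also have "\<dots> = (\<Sum>k\<in>K. c k * cnj (c k) * expectation (\<lambda>x. S k x * cnj (S k x)))"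
  proof (rule sum.cong[OF refl])
    fix k assume k: "k \<in> K"
    have "(\<Sum>l\<in>K - {k}. c k * cnj (c l) * expectation (\<lambda>x. S k x * cnj (S l x))) = 0"
      by (rule sum.neutral) (use orth k in auto)
    then show "(\<Sum>l\<in>K. c k * cnj (c l) * expectation (\<lambda>x. S k x * cnj (S l x))) =
        c k * cnj (c k) * expectation (\<lambda>x. S k x * cnj (S k x))"
      using K k by (simp add: sum.remove)
  qed
  also have "\<dots> = complex_of_real (\<Sum>k\<in>K. (cmod (c k))\<^sup>2 * expectation (\<lambda>x. (cmod (S k x))\<^sup>2))"
    using S by (auto simp: of_real_expectation_cmod_square complex_norm_square simp del: of_real_power
        intro!: sum.cong)
  finally show ?thesis
    unfolding of_real_eq_iff .
qed

text \<open>The distance from \<open>Z\<close> to its projection has a nonnegative second moment. It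
  is applied both to iterated differences of the integrand and to the truncation error.\<close>

lemma bessel_inequality:
  assumes K: "finite K" and S: "\<And>k. k \<in> K \<Longrightarrow> bounded_measurable M (S k)"
    and orth: "\<And>k l. k \<in> K \<Longrightarrow> l \<in> K \<Longrightarrow> expectation (\<lambda>x. S k x * cnj (S l x)) = (if k = l then 1 else 0)"
    and Z: "bounded_measurable M Z"
  shows "(\<Sum>k\<in>K. (cmod (expectation (\<lambda>x. Z x * cnj (S k x))))\<^sup>2) \<le> expectation (\<lambda>x. (cmod (Z x))\<^sup>2)"
proof -
  define c where "c k = expectation (\<lambda>x. Z x * cnj (S k x))" for k
  define T where "T x = (\<Sum>k\<in>K. c k * S k x)" for x
  have T: "bounded_measurable M T"
    unfolding T_def by (intro bounded_measurable_intros S)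
  have norm1: "expectation (\<lambda>x. (cmod (S k x))\<^sup>2) = 1" if "k \<in> K" for k
    using of_real_expectation_cmod_square[OF S[OF that]] orth[OF that that] by simp
  have TT: "expectation (\<lambda>x. (cmod (T x))\<^sup>2) = (\<Sum>k\<in>K. (cmod (c k))\<^sup>2)"
    unfolding T_def using orth norm1
    by (subst expectation_cmod_square_orthogonal_sum[OF K S]) (auto intro!: sum.cong)
  have "expectation (\<lambda>x. Z x * cnj (T x)) = expectation (\<lambda>x. \<Sum>k\<in>K. cnj (c k) * (Z x * cnj (S k x)))"
    by (simp add: T_def sum_distrib_left mult_ac)
  also have "\<dots> = (\<Sum>k\<in>K. cnj (c k) * c k)"
    using S Z by (subst Bochner_Integration.integral_sum)
      (auto simp: c_def intro!: integrable_bounded_measurable bounded_measurable_intros sum.cong)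
  also have "\<dots> = complex_of_real (\<Sum>k\<in>K. (cmod (c k))\<^sup>2)"
    by (simp add: complex_norm_square mult.commute del: of_real_power)
  finally have ZT: "expectation (\<lambda>x. Z x * cnj (T x)) = complex_of_real (\<Sum>k\<in>K. (cmod (c k))\<^sup>2)" .
  define R where "R x = Re (Z x * cnj (T x))" for x
  have eq: "(cmod (Z x - T x))\<^sup>2 = (cmod (Z x))\<^sup>2 + (cmod (T x))\<^sup>2 - 2 * R x" for x
    by (simp add: R_def cmod_power2 power2_diff)
  have i: "integrable M (\<lambda>x. (cmod (Z x))\<^sup>2)" "integrable M (\<lambda>x. (cmod (T x))\<^sup>2)"
      "integrable M (\<lambda>x. Z x * cnj (T x))"
    by (intro integrable_cmod_square_bounded_measurable integrable_bounded_measurable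
        bounded_measurable_intros Z T)+
  have iR: "integrable M R" and eR: "expectation R = (\<Sum>k\<in>K. (cmod (c k))\<^sup>2)"
    unfolding R_def using integrable_Re[OF i(3)] integral_Re[OF i(3)] ZT by (simp_all del: of_real_sum)
  have "0 \<le> expectation (\<lambda>x. (cmod (Z x - T x))\<^sup>2)"
    by (rule integral_nonneg_AE) simp
  also have "\<dots> = expectation (\<lambda>x. (cmod (Z x))\<^sup>2) - (\<Sum>k\<in>K. (cmod (c k))\<^sup>2)"
    unfolding eq using i iR eR TT by simp
  finally show ?thesis by (simp add: c_def)
qed

end


section \<open>Walsh functions of the scrambled digits\<close>

text \<open>Applying a measure preserving map to one factor preserves an arbitrary product. It
  suffices to check finite cylinders, whose preimages are again cylinders with one side
  replaced.\<close>

lemma (in product_prob_space) distr_PiM_update: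
  assumes i: "i \<in> I" and T: "T \<in> measurable (M i) (M i)" "distr (M i) (M i) T = M i"
  shows "(\<lambda>\<omega>. fun_upd \<omega> i (T (\<omega> i))) \<in> measurable (PiM I M) (PiM I M)" (is "?R \<in> _")
    and "distr (PiM I M) (PiM I M) (\<lambda>\<omega>. fun_upd \<omega> i (T (\<omega> i))) = PiM I M"
proof -
  show R: "?R \<in> measurable (PiM I M) (PiM I M)"
  proof (rule measurable_PiM_single')
    fix j assume j: "j \<in> I"
    show "(\<lambda>\<omega>. ?R \<omega> j) \<in> measurable (PiM I M) (M j)"
    proof (cases "j = i")
      case True
      then show ?thesis
        using measurable_compose[OF measurable_component_singleton[OF i, of M] T(1)]
        unfolding True by (simp only: fun_upd_same)
    next
      case False
      then have "(\<lambda>\<omega>. ?R \<omega> j) = (\<lambda>\<omega>. \<omega> j)" by auto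
      then show ?thesis
        using measurable_component_singleton[OF j, of M] by (simp only:)
    qed
  next
    show "?R \<in> space (PiM I M) \<rightarrow> (\<Pi>\<^sub>E i\<in>I. space (M i))"
    proof
      fix \<omega> assume \<omega>: "\<omega> \<in> space (PiM I M)"
      then have "T (\<omega> i) \<in> space (M i)"
        using i by (intro measurable_space[OF T(1)]) (auto simp: space_PiM)
      then show "?R \<omega> \<in> (\<Pi>\<^sub>E i\<in>I. space (M i))"
        using \<omega> i by (auto simp: space_PiM PiE_iff extensional_def)
    qed
  qed
  show "distr (PiM I M) (PiM I M) ?R = PiM I M"
  proof (rule PiM_eq)
    fix J F assume J: "finite J" "J \<subseteq> I" and F: "\<And>j. j \<in> J \<Longrightarrow> F j \<in> sets (M j)"
    define F' where "F' j = (if j = i then T -` F i \<inter> space (M i) else F j)" for j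
    have F': "F' j \<in> sets (M j)" if "j \<in> J" for j
      using F[OF that] measurable_sets[OF T(1)] by (auto simp: F'_def)
    have "?R -` prod_emb I M J (Pi\<^sub>E J F) \<inter> space (PiM I M) = prod_emb I M J (Pi\<^sub>E J F')"
    proof (rule Set.set_eqI)
      fix \<omega>
      have emb: "\<omega> \<in> prod_emb I M J (Pi\<^sub>E J G) \<longleftrightarrow> \<omega> \<in> space (PiM I M) \<and> (\<forall>j\<in>J. \<omega> j \<in> G j)" for \<omega> G
        unfolding prod_emb_def space_PiM[symmetric] by (auto simp: PiE_iff)
      have "?R \<omega> \<in> space (PiM I M)" if "\<omega> \<in> space (PiM I M)"
        using measurable_space[OF R that] .
      moreover have "\<omega> i \<in> space (M i)" if "\<omega> \<in> space (PiM I M)"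
        using that i by (auto simp: space_PiM)
      then have "?R \<omega> j \<in> F j \<longleftrightarrow> \<omega> j \<in> F' j" if "\<omega> \<in> space (PiM I M)" for j
        using that by (cases "j = i") (simp_all add: F'_def)
      ultimately show "\<omega> \<in> ?R -` prod_emb I M J (Pi\<^sub>E J F) \<inter> space (PiM I M) \<longleftrightarrow>
          \<omega> \<in> prod_emb I M J (Pi\<^sub>E J F')"
        unfolding vimage_def emb Int_iff mem_Collect_eq by blast
    qed
    then have "emeasure (distr (PiM I M) (PiM I M) ?R) (prod_emb I M J (Pi\<^sub>E J F)) =
        emeasure (PiM I M) (prod_emb I M J (Pi\<^sub>E J F'))"
      using J F by (subst emeasure_distr[OF R]) auto
    also have "\<dots> = (\<Prod>j\<in>J. emeasure (M j) (F' j))"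
      using J F' by (intro emeasure_PiM_emb)
    also have "\<dots> = (\<Prod>j\<in>J. emeasure (M j) (F j))"
    proof (rule prod.cong[OF refl])
      fix j assume j: "j \<in> J"
      show "emeasure (M j) (F' j) = emeasure (M j) (F j)"
      proof (cases "j = i")
        case True
        then show ?thesis
          using emeasure_distr[OF T(1), of "F i"] F[OF j]
          unfolding True T(2) F'_def by (simp only: if_True)
      next
        case False
        then show ?thesis unfolding F'_def by (simp only: if_False)
      qed
    qed
    finally show "emeasure (distr (PiM I M) (PiM I M) ?R) (prod_emb I M J (Pi\<^sub>E J F)) =
        (\<Prod>j\<in>J. emeasure (M j) (F j))" .
  qed simp
qed

section \<open>Roots of unity and finite Walsh expansions\<close>

definition root_of_unity :: "nat \<Rightarrow> complex" where
  "root_of_unity b = exp (2 * of_real pi * \<i> / of_nat b)"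

lemma root_of_unity_power: "root_of_unity b ^ k = exp (2 * of_real pi * \<i> * of_nat k / of_nat b)"
  by (simp add: root_of_unity_def exp_of_nat_mult[symmetric] mult_ac)

lemma cmod_root_of_unity_power [simp]: "cmod (root_of_unity b ^ k) = 1"
proof -
  have "cmod (root_of_unity b) = 1"
    by (simp add: root_of_unity_def)
  then show ?thesis by (simp add: norm_power)
qed

lemma root_of_unity_power_eq_iff:
  "b > 0 \<Longrightarrow> root_of_unity b ^ j = root_of_unity b ^ k \<longleftrightarrow> j mod b = k mod b"
  unfolding root_of_unity_power using complex_root_unity_eq[of b j k] by simp

lemma root_of_unity_power_mult_cnj_eq_1_iff:
  assumes "b > 0"
  shows "root_of_unity b ^ j * cnj (root_of_unity b ^ k) = 1 \<longleftrightarrow> j mod b = k mod b"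
proof -
  have *: "cnj (root_of_unity b ^ k) * root_of_unity b ^ k = 1"
    using complex_norm_square[of "root_of_unity b ^ k"] by (simp add: mult.commute)
  have "root_of_unity b ^ j * cnj (root_of_unity b ^ k) = 1 \<longleftrightarrow> root_of_unity b ^ j = root_of_unity b ^ k"
  proof
    assume a: "root_of_unity b ^ j * cnj (root_of_unity b ^ k) = 1"
    have "root_of_unity b ^ j = root_of_unity b ^ j * (cnj (root_of_unity b ^ k) * root_of_unity b ^ k)"
      unfolding * by simp
    also have "\<dots> = root_of_unity b ^ k"
      unfolding mult.assoc[symmetric] a by simp
    finally show "root_of_unity b ^ j = root_of_unity b ^ k" .
  next
    assume "root_of_unity b ^ j = root_of_unity b ^ k"
    then show "root_of_unity b ^ j * cnj (root_of_unity b ^ k) = 1"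
      using * by (simp add: mult.commute)
  qed
  then show ?thesis using root_of_unity_power_eq_iff[OF assms] by blast
qed

lemma root_of_unity_power_eq_1_iff: "b > 0 \<Longrightarrow> root_of_unity b ^ k = 1 \<longleftrightarrow> b dvd k"
  using root_of_unity_power_eq_iff[of b k 0] by (simp add: mod_eq_0_iff_dvd)

lemma sum_root_of_unity_power_mult_cnj:
  assumes "b > 0" "x < b" "y < b"
  shows "(\<Sum>k<b. root_of_unity b ^ (k * x) * cnj (root_of_unity b ^ (k * y))) = (if x = y then of_nat b else 0)"
proof -
  define w where "w = root_of_unity b ^ x * cnj (root_of_unity b ^ y)"
  have "root_of_unity b ^ (k * x) * cnj (root_of_unity b ^ (k * y)) = w ^ k" for k
    by (simp add: w_def power_mult_distrib power_mult[symmetric] mult.commute)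
  then have eq: "(\<Sum>k<b. root_of_unity b ^ (k * x) * cnj (root_of_unity b ^ (k * y))) = (\<Sum>k<b. w ^ k)"
    by simp
  have "root_of_unity b ^ (x * b) = 1" "root_of_unity b ^ (y * b) = 1"
    using assms(1) by (simp_all add: root_of_unity_power_eq_1_iff)
  moreover have "w ^ b = root_of_unity b ^ (x * b) * cnj (root_of_unity b ^ (y * b))"
    unfolding w_def power_mult power_mult_distrib complex_cnj_power ..
  ultimately have "w ^ b = 1"
    by simp
  moreover have "w = 1 \<longleftrightarrow> x = y"
    using root_of_unity_power_mult_cnj_eq_1_iff[OF assms(1), of x y] assms by (simp add: w_def)
  ultimately show ?thesis
    unfolding eq by (cases "w = 1") (auto simp: geometric_sum)
qed

lemma sum_root_of_unity_power:
  assumes "b > 0" "0 < k" "k < b"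
  shows "(\<Sum>e<b. root_of_unity b ^ (k * e)) = 0"
  using sum_root_of_unity_power_mult_cnj[of b k 0] assms by (simp add: mult.commute)

text \<open>The characters of the group of digit vectors on \<open>A\<close>. A frequency is itself
  a digit vector, so its digit at each position can be read off directly.\<close>

definition walsh :: "nat \<Rightarrow> 'a set \<Rightarrow> ('a \<Rightarrow> nat) \<Rightarrow> ('a \<Rightarrow> nat) \<Rightarrow> complex" where
  "walsh b A k x = (\<Prod>p\<in>A. root_of_unity b ^ (k p * x p))"

lemma cmod_walsh [simp]: "cmod (walsh b A k x) = 1"
  by (simp add: walsh_def prod_norm[symmetric])

lemma walsh_mult_cnj [simp]: "walsh b A k x * cnj (walsh b A k x) = 1"
  using complex_norm_square[of "walsh b A k x"] by simp

lemma walsh_cong: "(\<And>p. p \<in> A \<Longrightarrow> x p = y p) \<Longrightarrow> walsh b A k x = walsh b A k y"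
  by (simp add: walsh_def)

lemma walsh_zero: "(\<And>p. p \<in> A \<Longrightarrow> k p = 0) \<Longrightarrow> walsh b A k x = 1"
  by (simp add: walsh_def)

text \<open>Orthogonality over the frequencies with the digit vectors held fixed; it writes the
  indicator of equality of two digit vectors as a character sum. The sum factorises over the
  positions.\<close>

lemma sum_walsh_mult_cnj:
  assumes "finite A" "b > 0" "\<And>p. p \<in> A \<Longrightarrow> x p < b" "\<And>p. p \<in> A \<Longrightarrow> y p < b"
  shows "(\<Sum>k\<in>A \<rightarrow>\<^sub>E {..<b}. walsh b A k x * cnj (walsh b A k y)) =
     (if \<forall>p\<in>A. x p = y p then of_nat b ^ card A else 0)"
proof -
  have "(\<Sum>k\<in>A \<rightarrow>\<^sub>E {..<b}. walsh b A k x * cnj (walsh b A k y)) =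
    (\<Sum>k\<in>A \<rightarrow>\<^sub>E {..<b}. \<Prod>p\<in>A. root_of_unity b ^ (k p * x p) * cnj (root_of_unity b ^ (k p * y p)))"
    by (simp add: walsh_def prod.distrib)
  also have "\<dots> = (\<Prod>p\<in>A. \<Sum>e<b. root_of_unity b ^ (e * x p) * cnj (root_of_unity b ^ (e * y p)))"
    using assms(1) by (intro prod_sum_PiE[symmetric]) auto
  also have "\<dots> = (\<Prod>p\<in>A. if x p = y p then of_nat b else 0)"
    using assms by (intro prod.cong refl sum_root_of_unity_power_mult_cnj) auto
  also have "\<dots> = (if \<forall>p\<in>A. x p = y p then of_nat b ^ card A else 0)"
    using assms(1) by (auto simp: prod_zero_iff)
  finally show ?thesis .
qed

lemma walsh_fourier_inversion:
  fixes G :: "('a \<Rightarrow> nat) \<Rightarrow> complex"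
  assumes A: "finite A" and b: "b > 0" and x: "\<And>p. p \<in> A \<Longrightarrow> x p < b"
  shows "G (restrict x A) = (\<Sum>k\<in>A \<rightarrow>\<^sub>E {..<b}.
     ((\<Sum>y\<in>A \<rightarrow>\<^sub>E {..<b}. G y * cnj (walsh b A k y)) / of_nat b ^ card A) * walsh b A k x)"
proof -
  have fin: "finite (A \<rightarrow>\<^sub>E {..<b})" using A by (intro finite_PiE) auto
  have "(\<Sum>k\<in>A \<rightarrow>\<^sub>E {..<b}. ((\<Sum>y\<in>A \<rightarrow>\<^sub>E {..<b}. G y * cnj (walsh b A k y)) / of_nat b ^ card A) * walsh b A k x)
    = (\<Sum>k\<in>A \<rightarrow>\<^sub>E {..<b}. \<Sum>y\<in>A \<rightarrow>\<^sub>E {..<b}. (G y / of_nat b ^ card A) * (walsh b A k x * cnj (walsh b A k y)))"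
    by (simp add: sum_distrib_left sum_divide_distrib mult_ac)
  also have "\<dots> = (\<Sum>y\<in>A \<rightarrow>\<^sub>E {..<b}. (G y / of_nat b ^ card A) *
      (\<Sum>k\<in>A \<rightarrow>\<^sub>E {..<b}. walsh b A k x * cnj (walsh b A k y)))"
    by (subst sum.swap) (simp add: sum_distrib_left)
  also have "\<dots> = (\<Sum>y\<in>A \<rightarrow>\<^sub>E {..<b}. if y = restrict x A then G y else 0)"
  proof (rule sum.cong[OF refl])
    fix y assume y: "y \<in> A \<rightarrow>\<^sub>E {..<b}"
    have "(\<forall>p\<in>A. x p = y p) \<longleftrightarrow> y = restrict x A"
      using y by (auto simp: fun_eq_iff PiE_iff extensional_def restrict_def)
    moreover have "(\<Sum>k\<in>A \<rightarrow>\<^sub>E {..<b}. walsh b A k x * cnj (walsh b A k y)) =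
        (if \<forall>p\<in>A. x p = y p then of_nat b ^ card A else 0)"
      using y by (intro sum_walsh_mult_cnj A b x) auto
    ultimately show "(G y / of_nat b ^ card A) * (\<Sum>k\<in>A \<rightarrow>\<^sub>E {..<b}. walsh b A k x * cnj (walsh b A k y)) =
        (if y = restrict x A then G y else 0)"
      using b by simp
  qed
  also have "\<dots> = G (restrict x A)"
    using fin x by (simp add: sum.delta)
  finally show ?thesis by simp
qed

text \<open>\<open>dg n j a\<close> stands for digit \<open>a\<close> of coordinate \<open>j\<close>
  of point \<open>n\<close>. Scrambling sees a point only through its digits, so this part is
  independent of the net.\<close>

locale scrambling =
  fixes b q :: nat and dg :: "nat \<Rightarrow> nat \<Rightarrow> nat \<Rightarrow> nat"
  assumes b2: "b \<ge> 2" and dg_less: "\<And>n j a. dg n j a < b"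
begin

lemma b0: "b > 0" using b2 by simp

abbreviation "perms \<equiv> {p. p permutes {..<b}}"
abbreviation "keys \<equiv> {1..q} \<times> lists {..<b}"
abbreviation "\<Omega> \<equiv> scramble_space b q"

sublocale S: product_prob_space "\<lambda>_. measure_pmf (pmf_of_set perms)" keys
  by (intro product_prob_spaceI measure_pmf.prob_space_axioms)

sublocale Om: prob_space \<Omega>
  unfolding scramble_space_def by (rule S.P.prob_space_axioms)

text \<open>The factor measures live on all functions \<open>nat \<Rightarrow> nat\<close>, so being
  a permutation is only an almost sure property. Exact identities are proved for good
  scramblings.\<close>

definition good :: "(nat \<times> nat list \<Rightarrow> nat \<Rightarrow> nat) \<Rightarrow> bool" where
  "good \<omega> \<longleftrightarrow> (\<forall>\<kappa>\<in>keys. \<omega> \<kappa> permutes {..<b})"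

lemma finite_perms: "finite perms" "perms \<noteq> {}"
proof -
  have "id \<in> perms" by (simp add: permutes_id)
  then show "perms \<noteq> {}" by blast
qed (simp add: finite_permutations)

lemma AE_good: "AE \<omega> in \<Omega>. good \<omega>"
proof -
  have "AE \<omega> in \<Omega>. \<omega> \<kappa> permutes {..<b}" if "\<kappa> \<in> keys" for \<kappa>
  proof -
    have "AE p in measure_pmf (pmf_of_set perms). p permutes {..<b}"
      using finite_perms by (simp add: AE_measure_pmf_iff)
    then show ?thesis
      unfolding scramble_space_def by (rule S.AE_component[OF that])
  qed
  then show ?thesis
    unfolding good_def by (subst AE_ball_countable) (auto intro: countable_lists)
qed

definition cyc :: "nat \<Rightarrow> nat" where
  "cyc e = (if e < b then (e + 1) mod b else e)"

lemma cyc_permutes: "cyc permutes {..<b}"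
proof (rule bij_imp_permutes)
  have "inj_on cyc {..<b}"
    by (auto simp: inj_on_def cyc_def mod_Suc split: if_splits)
  moreover have "cyc ` {..<b} \<subseteq> {..<b}"
    using b0 by (auto simp: cyc_def)
  ultimately show "bij_betw cyc {..<b} {..<b}"
    using endo_inj_surj[of "{..<b}" cyc] by (auto simp: bij_betw_def)
qed (simp add: cyc_def)

text \<open>A turn preserves the law of \<open>\<omega>\<close> and multiplies a Walsh function involving the turned digit by a
  root of unity: this gives the orthogonality relations and, by taking differences, the decay of
  Walsh coefficients.\<close>

definition turn :: "nat \<times> nat list \<Rightarrow> (nat \<times> nat list \<Rightarrow> nat \<Rightarrow> nat) \<Rightarrow> (nat \<times> nat list \<Rightarrow> nat \<Rightarrow> nat)" where
  "turn \<kappa> \<omega> = fun_upd \<omega> \<kappa> (cyc \<circ> \<omega> \<kappa>)"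

text \<open>Composition with a fixed permutation is a bijection of the symmetric group and so
  preserves its uniform law.\<close>

lemma distr_turn:
  assumes "\<kappa> \<in> keys"
  shows measurable_turn: "turn \<kappa> \<in> measurable \<Omega> \<Omega>" and "distr \<Omega> \<Omega> (turn \<kappa>) = \<Omega>"
proof -
  let ?U = "pmf_of_set perms"
  have "bij_betw ((\<circ>) cyc) perms perms"
  proof (rule bij_betw_byWitness[where f' = "(\<circ>) (inv_into UNIV cyc)"])
    show "\<forall>p\<in>perms. inv_into UNIV cyc \<circ> (cyc \<circ> p) = p" "\<forall>p\<in>perms. cyc \<circ> (inv_into UNIV cyc \<circ> p) = p"
      using permutes_inv_o[OF cyc_permutes] by (auto simp: o_assoc)
    show "(\<circ>) cyc ` perms \<subseteq> perms" "(\<circ>) (inv_into UNIV cyc) ` perms \<subseteq> perms"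
      using permutes_compose cyc_permutes permutes_inv[OF cyc_permutes] by auto
  qed
  then have "map_pmf ((\<circ>) cyc) ?U = ?U"
    using finite_perms by (intro map_pmf_of_set_bij_betw)
  then have "distr (measure_pmf ?U) (count_space UNIV) ((\<circ>) cyc) = measure_pmf ?U"
    by (metis map_pmf_rep_eq)
  moreover have "distr (measure_pmf ?U) (measure_pmf ?U) ((\<circ>) cyc) = distr (measure_pmf ?U) (count_space UNIV) ((\<circ>) cyc)"
    by (rule distr_cong) auto
  ultimately have "distr (measure_pmf ?U) (measure_pmf ?U) ((\<circ>) cyc) = measure_pmf ?U"
    by simp
  note * = S.distr_PiM_update[OF assms _ this]
  show "turn \<kappa> \<in> measurable \<Omega> \<Omega>" "distr \<Omega> \<Omega> (turn \<kappa>) = \<Omega>"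
    unfolding scramble_space_def turn_def[abs_def] using * by simp_all
qed

lemma good_turn: "good \<omega> \<Longrightarrow> \<kappa> \<in> keys \<Longrightarrow> good (turn \<kappa> \<omega>)"
  by (auto simp: good_def turn_def intro: permutes_compose cyc_permutes)

lemma expectation_turn:
  fixes f :: "_ \<Rightarrow> complex"
  assumes "\<kappa> \<in> keys" "f \<in> borel_measurable \<Omega>"
  shows "Om.expectation (\<lambda>\<omega>. f (turn \<kappa> \<omega>)) = Om.expectation f"
  using integral_distr[OF measurable_turn[OF assms(1)] assms(2)] distr_turn(2)[OF assms(1)] by simp

text \<open>Invariance of the law gives \<open>E f = c * E f\<close> with
  \<open>c \<noteq> 1\<close>.\<close>

lemma expectation_eq_0_turn:
  fixes f :: "_ \<Rightarrow> complex"
  assumes \<kappa>: "\<kappa> \<in> keys" and f: "f \<in> borel_measurable \<Omega>" and c: "c \<noteq> 1"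
    and eq: "\<And>\<omega>. good \<omega> \<Longrightarrow> f (turn \<kappa> \<omega>) = c * f \<omega>"
  shows "Om.expectation f = 0"
proof -
  have "Om.expectation f = Om.expectation (\<lambda>\<omega>. f (turn \<kappa> \<omega>))"
    using expectation_turn[OF \<kappa> f] by simp
  also have "\<dots> = Om.expectation (\<lambda>\<omega>. c * f \<omega>)"
    using AE_good eq f measurable_compose[OF measurable_turn[OF \<kappa>] f]
    by (intro integral_cong_AE) auto
  also have "\<dots> = c * Om.expectation f"
    by simp
  finally show ?thesis using c by simp
qed

text \<open>The node of the scrambling tree at which the digit of point \<open>n\<close> at position
  \<open>x\<close> is permuted.\<close>

definition key :: "nat \<Rightarrow> nat \<times> nat \<Rightarrow> nat \<times> nat list" where
  "key n x = (fst x, map (dg n (fst x)) [1..<snd x])"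

text \<open>Reducing modulo \<open>b\<close> only matters on the null set where some \<open>\<omega> \<kappa>\<close> is not a permutation.\<close>

definition scrambled_digit :: "nat \<Rightarrow> (nat \<times> nat list \<Rightarrow> nat \<Rightarrow> nat) \<Rightarrow> nat \<times> nat \<Rightarrow> nat" where
  "scrambled_digit n \<omega> x = \<omega> (key n x) (dg n (fst x) (snd x)) mod b"

abbreviation "positions \<equiv> {1..q} \<times> {1::nat..}"

lemma key_in_keys: "x \<in> positions \<Longrightarrow> key n x \<in> keys"
  using dg_less by (auto simp: key_def)

text \<open>The length of the digit string reveals the digit index, so no permutation acts at two
  different positions, not even for two different points. Hence a turn changes at most one digit of
  each point.\<close>

lemma key_eq_imp_eq: "x \<in> positions \<Longrightarrow> y \<in> positions \<Longrightarrow> key n x = key m y \<Longrightarrow> x = y"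
  by (auto simp: key_def prod_eq_iff dest!: arg_cong[of _ _ length])

lemma scrambled_digit_less [simp]: "scrambled_digit n \<omega> x < b"
  using b0 by (simp add: scrambled_digit_def)

lemma measurable_scrambled_digit:
  assumes "x \<in> positions"
  shows "(\<lambda>\<omega>. scrambled_digit n \<omega> x) \<in> measurable \<Omega> (count_space UNIV)"
proof -
  have "(\<lambda>\<omega>. \<omega> (key n x)) \<in> measurable \<Omega> (measure_pmf (pmf_of_set perms))"
    unfolding scramble_space_def by (rule measurable_component_singleton) (rule key_in_keys[OF assms])
  then show ?thesis
    unfolding scrambled_digit_def by (rule measurable_compose) simp
qed

lemma scrambled_digit_turn:
  assumes "good \<omega>" "x \<in> positions"
  shows "scrambled_digit n (turn \<kappa> \<omega>) x =
    (if key n x = \<kappa> then (scrambled_digit n \<omega> x + 1) mod b else scrambled_digit n \<omega> x)"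
proof -
  have "\<omega> (key n x) permutes {..<b}"
    using assms(1) key_in_keys[OF assms(2)] unfolding good_def by blast
  then have "\<omega> (key n x) (dg n (fst x) (snd x)) < b"
    using dg_less permutes_in_image by fastforce
  then show ?thesis
    by (auto simp: scrambled_digit_def turn_def cyc_def)
qed

definition W :: "(nat \<times> nat) set \<Rightarrow> nat \<Rightarrow> (nat \<times> nat \<Rightarrow> nat) \<Rightarrow> (nat \<times> nat list \<Rightarrow> nat \<Rightarrow> nat) \<Rightarrow> complex" where
  "W A n k \<omega> = walsh b A k (scrambled_digit n \<omega>)"

lemma bounded_measurable_W:
  assumes "A \<subseteq> positions"
  shows "bounded_measurable \<Omega> (W A n k)"
proof (rule bounded_measurableI[where B = 1])
  have "(\<lambda>\<omega>. root_of_unity b ^ (k x * scrambled_digit n \<omega> x)) \<in> borel_measurable \<Omega>" if "x \<in> A" for x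
    using measurable_compose[OF measurable_scrambled_digit[of x n], of "\<lambda>e. root_of_unity b ^ (k x * e)" borel] that assms
    by auto
  then show "W A n k \<in> borel_measurable \<Omega>"
    unfolding W_def[abs_def] walsh_def by (rule borel_measurable_prod)
qed (simp add: W_def)

lemma W_turn_other:
  assumes "good \<omega>" "A \<subseteq> positions" "\<And>x. x \<in> A \<Longrightarrow> key n x \<noteq> \<kappa>"
  shows "W A n k (turn \<kappa> \<omega>) = W A n k \<omega>"
  unfolding W_def using assms by (intro walsh_cong) (auto simp: scrambled_digit_turn)

lemma W_turn:
  assumes \<omega>: "good \<omega>" and A: "finite A" "A \<subseteq> positions" and x: "x \<in> A"
  shows "W A n k (turn (key n x) \<omega>) = root_of_unity b ^ k x * W A n k \<omega>"
proof -
  have "scrambled_digit n (turn (key n x) \<omega>) y = scrambled_digit n \<omega> y" if "y \<in> A - {x}" for y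
  proof -
    have y: "y \<in> positions" and "x \<in> positions" and "y \<noteq> x"
      using that A x by blast+
    then have "key n y \<noteq> key n x"
      using key_eq_imp_eq by blast
    then show ?thesis
      by (simp only: scrambled_digit_turn[OF \<omega> y] if_False)
  qed
  then have "(\<Prod>y\<in>A - {x}. root_of_unity b ^ (k y * scrambled_digit n (turn (key n x) \<omega>) y)) =
      (\<Prod>y\<in>A - {x}. root_of_unity b ^ (k y * scrambled_digit n \<omega> y))"
    by (intro prod.cong) auto
  moreover have "root_of_unity b ^ (k x * scrambled_digit n (turn (key n x) \<omega>) x) =
      root_of_unity b ^ k x * root_of_unity b ^ (k x * scrambled_digit n \<omega> x)"
  proof -
    have "scrambled_digit n (turn (key n x) \<omega>) x = (scrambled_digit n \<omega> x + 1) mod b"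
      using A x \<omega> by (auto simp: scrambled_digit_turn)
    then have "root_of_unity b ^ (k x * scrambled_digit n (turn (key n x) \<omega>) x) =
        root_of_unity b ^ (k x * (scrambled_digit n \<omega> x + 1))"
      by (simp add: root_of_unity_power_eq_iff[OF b0] mod_mult_right_eq)
    then show ?thesis by (simp add: power_add)
  qed
  ultimately show ?thesis
    using A(1) x by (simp add: W_def walsh_def prod.remove[of A x])
qed

text \<open>A pair survives only if the frequencies agree and the two points use the same
  permutation wherever the frequency is nonzero. Otherwise some turn multiplies the product by a
  root of unity different from 1.\<close>

lemma expectation_W_mult_cnj:
  assumes A: "finite A" "A \<subseteq> positions" and k: "k \<in> A \<rightarrow>\<^sub>E {..<b}" "l \<in> A \<rightarrow>\<^sub>E {..<b}"
    and ne: "\<not> (k = l \<and> (\<forall>x\<in>A. k x \<noteq> 0 \<longrightarrow> key n x = key m x))"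
  shows "Om.expectation (\<lambda>\<omega>. W A n k \<omega> * cnj (W A m l \<omega>)) = 0"
proof -
  obtain x where x: "x \<in> A" and
    cases: "k x \<noteq> l x \<and> key n x = key m x \<or> key n x \<noteq> key m x \<and> (k x \<noteq> 0 \<or> l x \<noteq> 0)"
  proof (cases "k = l")
    case True
    then show ?thesis using ne that by blast
  next
    case False
    then obtain x where "x \<in> A" "k x \<noteq> l x"
      using PiE_ext[OF k] by blast
    moreover from this have "k x \<noteq> 0 \<or> l x \<noteq> 0" by auto
    ultimately show ?thesis using that by blast
  qed
  have kl: "k x < b" "l x < b" using k x by auto
  have keys: "key n x \<in> keys" "key m x \<in> keys" using key_in_keys x A by blast+
  have meas: "(\<lambda>\<omega>. W A n k \<omega> * cnj (W A m l \<omega>)) \<in> borel_measurable \<Omega>"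
    using bounded_measurable_mult[OF bounded_measurable_W bounded_measurable_cnj[OF bounded_measurable_W]] A
    by (auto simp: bounded_measurable_def)
  have other: "key n' y \<noteq> key m' x" if "key n' x \<noteq> key m' x" "y \<in> A" for n' m' y
    using key_eq_imp_eq[of y x n' m'] that A x by auto
  \<comment> \<open>Either a permutation common to both points is turned, which produces the
    quotient of two distinct roots, or one that only one of the points uses, which produces a single
    nontrivial root.\<close>
  consider "k x \<noteq> l x" "key n x = key m x" | "key n x \<noteq> key m x" "k x \<noteq> 0" | "key n x \<noteq> key m x" "l x \<noteq> 0"
    using cases by blast
  then show ?thesis
  proof cases
    case 1
    have "root_of_unity b ^ k x * cnj (root_of_unity b ^ l x) \<noteq> 1"
      using root_of_unity_power_mult_cnj_eq_1_iff[OF b0] 1 kl by simp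
    then show ?thesis
      using W_turn[OF _ A x, of _ n k] W_turn[OF _ A x, of _ m l] 1(2)
      by (intro expectation_eq_0_turn[OF keys(1) meas]) (auto simp: mult_ac)
  next
    case 2
    have "root_of_unity b ^ k x \<noteq> 1"
      using root_of_unity_power_eq_1_iff[OF b0] 2 kl by (auto dest: dvd_imp_le)
    then show ?thesis
      using W_turn[OF _ A x, of _ n k] W_turn_other[OF _ A(2) other[OF 2(1)[symmetric]], of _ l]
      by (intro expectation_eq_0_turn[OF keys(1) meas]) (auto simp: mult_ac)
  next
    case 3
    have "root_of_unity b ^ l x \<noteq> 1"
      using root_of_unity_power_eq_1_iff[OF b0] 3 kl by (auto dest: dvd_imp_le)
    then have "cnj (root_of_unity b ^ l x) \<noteq> 1"
      by (metis complex_cnj_cnj complex_cnj_one)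
    then show ?thesis
      using W_turn[OF _ A x, of _ m l] W_turn_other[OF _ A(2) other[OF 3(1)], of _ k]
      by (intro expectation_eq_0_turn[OF keys(2) meas]) (auto simp: mult_ac)
  qed
qed

lemma expectation_W_orthonormal:
  assumes A: "finite A" "A \<subseteq> positions" and k: "k \<in> A \<rightarrow>\<^sub>E {..<b}" "l \<in> A \<rightarrow>\<^sub>E {..<b}"
  shows "Om.expectation (\<lambda>\<omega>. W A n k \<omega> * cnj (W A n l \<omega>)) = (if k = l then 1 else 0)"
proof (cases "k = l")
  case True
  then show ?thesis by (simp add: W_def Om.prob_space)
next
  case False
  then show ?thesis using expectation_W_mult_cnj[OF assms, of n n] by simp
qed

text \<open>The digits of one scrambled point are independent and uniform. This is read off from the
  vanishing mean of every nontrivial character, by expanding the indicator of the event into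
  characters.\<close>

lemma prob_scrambled_digits:
  assumes A: "finite A" "A \<subseteq> positions" and e: "\<And>x. x \<in> A \<Longrightarrow> e x < b"
  shows "Om.prob {\<omega>\<in>space \<Omega>. \<forall>x\<in>A. scrambled_digit n \<omega> x = e x} = 1 / real b ^ card A"
proof -
  let ?K = "A \<rightarrow>\<^sub>E {..<b}"
  let ?E = "{\<omega>\<in>space \<Omega>. \<forall>x\<in>A. scrambled_digit n \<omega> x = e x}"
  define z where "z = (\<lambda>x\<in>A. 0 :: nat)"
  have z: "z \<in> ?K" using b0 by (auto simp: z_def)
  have Wz: "W A n z \<omega> = 1" for \<omega>
    unfolding W_def by (rule walsh_zero) (simp add: z_def)
  have fin: "finite ?K" using A by (intro finite_PiE) auto
  have ind: "(\<Sum>k\<in>?K. cnj (walsh b A k e) * W A n k \<omega>) = of_nat b ^ card A * indicator ?E \<omega>"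
    if "\<omega> \<in> space \<Omega>" for \<omega>
    using sum_walsh_mult_cnj[OF A(1) b0, of "scrambled_digit n \<omega>" e] e that
    by (auto simp: W_def mult.commute indicator_def)
  have W0: "Om.expectation (W A n k) = (if k = z then 1 else 0)" if "k \<in> ?K" for k
    using expectation_W_orthonormal[OF A that z, of n] by (simp add: Wz)
  have "?E \<in> Om.events"
  proof -
    have "{\<omega>\<in>space \<Omega>. scrambled_digit n \<omega> x = e x} \<in> Om.events" if "x \<in> A" for x
    proof -
      have "x \<in> positions" using that A by blast
      from measurable_sets[OF measurable_scrambled_digit[OF this], of "{e x}" n]
      have "(\<lambda>\<omega>. scrambled_digit n \<omega> x) -` {e x} \<inter> space \<Omega> \<in> Om.events" by simp
      then show ?thesis by (simp add: vimage_def Int_def conj_commute)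
    qed
    then show ?thesis
      using A(1) by (intro sets.sets_Collect_finite_All) auto
  qed
  then have "Om.expectation (\<lambda>\<omega>. complex_of_real (indicator ?E \<omega>)) = complex_of_real (Om.prob ?E)"
    by simp
  moreover have "complex_of_real (indicator ?E \<omega>) = indicator ?E \<omega>" for \<omega>
    by (simp add: indicator_def)
  ultimately have "of_nat b ^ card A * complex_of_real (Om.prob ?E) = Om.expectation (\<lambda>\<omega>. of_nat b ^ card A * indicator ?E \<omega>)"
    by simp
  also have "\<dots> = Om.expectation (\<lambda>\<omega>. \<Sum>k\<in>?K. cnj (walsh b A k e) * W A n k \<omega>)"
    using ind by (intro Bochner_Integration.integral_cong) auto
  also have "\<dots> = (\<Sum>k\<in>?K. cnj (walsh b A k e) * Om.expectation (W A n k))"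
    using bounded_measurable_W[OF A(2)]
    by (subst Bochner_Integration.integral_sum) (auto intro!: Om.integrable_bounded_measurable bounded_measurable_intros)
  also have "\<dots> = (\<Sum>k\<in>?K. if k = z then cnj (walsh b A z e) else 0)"
    using W0 by (intro sum.cong) auto
  also have "\<dots> = cnj (walsh b A z e)"
    using fin z by simp
  also have "walsh b A z e = 1"
    by (rule walsh_zero) (simp add: z_def)
  finally have "complex_of_real (real b ^ card A * Om.prob ?E) = 1"
    by simp
  then have "real b ^ card A * Om.prob ?E = 1"
    using of_real_eq_1_iff by blast
  then show ?thesis
    using b0 by (simp add: field_simps)
qed

end

section \<open>Digit expansions\<close>

definition digit_series :: "nat \<Rightarrow> (nat \<Rightarrow> nat) \<Rightarrow> real" where
  "digit_series b e = (\<Sum>p. real (e p) / real b ^ Suc p)"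

text \<open>The integer formed by the first \<open>n\<close> digits, most significant first: for
  digits below \<open>b\<close>, the floor of \<open>b ^ n\<close> times the series unless the
  remaining tail equals 1.\<close>

primrec digits_nat :: "nat \<Rightarrow> (nat \<Rightarrow> nat) \<Rightarrow> nat \<Rightarrow> nat" where
  "digits_nat b e 0 = 0"
| "digits_nat b e (Suc n) = b * digits_nat b e n + e n"

lemma digits_nat_cong: "(\<And>p. p < n \<Longrightarrow> e p = e' p) \<Longrightarrow> digits_nat b e n = digits_nat b e' n"
  by (induction n) auto

lemma sum_digits_eq: "b > 0 \<Longrightarrow> (\<Sum>p<n. real (e p) / real b ^ Suc p) = real (digits_nat b e n) / real b ^ n"
  by (induction n) (auto simp: field_simps)

lemma digits_nat_inj:
  assumes "\<And>p. p < n \<Longrightarrow> e p < b" "\<And>p. p < n \<Longrightarrow> e' p < b" "digits_nat b e n = digits_nat b e' n"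
  shows "p < n \<Longrightarrow> e p = e' p"
  using assms
proof (induction n arbitrary: p)
  case (Suc n)
  have "e n < b" "e' n < b" using Suc.prems by auto
  then have 1: "e n = e' n" and 2: "digits_nat b e n = digits_nat b e' n"
    using arg_cong[OF Suc.prems(4), of "\<lambda>x. x mod b"] arg_cong[OF Suc.prems(4), of "\<lambda>x. x div b"] by auto
  show ?case
  proof (cases "p = n")
    case False
    then show ?thesis using Suc.IH[of p] Suc.prems 2 by auto
  qed (use 1 in simp)
qed simp

lemma digits_nat_surj:
  assumes "b > 0" "c < b ^ n"
  obtains e where "\<And>p. e p < b" "digits_nat b e n = c"
proof -
  have "c < b ^ n \<Longrightarrow> \<exists>e. (\<forall>p. e p < b) \<and> digits_nat b e n = c" for c
  proof (induction n arbitrary: c)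
    case 0
    then show ?case using assms(1) by (auto intro!: exI[of _ "\<lambda>_. 0"])
  next
    case (Suc n)
    have "c div b < b ^ n"
      using Suc.prems by (simp add: less_mult_imp_div_less mult.commute)
    then obtain e where e: "\<forall>p. e p < b" "digits_nat b e n = c div b"
      using Suc.IH by blast
    define e' where "e' p = (if p = n then c mod b else e p)" for p
    have "digits_nat b e' n = c div b"
      using e(2) digits_nat_cong[of n e' e b] by (simp add: e'_def)
    then have "digits_nat b e' (Suc n) = c"
      by (simp add: e'_def)
    moreover have "\<forall>p. e' p < b"
      using e(1) assms(1) by (simp add: e'_def)
    ultimately show ?case by blast
  qed
  then show ?thesis using assms(2) that by blast
qed

context
  fixes b :: nat and e :: "nat \<Rightarrow> nat"
  assumes b2: "b \<ge> 2" and e: "\<And>p. e p < b"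
begin

lemma sums_digit_series_max: "(\<lambda>p. real (b - 1) / real b ^ Suc p) sums 1"
proof -
  have "(\<lambda>p. (1 / real b) ^ p) sums (1 / (1 - 1 / real b))"
    using b2 by (intro geometric_sums) auto
  from sums_mult[OF this, of "real (b - 1) / real b"] show ?thesis
    using b2 by (simp add: field_simps power_divide of_nat_diff)
qed

lemma summable_digits: "summable (\<lambda>p. real (e p) / real b ^ Suc p)"
proof (rule summable_comparison_test'[OF sums_summable[OF sums_digit_series_max]])
  fix p
  have "e p \<le> b - 1" using e[of p] by simp
  then show "norm (real (e p) / real b ^ Suc p) \<le> real (b - 1) / real b ^ Suc p"
    by (simp add: divide_right_mono)
qed

lemma digit_series_nonneg: "digit_series b e \<ge> 0"
  unfolding digit_series_def by (intro suminf_nonneg summable_digits) simp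

lemma digit_series_eq_diff:
  "digit_series b e = 1 - (\<Sum>p. real (b - 1 - e p) / real b ^ Suc p)"
  "summable (\<lambda>p. real (b - 1 - e p) / real b ^ Suc p)"
proof -
  have *: "real (b - 1) / real b ^ Suc p - real (e p) / real b ^ Suc p = real (b - 1 - e p) / real b ^ Suc p" for p
  proof -
    have "real (b - 1 - e p) = real (b - 1) - real (e p)"
      using e[of p] by (intro of_nat_diff) simp
    then show ?thesis by (simp only: diff_divide_distrib)
  qed
  from sums_diff[OF sums_digit_series_max summable_sums[OF summable_digits]]
  have s: "(\<lambda>p. real (b - 1 - e p) / real b ^ Suc p) sums (1 - digit_series b e)"
    unfolding digit_series_def * .
  then show "digit_series b e = 1 - (\<Sum>p. real (b - 1 - e p) / real b ^ Suc p)"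
    using sums_unique by force
  show "summable (\<lambda>p. real (b - 1 - e p) / real b ^ Suc p)"
    using s by (rule sums_summable)
qed

lemma digit_series_le_1: "digit_series b e \<le> 1"
  using digit_series_eq_diff(1) suminf_nonneg[OF digit_series_eq_diff(2)] by simp

lemma digit_series_less_1:
  assumes "e p \<noteq> b - 1"
  shows "digit_series b e < 1"
proof -
  have "e p < b - 1" using e[of p] assms by simp
  then have "0 < real (b - 1 - e p) / real b ^ Suc p"
    using b2 by (intro divide_pos_pos) auto
  then have "0 < (\<Sum>p. real (b - 1 - e p) / real b ^ Suc p)"
    by (intro suminf_pos2[OF digit_series_eq_diff(2)]) auto
  then show ?thesis using digit_series_eq_diff(1) by simp
qed

end

lemma digit_series_split:
  assumes "b \<ge> 2" "\<And>p. e p < b"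
  shows "digit_series b e = (real (digits_nat b e n) + digit_series b (\<lambda>p. e (p + n))) / real b ^ n"
proof -
  have "digit_series b e = (\<Sum>p. real (e (p + n)) / real b ^ Suc (p + n)) + (\<Sum>p<n. real (e p) / real b ^ Suc p)"
    unfolding digit_series_def by (rule suminf_split_initial_segment[OF summable_digits[OF assms]])
  also have "(\<Sum>p<n. real (e p) / real b ^ Suc p) = real (digits_nat b e n) / real b ^ n"
    using assms(1) by (intro sum_digits_eq) simp
  also have "(\<Sum>p. real (e (p + n)) / real b ^ Suc (p + n)) = (\<Sum>p. (real (e (p + n)) / real b ^ Suc p) / real b ^ n)"
    by (simp add: power_add mult_ac)
  also have "\<dots> = digit_series b (\<lambda>p. e (p + n)) / real b ^ n"
    unfolding digit_series_def
    by (rule suminf_divide) (rule summable_digits[OF assms(1)], rule assms(2))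
  finally show ?thesis by (simp add: add_divide_distrib)
qed

text \<open>One later digit different from \<open>b - 1\<close> keeps the tail strictly below 1, so
  the floor in \<open>digit\<close> sees no carry.\<close>

lemma digit_digit_series:
  assumes b2: "b \<ge> 2" and e: "\<And>p. e p < b" and inf: "\<exists>p>n. e p \<noteq> b - 1"
  shows "digit b (digit_series b e) (Suc n) = e n"
proof -
  let ?t = "digit_series b (\<lambda>p. e (p + Suc n))"
  obtain p where "p > n" "e p \<noteq> b - 1" using inf by blast
  then have "?t < 1"
    using digit_series_less_1[OF b2 e, of "\<lambda>p. p + Suc n" "p - Suc n"] by (simp add: e b2)
  moreover have "?t \<ge> 0"
    by (rule digit_series_nonneg[OF b2 e])
  moreover have "digit_series b e * real b ^ Suc n = real (digits_nat b e (Suc n)) + ?t"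
    using digit_series_split[where e = e and n = "Suc n", OF b2 e] b2 by (simp add: field_simps)
  ultimately have "\<lfloor>digit_series b e * real b ^ Suc n\<rfloor> = int (digits_nat b e (Suc n))"
    by (intro floor_unique) auto
  then have "digit b (digit_series b e) (Suc n) = digits_nat b e (Suc n) mod b"
    unfolding digit_def by (simp only: nat_int)
  then show ?thesis using e[of n] by simp
qed

section \<open>The law of a scrambled and interlaced point\<close>

text \<open>Digit interlacing read backwards: the source coordinate and source digit of the digit
  with index \<open>p\<close>, counted from 0, of the interlaced coordinate
  \<open>i\<close>.\<close>

definition interlaced_position :: "nat \<Rightarrow> nat \<Rightarrow> nat \<Rightarrow> nat \<times> nat" where
  "interlaced_position d i p = ((i - 1) * d + p mod d + 1, p div d + 1)"

lemma interlaced_position_inj: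
  assumes "d \<ge> 1" "i \<ge> 1" "i' \<ge> 1" "interlaced_position d i p = interlaced_position d i' p'"
  shows "i = i'" "p = p'"
proof -
  have a: "(i - 1) * d + p mod d = (i' - 1) * d + p' mod d" and q: "p div d = p' div d"
    using assms(4) by (auto simp: interlaced_position_def)
  have "p mod d = p' mod d"
    using arg_cong[OF a, of "\<lambda>x. x mod d"] by simp
  then show "p = p'" using q by (metis div_mult_mod_eq)
  have "i - 1 = i' - 1"
    using arg_cong[OF a, of "\<lambda>x. x div d"] assms(1) by simp
  then show "i = i'" using assms by simp
qed

locale interlaced_scrambling = scrambling b "d * s" dg for b d s dg +
  assumes d1: "d \<ge> 1" and s1: "s \<ge> 1"
begin

abbreviation "pos \<equiv> interlaced_position d"

lemma pos_in_positions: "i \<in> {1..s} \<Longrightarrow> pos i p \<in> positions"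
proof -
  assume i: "i \<in> {1..s}"
  have "p mod d + 1 \<le> d" using d1 by (simp add: Suc_le_eq)
  then have "(i - 1) * d + p mod d + 1 \<le> (i - 1) * d + d" by simp
  also have "\<dots> = i * d" using i by (cases i) auto
  also have "\<dots> \<le> s * d" using i by (intro mult_right_mono) auto
  finally show ?thesis by (auto simp: interlaced_position_def mult.commute)
qed

text \<open>The scrambled and interlaced point assembled directly from the random digits. The
  estimator instead extracts digits from scrambled real numbers, and the two agree only almost
  surely.\<close>

definition point :: "nat \<Rightarrow> (nat \<times> nat list \<Rightarrow> nat \<Rightarrow> nat) \<Rightarrow> nat \<Rightarrow> real" where
  "point n \<omega> = (\<lambda>i\<in>{1..s}. digit_series b (\<lambda>p. scrambled_digit n \<omega> (pos i p)))"

lemma point_in_cube: "point n \<omega> \<in> {1..s} \<rightarrow>\<^sub>E {0..1}"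
  by (auto simp: point_def intro!: digit_series_nonneg digit_series_le_1 b2)

lemma prob_digits_nat:
  assumes i: "i \<in> {1..s}" and c: "c < b ^ Q"
  shows "Om.prob {\<omega>\<in>space \<Omega>. digits_nat b (\<lambda>p. scrambled_digit n \<omega> (pos i p)) Q = c} = 1 / real b ^ Q"
proof -
  obtain e where e: "\<And>p. e p < b" "digits_nat b e Q = c"
    using digits_nat_surj[OF b0 c] by blast
  define A where "A = pos i ` {..<Q}"
  have inj: "inj_on (pos i) {..<Q}"
    using interlaced_position_inj[OF d1] i by (intro inj_onI) auto
  have "card A = Q" "finite A"
    using card_image[OF inj] by (simp_all add: A_def)
  have "A \<subseteq> positions"
    unfolding A_def by (intro image_subsetI pos_in_positions i)
  define g where "g x = e (the_inv_into {..<Q} (pos i) x)" for x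
  have g: "g (pos i p) = e p" if "p < Q" for p
    using the_inv_into_f_f[OF inj, of p] that by (simp add: g_def)
  have "digits_nat b (\<lambda>p. scrambled_digit n \<omega> (pos i p)) Q = c \<longleftrightarrow> (\<forall>x\<in>A. scrambled_digit n \<omega> x = g x)" for \<omega>
  proof
    assume "digits_nat b (\<lambda>p. scrambled_digit n \<omega> (pos i p)) Q = c"
    then have "scrambled_digit n \<omega> (pos i p) = e p" if "p < Q" for p
      using digits_nat_inj[of Q "\<lambda>p. scrambled_digit n \<omega> (pos i p)" b e p] e that by simp
    then show "\<forall>x\<in>A. scrambled_digit n \<omega> x = g x"
      using g by (auto simp: A_def)
  next
    assume "\<forall>x\<in>A. scrambled_digit n \<omega> x = g x"
    then show "digits_nat b (\<lambda>p. scrambled_digit n \<omega> (pos i p)) Q = c"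
      using g e(2) digits_nat_cong[of Q "\<lambda>p. scrambled_digit n \<omega> (pos i p)" e b] by (auto simp: A_def)
  qed
  then show ?thesis
    using prob_scrambled_digits[OF \<open>finite A\<close> \<open>A \<subseteq> positions\<close>, of g n] e(1) \<open>card A = Q\<close>
    by (simp add: g_def)
qed

lemma measurable_digit_series_pos:
  assumes i: "i \<in> {1..s}"
  shows "(\<lambda>\<omega>. digit_series b (\<lambda>p. scrambled_digit n \<omega> (pos i p))) \<in> borel_measurable \<Omega>"
proof -
  have "(\<lambda>\<omega>. real (scrambled_digit n \<omega> (pos i p)) / real b ^ Suc p) \<in> borel_measurable \<Omega>" for p
    by (rule measurable_compose[OF measurable_scrambled_digit[OF pos_in_positions[OF i]]]) simp
  then show ?thesis
    unfolding digit_series_def by (rule borel_measurable_suminf)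
qed

lemma measurable_digits_nat:
  assumes i: "i \<in> {1..s}"
  shows "(\<lambda>\<omega>. digits_nat b (\<lambda>p. scrambled_digit n \<omega> (pos i p)) Q) \<in> measurable \<Omega> (count_space UNIV)"
proof (induction Q)
  case (Suc Q)
  have [measurable]: "(\<lambda>\<omega>. scrambled_digit n \<omega> (pos i Q)) \<in> measurable \<Omega> (count_space UNIV)"
    by (rule measurable_scrambled_digit[OF pos_in_positions[OF i]])
  note [measurable] = Suc
  show ?case by simp
qed simp

lemma prob_digits_nat_less:
  assumes i: "i \<in> {1..s}" and k: "k \<le> b ^ Q"
  shows "Om.prob {\<omega>\<in>space \<Omega>. digits_nat b (\<lambda>p. scrambled_digit n \<omega> (pos i p)) Q < k} = real k / real b ^ Q"
proof -
  let ?E = "\<lambda>c. {\<omega>\<in>space \<Omega>. digits_nat b (\<lambda>p. scrambled_digit n \<omega> (pos i p)) Q = c}"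
  have ev: "?E c \<in> Om.events" for c
    using measurable_sets[OF measurable_digits_nat[OF i], of "{c}" n Q]
    by (simp add: vimage_def Int_def conj_commute)
  have "{\<omega>\<in>space \<Omega>. digits_nat b (\<lambda>p. scrambled_digit n \<omega> (pos i p)) Q < k} = (\<Union>c\<in>{..<k}. ?E c)"
    by auto
  then have "Om.prob {\<omega>\<in>space \<Omega>. digits_nat b (\<lambda>p. scrambled_digit n \<omega> (pos i p)) Q < k} =
      Om.prob (\<Union>c\<in>{..<k}. ?E c)"
    by (simp only:)
  also have "\<dots> = (\<Sum>c<k. Om.prob (?E c))"
  proof (rule Om.finite_measure_finite_Union)
    show "?E ` {..<k} \<subseteq> Om.events" by (rule image_subsetI) (rule ev)
    have "disjoint_family_on (\<lambda>c. {\<omega>\<in>S. f \<omega> = c}) C" for S :: "'c set" and f :: "'c \<Rightarrow> nat" and C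
      by (auto simp: disjoint_family_on_def)
    then show "disjoint_family_on ?E {..<k}" .
  qed (rule finite_lessThan)
  also have "\<dots> = (\<Sum>c<k. 1 / real b ^ Q)"
  proof (rule sum.cong[OF refl])
    fix c assume "c \<in> {..<k}"
    then have "c < b ^ Q" using k by simp
    then show "Om.prob (?E c) = 1 / real b ^ Q" by (rule prob_digits_nat[OF i])
  qed
  finally show ?thesis by simp
qed

text \<open>The first \<open>Q\<close> digits form a uniform integer and locate the value up to
  \<open>1 / b ^ Q\<close>. This squeezes the distribution function, and \<open>Q\<close> tends to
  infinity.\<close>

lemma prob_digit_series_le:
  assumes i: "i \<in> {1..s}" and t: "0 \<le> t" "t \<le> 1"
  shows "Om.prob {\<omega>\<in>space \<Omega>. digit_series b (\<lambda>p. scrambled_digit n \<omega> (pos i p)) \<le> t} = t"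
proof -
  let ?X = "\<lambda>\<omega>. digit_series b (\<lambda>p. scrambled_digit n \<omega> (pos i p))"
  let ?Y = "\<lambda>Q \<omega>. digits_nat b (\<lambda>p. scrambled_digit n \<omega> (pos i p)) Q"
  let ?P = "Om.prob {\<omega>\<in>space \<Omega>. ?X \<omega> \<le> t}"
  note [measurable] = measurable_digit_series_pos[OF i] measurable_digits_nat[OF i]
  have XY: "real (?Y Q \<omega>) \<le> ?X \<omega> * real b ^ Q" "?X \<omega> * real b ^ Q \<le> real (?Y Q \<omega>) + 1" for Q \<omega>
  proof -
    let ?t = "digit_series b (\<lambda>p. scrambled_digit n \<omega> (pos i (p + Q)))"
    have "?X \<omega> * real b ^ Q = real (?Y Q \<omega>) + ?t"
      using digit_series_split[where e = "\<lambda>p. scrambled_digit n \<omega> (pos i p)" and n = Q, OF b2] b0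
      by (simp add: field_simps)
    moreover have "0 \<le> ?t" "?t \<le> 1"
      by (rule digit_series_nonneg[OF b2 scrambled_digit_less], rule digit_series_le_1[OF b2 scrambled_digit_less])
    ultimately show "real (?Y Q \<omega>) \<le> ?X \<omega> * real b ^ Q" "?X \<omega> * real b ^ Q \<le> real (?Y Q \<omega>) + 1"
      by auto
  qed
  have bounds: "t - 1 / real b ^ Q \<le> ?P \<and> ?P \<le> t + 1 / real b ^ Q" for Q
  proof
    define k where "k = nat \<lfloor>t * real b ^ Q\<rfloor>"
    have bQ: "real b ^ Q > 0" using b0 by simp
    have tb: "0 \<le> t * real b ^ Q" using t by simp
    have k: "real k \<le> t * real b ^ Q" "t * real b ^ Q < real k + 1"
      unfolding k_def using tb by linarith+
    have "t * real b ^ Q \<le> 1 * real b ^ Q"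
      using t by (intro mult_right_mono) auto
    with k have "real k \<le> real b ^ Q" by linarith
    then have "real k \<le> real (b ^ Q)" by (simp only: of_nat_power)
    then have kQ: "k \<le> b ^ Q" by (simp only: of_nat_le_iff)
    have "t \<le> (real k + 1) / real b ^ Q"
      using k(2) by (simp only: pos_le_divide_eq[OF bQ])
    then have "t - 1 / real b ^ Q \<le> real k / real b ^ Q"
      by (simp add: add_divide_distrib)
    also have "\<dots> = Om.prob {\<omega>\<in>space \<Omega>. ?Y Q \<omega> < k}"
      using prob_digits_nat_less[OF i kQ] by simp
    also have "\<dots> \<le> ?P"
    proof (rule Om.finite_measure_mono)
      show "{\<omega>\<in>space \<Omega>. ?Y Q \<omega> < k} \<subseteq> {\<omega>\<in>space \<Omega>. ?X \<omega> \<le> t}"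
      proof safe
        fix \<omega> assume "?Y Q \<omega> < k"
        then have "real (?Y Q \<omega>) + 1 \<le> real k" by linarith
        with XY(2)[of \<omega> Q] k have "?X \<omega> * real b ^ Q \<le> t * real b ^ Q" by linarith
        then show "?X \<omega> \<le> t" using bQ by simp
      qed
    qed measurable
    finally show "t - 1 / real b ^ Q \<le> ?P" .
    show "?P \<le> t + 1 / real b ^ Q"
    proof (cases "k + 1 \<le> b ^ Q")
      case True
      have "?P \<le> Om.prob {\<omega>\<in>space \<Omega>. ?Y Q \<omega> < k + 1}"
      proof (rule Om.finite_measure_mono)
        show "{\<omega>\<in>space \<Omega>. ?X \<omega> \<le> t} \<subseteq> {\<omega>\<in>space \<Omega>. ?Y Q \<omega> < k + 1}"
        proof safe
          fix \<omega> assume "?X \<omega> \<le> t"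
          then have "?X \<omega> * real b ^ Q \<le> t * real b ^ Q" using bQ by simp
          with XY(1)[of \<omega> Q] k have "real (?Y Q \<omega>) < real (k + 1)" by simp
          then show "?Y Q \<omega> < k + 1" by (simp only: of_nat_less_iff)
        qed
      qed measurable
      also have "\<dots> = real (k + 1) / real b ^ Q"
        by (rule prob_digits_nat_less[OF i True])
      also have "\<dots> \<le> t + 1 / real b ^ Q"
      proof -
        have "real k / real b ^ Q \<le> t"
          using k(1) by (simp only: pos_divide_le_eq[OF bQ])
        then show ?thesis by (simp add: add_divide_distrib)
      qed
      finally show ?thesis .
    next
      \<comment> \<open>Here \<open>b ^ Q \<le> k\<close> forces \<open>t \<ge> 1\<close>, and a
        probability is at most 1.\<close>
      case False
      then have "b ^ Q \<le> k" by linarith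
      then have "real b ^ Q \<le> real k" by (simp only: of_nat_le_iff of_nat_power[symmetric])
      with k have "1 * real b ^ Q \<le> t * real b ^ Q" by linarith
      then have "1 \<le> t" using bQ by (rule mult_right_le_imp_le)
      then have "?P \<le> t" by (rule order_trans[OF Om.prob_le_1])
      also have "t \<le> t + 1 / real b ^ Q" using bQ by simp
      finally show ?thesis .
    qed
  qed
  have lim0: "(\<lambda>Q. 1 / real b ^ Q) \<longlonglongrightarrow> 0"
    using LIMSEQ_divide_realpow_zero[of "real b" 1] b2 by simp
  have "(\<lambda>Q. t - 1 / real b ^ Q) \<longlonglongrightarrow> t - 0" "(\<lambda>Q. t + 1 / real b ^ Q) \<longlonglongrightarrow> t + 0"
    by (intro tendsto_intros lim0)+
  then have "t \<le> ?P" "?P \<le> t"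
    using bounds by (auto intro: LIMSEQ_le_const LIMSEQ_le_const2)
  then show ?thesis by simp
qed

lemma distr_digit_series:
  assumes i: "i \<in> {1..s}"
  shows "distr \<Omega> unit_interval (\<lambda>\<omega>. digit_series b (\<lambda>p. scrambled_digit n \<omega> (pos i p))) = unit_interval"
    (is "distr _ _ ?X = _")
    and "(\<lambda>\<omega>. digit_series b (\<lambda>p. scrambled_digit n \<omega> (pos i p))) \<in> measurable \<Omega> unit_interval"
proof -
  note X [measurable] = measurable_digit_series_pos[OF i, of n]
  have X01: "?X \<omega> \<in> {0..1}" for \<omega>
    using digit_series_nonneg[OF b2 scrambled_digit_less] digit_series_le_1[OF b2 scrambled_digit_less] by simp
  show XU: "?X \<in> measurable \<Omega> unit_interval"
    using X X01 by (intro measurable_restrict_space2) auto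
  have idU: "(\<lambda>t. t) \<in> borel_measurable unit_interval"
    by (auto intro: measurable_restrict_space1)
  have Um: "measure unit_interval {0..t} = t" if "0 \<le> t" "t \<le> 1" for t
    using that by (subst measure_restrict_space) auto
  have eq: "distr \<Omega> borel ?X = distr unit_interval borel (\<lambda>t. t)"
  proof (rule cdf_unique)
    show "real_distribution (distr \<Omega> borel ?X)"
      by (rule Om.real_distribution_distr) simp
    show "real_distribution (distr unit_interval borel (\<lambda>t. t))"
      by (intro prob_space.real_distribution_distr prob_space_unit_interval idU)
    show "cdf (distr \<Omega> borel ?X) = cdf (distr unit_interval borel (\<lambda>t. t))"
    proof
      fix t :: real
      have c1: "cdf (distr \<Omega> borel ?X) t = Om.prob {\<omega>\<in>space \<Omega>. ?X \<omega> \<le> t}"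
        unfolding cdf_def by (subst measure_distr) (auto simp: vimage_def Int_def conj_commute)
      have c2: "cdf (distr unit_interval borel (\<lambda>t. t)) t = measure unit_interval ({..t} \<inter> {0..1})"
        unfolding cdf_def by (subst measure_distr[OF idU]) auto
      consider "t < 0" | "0 \<le> t" "t \<le> 1" | "t > 1" by linarith
      then show "cdf (distr \<Omega> borel ?X) t = cdf (distr unit_interval borel (\<lambda>t. t)) t"
      proof cases
        case 1
        then have "\<not> ?X \<omega> \<le> t" for \<omega> using X01[of \<omega>] by simp
        moreover have "{..t} \<inter> {0..1} = {}" using 1 by auto
        ultimately show ?thesis unfolding c1 c2 by simp
      next
        case 2
        have "{..t} \<inter> {0..1} = {0..t}" using 2 by auto
        then show ?thesis
          unfolding c1 c2 prob_digit_series_le[OF i 2] by (simp only: Um[OF 2])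
      next
        case 3
        then have "?X \<omega> \<le> t" for \<omega> using X01[of \<omega>] by simp
        moreover have "{..t} \<inter> {0..1} = {0..1}" using 3 by auto
        ultimately show ?thesis unfolding c1 c2
          using Om.prob_space Um[of 1] by simp
      qed
    qed
  qed
  show "distr \<Omega> unit_interval ?X = unit_interval"
  proof (rule measure_eqI)
    fix A assume "A \<in> sets (distr \<Omega> unit_interval ?X)"
    then have A: "A \<in> sets unit_interval" by simp
    then have B: "A \<in> sets borel" and A01: "A \<subseteq> {0..1}"
      by (auto simp: sets_restrict_space)
    have "emeasure (distr \<Omega> unit_interval ?X) A = emeasure (distr \<Omega> borel ?X) A"
      using A B XU by (simp add: emeasure_distr)
    also have "\<dots> = emeasure unit_interval A"
      unfolding eq using B A01 by (subst emeasure_distr[OF idU]) (auto simp: Int_absorb2)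
    finally show "emeasure (distr \<Omega> unit_interval ?X) A = emeasure unit_interval A" .
  qed simp
qed

text \<open>Each coordinate is uniform, and the coordinates are independent because distinct
  interlaced coordinates read disjoint sets of permutations.\<close>

lemma distr_point:
  shows measurable_point: "point n \<in> measurable \<Omega> (cube {1..s})"
    and "distr \<Omega> (cube {1..s}) (point n) = cube {1..s}"
proof -
  let ?M = "\<lambda>_ :: nat \<times> nat list. measure_pmf (pmf_of_set perms)"
  define K where "K i = range (\<lambda>p. key n (pos i p))" for i
  define Y where "Y i \<eta> = digit_series b (\<lambda>p. \<eta> (key n (pos i p)) (dg n (fst (pos i p)) (snd (pos i p))) mod b)"
    for i and \<eta> :: "nat \<times> nat list \<Rightarrow> nat \<Rightarrow> nat"
  have keys: "K i \<subseteq> keys" if "i \<in> {1..s}" for i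
    unfolding K_def by (intro image_subsetI key_in_keys pos_in_positions that)
  have ne: "keys \<noteq> {}"
  proof -
    have "1 \<in> {1..s}" using s1 by simp
    from key_in_keys[OF pos_in_positions[OF this]] show ?thesis by blast
  qed
  have disj: "disjoint_family_on K {1..s}"
  proof (unfold disjoint_family_on_def, intro ballI impI)
    fix i i' assume i: "i \<in> {1..s}" "i' \<in> {1..s}" "i \<noteq> i'"
    have "key n (pos i p) \<noteq> key n (pos i' p')" for p p'
    proof
      assume "key n (pos i p) = key n (pos i' p')"
      from key_eq_imp_eq[OF pos_in_positions[OF i(1)] pos_in_positions[OF i(2)] this]
      have "i = i'" using interlaced_position_inj(1)[OF d1, of i i' p p'] i by simp
      with i show False by simp
    qed
    then show "K i \<inter> K i' = {}" unfolding K_def by blast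
  qed
  \<comment> \<open>The coordinate maps of a product measure are independent; grouping them into the
    disjoint blocks \<open>K i\<close> preserves this.\<close>
  have "Om.indep_vars ?M (\<lambda>\<kappa> \<omega>. \<omega> \<kappa>) keys"
  proof (subst Om.indep_vars_iff_distr_eq_PiM'[OF ne])
    show "(\<lambda>\<omega>. \<omega> \<kappa>) \<in> measurable \<Omega> (?M \<kappa>)" if "\<kappa> \<in> keys" for \<kappa>
      unfolding scramble_space_def using that by (rule measurable_component_singleton)
    have "distr \<Omega> (PiM keys ?M) (\<lambda>\<omega>. restrict \<omega> keys) = distr \<Omega> \<Omega> (\<lambda>\<omega>. \<omega>)"
      by (intro distr_cong) (auto simp: scramble_space_def space_PiM PiE_restrict)
    also have "\<dots> = PiM keys ?M"
      by (simp add: distr_id2 scramble_space_def)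
    also have "\<dots> = (\<Pi>\<^sub>M \<kappa>\<in>keys. distr \<Omega> (?M \<kappa>) (\<lambda>\<omega>. \<omega> \<kappa>))"
      unfolding scramble_space_def using S.PiM_component by (intro PiM_cong) auto
    finally show "distr \<Omega> (PiM keys ?M) (\<lambda>\<omega>. \<lambda>\<kappa>\<in>keys. \<omega> \<kappa>) = (\<Pi>\<^sub>M \<kappa>\<in>keys. distr \<Omega> (?M \<kappa>) (\<lambda>\<omega>. \<omega> \<kappa>))" .
  qed
  then have "Om.indep_vars (\<lambda>i. PiM (K i) ?M) (\<lambda>i \<omega>. restrict (\<lambda>\<kappa>. \<omega> \<kappa>) (K i)) {1..s}"
    using keys disj by (rule Om.indep_vars_restrict)
  moreover have "Y i \<in> measurable (PiM (K i) ?M) unit_interval" for i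
  proof (rule measurable_restrict_space2)
    show "Y i \<in> space (PiM (K i) ?M) \<rightarrow> {0..1}"
      using b0 by (auto simp: Y_def intro!: digit_series_nonneg digit_series_le_1 b2)
    have "(\<lambda>\<eta>. real (\<eta> (key n (pos i p)) (dg n (fst (pos i p)) (snd (pos i p))) mod b) / real b ^ Suc p)
        \<in> borel_measurable (PiM (K i) ?M)" for p
      by (rule measurable_compose[OF measurable_component_singleton, of "key n (pos i p)"]) (auto simp: K_def)
    then have "Y i \<in> borel_measurable (PiM (K i) ?M)"
      unfolding Y_def[abs_def] digit_series_def by (rule borel_measurable_suminf)
    then show "Y i \<in> measurable (PiM (K i) ?M) lborel" by simp
  qed
  ultimately have "Om.indep_vars (\<lambda>_. unit_interval) (\<lambda>i \<omega>. Y i (restrict (\<lambda>\<kappa>. \<omega> \<kappa>) (K i))) {1..s}"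
    by (rule Om.indep_vars_compose2)
  moreover have "Y i (restrict (\<lambda>\<kappa>. \<omega> \<kappa>) (K i)) = digit_series b (\<lambda>p. scrambled_digit n \<omega> (pos i p))" for i \<omega>
    by (simp add: Y_def K_def scrambled_digit_def)
  ultimately have ind: "Om.indep_vars (\<lambda>_. unit_interval) (\<lambda>i \<omega>. digit_series b (\<lambda>p. scrambled_digit n \<omega> (pos i p))) {1..s}"
    by simp
  have ne': "{1..s} \<noteq> {}" using s1 by auto
  have "distr \<Omega> (\<Pi>\<^sub>M i\<in>{1..s}. unit_interval) (\<lambda>\<omega>. \<lambda>i\<in>{1..s}. digit_series b (\<lambda>p. scrambled_digit n \<omega> (pos i p)))
      = (\<Pi>\<^sub>M i\<in>{1..s}. distr \<Omega> unit_interval (\<lambda>\<omega>. digit_series b (\<lambda>p. scrambled_digit n \<omega> (pos i p))))"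
    using ind distr_digit_series(2) by (subst (asm) Om.indep_vars_iff_distr_eq_PiM'[OF ne']) auto
  also have "\<dots> = (\<Pi>\<^sub>M i\<in>{1..s}. unit_interval)"
    using distr_digit_series(1) by (intro PiM_cong) auto
  finally show "distr \<Omega> (cube {1..s}) (point n) = cube {1..s}"
    unfolding cube_def point_def[abs_def] .
  show "point n \<in> measurable \<Omega> (cube {1..s})"
    unfolding cube_def point_def[abs_def] using distr_digit_series(2) by (intro measurable_restrict) auto
qed

end

section \<open>Almost sure agreement of the estimator's points with the digit model\<close>

lemma interlace_eq_digit_series:
  assumes b2: "b \<ge> 2" and d1: "d \<ge> 1"
  shows "interlace b s d z = (\<lambda>i\<in>{1..s}. digit_series b
    (\<lambda>p. digit b (z (fst (interlaced_position d i p))) (snd (interlaced_position d i p))))"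
proof -
  have "(\<Sum>a. \<Sum>r=1..d. real (digit b (z ((i - 1) * d + r)) (Suc a)) / real b ^ (r + a * d)) =
      digit_series b (\<lambda>p. digit b (z (fst (interlaced_position d i p))) (snd (interlaced_position d i p)))" for i
  proof -
    define e where "e p = digit b (z (fst (interlaced_position d i p))) (snd (interlaced_position d i p))" for p
    have e: "e p < b" for p using b2 by (simp add: e_def digit_def)
    have "(\<lambda>p. real (e p) / real b ^ Suc p) sums digit_series b e"
      unfolding digit_series_def by (rule summable_sums[OF summable_digits[OF b2 e]])
    \<comment> \<open>Block \<open>a\<close> of \<open>d\<close> consecutive digits consists of the
      digits with index \<open>Suc a\<close> of the \<open>d\<close> coordinates in the
      group.\<close>
    then have "(\<lambda>a. \<Sum>p=a * d..<a * d + d. real (e p) / real b ^ Suc p) sums digit_series b e"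
      by (rule sums_group) (use d1 in simp)
    moreover have "(\<Sum>p=a * d..<a * d + d. real (e p) / real b ^ Suc p) =
        (\<Sum>r=1..d. real (digit b (z ((i - 1) * d + r)) (Suc a)) / real b ^ (r + a * d))" for a
    proof (rule sum.reindex_bij_witness[where i = "\<lambda>r. a * d + r - 1" and j = "\<lambda>p. p - a * d + 1"])
      fix p assume p: "p \<in> {a * d..<a * d + d}"
      then obtain r where r: "p = a * d + r" "r < d"
        by (metis atLeastLessThan_iff le_Suc_ex nat_add_left_cancel_less)
      have "p mod d = r" "p div d = a" using r by simp_all
      then show "real (digit b (z ((i - 1) * d + (p - a * d + 1))) (Suc a)) / real b ^ (p - a * d + 1 + a * d) =
          real (e p) / real b ^ Suc p"
        using r(1) by (simp add: e_def interlaced_position_def add_ac)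
    qed auto
    ultimately show ?thesis
      unfolding e_def using sums_unique by fastforce
  qed
  then show ?thesis by (simp add: interlace_def)
qed

context interlaced_scrambling
begin

text \<open>A run of \<open>k\<close> digits equal to \<open>b - 1\<close> has probability
  \<open>1 / b ^ k\<close>, so an infinite run is a null event.\<close>

lemma AE_scrambled_digit_not_max:
  assumes j: "j \<in> {1..d * s}"
  shows "AE \<omega> in \<Omega>. \<exists>a>a0. scrambled_digit n \<omega> (j, a) \<noteq> b - 1"
proof -
  define E where "E k = {\<omega>\<in>space \<Omega>. \<forall>x\<in>{j} \<times> {a0 + 1..a0 + k}. scrambled_digit n \<omega> x = b - 1}" for k
  have pos: "{j} \<times> {a0 + 1..a0 + k} \<subseteq> positions" for k
    using j by auto
  have prob: "Om.prob (E k) = 1 / real b ^ k" for k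
    using prob_scrambled_digits[OF _ pos[of k], of "\<lambda>_. b - 1" n] b2
    by (simp add: E_def card_cartesian_product)
  have ev: "E k \<in> Om.events" for k
  proof -
    have "{\<omega>\<in>space \<Omega>. scrambled_digit n \<omega> x = b - 1} \<in> Om.events" if "x \<in> {j} \<times> {a0 + 1..a0 + k}" for x
    proof -
      have "x \<in> positions" using that pos by blast
      from measurable_sets[OF measurable_scrambled_digit[OF this], of "{b - 1}" n]
      have "(\<lambda>\<omega>. scrambled_digit n \<omega> x) -` {b - 1} \<inter> space \<Omega> \<in> Om.events" by simp
      then show ?thesis by (simp add: vimage_def Int_def conj_commute)
    qed
    then show ?thesis
      unfolding E_def by (intro sets.sets_Collect_finite_All) auto
  qed
  have evI: "(\<Inter>k. E k) \<in> Om.events"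
    using ev by (intro sets.countable_INT) auto
  have "Om.prob (\<Inter>k. E k) \<le> 1 / real b ^ k" for k
    using Om.finite_measure_mono[of "\<Inter>k. E k" "E k"] ev prob[of k] by auto
  moreover have "(\<lambda>k. 1 / real b ^ k) \<longlonglongrightarrow> 0"
    using LIMSEQ_divide_realpow_zero[of "real b" 1] b2 by simp
  ultimately have "Om.prob (\<Inter>k. E k) \<le> 0"
    by (intro LIMSEQ_le_const) auto
  then have "Om.prob (\<Inter>k. E k) = 0"
    using measure_nonneg[of \<Omega> "\<Inter>k. E k"] by linarith
  then have "emeasure \<Omega> (\<Inter>k. E k) = 0"
    by (simp add: Om.emeasure_eq_measure)
  moreover have "{\<omega>\<in>space \<Omega>. \<not> (\<exists>a>a0. scrambled_digit n \<omega> (j, a) \<noteq> b - 1)} \<subseteq> (\<Inter>k. E k)"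
    by (auto simp: E_def)
  ultimately show ?thesis
    using evI by (intro AE_I)
qed

text \<open>Interlacing reads the digits of the real number that scrambling produced. These are the
  scrambled digits unless a scrambled expansion ends in \<open>b - 1\<close> forever, which almost
  surely does not happen.\<close>

lemma AE_interlace_scramble:
  assumes z: "\<And>j a. j \<in> {1..d * s} \<Longrightarrow> a \<ge> 1 \<Longrightarrow> digit b (z j) a = dg n j a"
  shows "AE \<omega> in \<Omega>. interlace b s d (scramble b \<omega> z) = point n \<omega>"
proof -
  have "AE \<omega> in \<Omega>. \<forall>a0. \<exists>a>a0. scrambled_digit n \<omega> (j, a) \<noteq> b - 1" if "j \<in> {1..d * s}" for j
    using AE_scrambled_digit_not_max[OF that] by (simp only: AE_all_countable) blast
  then have "AE \<omega> in \<Omega>. \<forall>j\<in>{1..d * s}. \<forall>a0. \<exists>a>a0. scrambled_digit n \<omega> (j, a) \<noteq> b - 1"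
    by (subst AE_ball_countable) auto
  with AE_good show ?thesis
  proof eventually_elim
    case (elim \<omega>)
    have scr: "scramble b \<omega> z j = digit_series b (\<lambda>r. scrambled_digit n \<omega> (j, Suc r))" if j: "j \<in> {1..d * s}" for j
    proof -
      have "real (\<omega> (j, map (digit b (z j)) [1..<Suc r]) (digit b (z j) (Suc r))) = real (scrambled_digit n \<omega> (j, Suc r))" for r
      proof -
        have "map (digit b (z j)) [1..<Suc r] = map (dg n j) [1..<Suc r]"
        proof (rule map_cong[OF refl])
          fix x assume "x \<in> set [1..<Suc r]"
          then have "x \<ge> 1" by auto
          then show "digit b (z j) x = dg n j x" by (rule z[OF j])
        qed
        then have k: "(j, map (digit b (z j)) [1..<Suc r]) = key n (j, Suc r)"
          by (simp add: key_def)
        have "key n (j, Suc r) \<in> keys"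
          by (rule key_in_keys) (use j in simp)
        with elim(1)[unfolded good_def] have "\<omega> (key n (j, Suc r)) permutes {..<b}"
          by (rule bspec)
        from permutes_in_image[OF this, of "dg n j (Suc r)"]
        have "\<omega> (key n (j, Suc r)) (dg n j (Suc r)) < b"
          using dg_less[of n j "Suc r"] by simp
        then show ?thesis
          unfolding k using z[OF j, of "Suc r"] by (simp add: scrambled_digit_def)
      qed
      then show ?thesis
        unfolding scramble_def digit_series_def by (simp only:)
    qed
    have dig: "digit b (scramble b \<omega> z j) (Suc a) = scrambled_digit n \<omega> (j, Suc a)" if j: "j \<in> {1..d * s}" for j a
    proof -
      obtain a' where "a' > Suc a" "scrambled_digit n \<omega> (j, a') \<noteq> b - 1"
        using elim(2) j by blast
      then have "\<exists>p>a. scrambled_digit n \<omega> (j, Suc p) \<noteq> b - 1"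
        by (intro exI[of _ "a' - 1"]) auto
      then show ?thesis
        unfolding scr[OF j]
        by (intro digit_digit_series[where e = "\<lambda>r. scrambled_digit n \<omega> (j, Suc r)"] b2 scrambled_digit_less)
    qed
    have "digit b (scramble b \<omega> z (fst (pos i p))) (snd (pos i p)) = scrambled_digit n \<omega> (pos i p)"
      if "i \<in> {1..s}" for i p
    proof -
      obtain a where "snd (pos i p) = Suc a" by (simp add: interlaced_position_def)
      moreover have "fst (pos i p) \<in> {1..d * s}" using pos_in_positions[OF that] by (simp add: mem_Times_iff)
      ultimately show ?thesis using dig by (metis prod.collapse)
    qed
    then show ?case
      unfolding interlace_eq_digit_series[OF b2 d1] point_def by (intro restrict_ext) simp
  qed
qed

text \<open>Almost sure equality with the measurable map \<open>point\<close> does not yield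
  measurability by itself, hence a direct proof.\<close>

lemma measurable_interlace_scramble:
  "(\<lambda>\<omega>. interlace b s d (scramble b \<omega> z)) \<in> measurable \<Omega> (cube {1..s})"
proof -
  have dig: "(\<lambda>x. digit b x a) \<in> measurable borel (count_space UNIV)" for a
    unfolding digit_def by measurable
  have dig_less: "digit b x a < b" for x a
    using b0 by (simp add: digit_def)
  have scr: "(\<lambda>\<omega>. scramble b \<omega> z j) \<in> borel_measurable \<Omega>" if j: "j \<in> {1..d * s}" for j
  proof -
    have "(\<lambda>\<omega>. real (\<omega> (j, map (digit b (z j)) [1..<Suc r]) (digit b (z j) (Suc r))) / real b ^ Suc r)
        \<in> borel_measurable \<Omega>" for r
      unfolding scramble_space_def
      by (rule measurable_compose[OF measurable_component_singleton,
            of "(j, map (digit b (z j)) [1..<Suc r])"]) (use j dig_less in auto)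
    then show ?thesis unfolding scramble_def by (rule borel_measurable_suminf)
  qed
  show ?thesis
    unfolding interlace_eq_digit_series[OF b2 d1] cube_def
  proof (rule measurable_restrict)
    fix i assume i: "i \<in> {1..s}"
    let ?e = "\<lambda>\<omega> p. digit b (scramble b \<omega> z (fst (pos i p))) (snd (pos i p))"
    have "(\<lambda>\<omega>. real (?e \<omega> p) / real b ^ Suc p) \<in> borel_measurable \<Omega>" for p
    proof -
      have "fst (pos i p) \<in> {1..d * s}" using pos_in_positions[OF i] by (simp add: mem_Times_iff)
      from measurable_compose[OF scr[OF this] dig] have "(\<lambda>\<omega>. ?e \<omega> p) \<in> measurable \<Omega> (count_space UNIV)" .
      then show ?thesis by (rule measurable_compose) simp
    qed
    then have "(\<lambda>\<omega>. digit_series b (?e \<omega>)) \<in> borel_measurable \<Omega>"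
      unfolding digit_series_def by (rule borel_measurable_suminf)
    moreover have "digit_series b (?e \<omega>) \<in> {0..1}" for \<omega>
      using digit_series_nonneg[OF b2 dig_less] digit_series_le_1[OF b2 dig_less] by simp
    ultimately show "(\<lambda>\<omega>. digit_series b (?e \<omega>)) \<in> measurable \<Omega> unit_interval"
      by (intro measurable_restrict_space2) auto
  qed
qed

end

section \<open>Equidistribution of a digital net\<close>

text \<open>The digit vectors of the numbers below \<open>b ^ m\<close> run through all vectors of
  length \<open>m\<close>, so the sum factorises. The induction splits off the most significant
  digit.\<close>

lemma sum_prod_digits:
  fixes g :: "nat \<Rightarrow> nat \<Rightarrow> complex"
  assumes b: "b > 0"
  shows "(\<Sum>n<b ^ m. \<Prod>k<m. g k (n div b ^ k mod b)) = (\<Prod>k<m. \<Sum>e<b. g k e)"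
proof (induction m)
  case (Suc m)
  let ?h = "\<lambda>n. \<Prod>k<Suc m. g k (n div b ^ k mod b)"
  have "(\<Sum>n<b ^ Suc m. ?h n) = (\<Sum>e<b. sum ?h {e * b ^ m..<e * b ^ m + b ^ m})"
    by (simp only: sum.nat_group power_Suc)
  also have "\<dots> = (\<Sum>e<b. \<Sum>n<b ^ m. ?h (n + e * b ^ m))"
  proof (rule sum.cong[OF refl])
    fix e
    show "sum ?h {e * b ^ m..<e * b ^ m + b ^ m} = (\<Sum>n<b ^ m. ?h (n + e * b ^ m))"
      using sum.shift_bounds_nat_ivl[of ?h 0 "e * b ^ m" "b ^ m"]
      by (simp add: add.commute atLeast0LessThan del: prod.lessThan_Suc)
  qed
  also have "\<dots> = (\<Sum>e<b. \<Sum>n<b ^ m. (\<Prod>k<m. g k (n div b ^ k mod b)) * g m e)"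
  proof (intro sum.cong refl)
    fix e n assume e: "e \<in> {..<b}" and n: "n \<in> {..<b ^ m}"
    have "(n + e * b ^ m) div b ^ k mod b = n div b ^ k mod b" if "k < m" for k
    proof -
      have "b ^ m = b ^ k * (b * b ^ (m - Suc k))"
        using that by (simp flip: power_Suc power_add)
      then have "n + e * b ^ m = n + b ^ k * (b * (e * b ^ (m - Suc k)))"
        by (simp add: mult_ac)
      moreover have "(n + b ^ k * (b * X)) div b ^ k mod b = n div b ^ k mod b" for X
        using b by simp
      ultimately show ?thesis by (simp only:)
    qed
    moreover have "(n + e * b ^ m) div b ^ m mod b = e"
      using e n by simp
    ultimately show "?h (n + e * b ^ m) = (\<Prod>k<m. g k (n div b ^ k mod b)) * g m e"
      by simp
  qed
  also have "\<dots> = (\<Sum>n<b ^ m. \<Prod>k<m. g k (n div b ^ k mod b)) * (\<Sum>e<b. g m e)"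
    by (simp add: sum_product sum.swap[of _ "{..<b}"] sum_distrib_left sum_distrib_right)
  finally show ?case using Suc by simp
qed simp

text \<open>The net property speaks of exactly \<open>m - t\<close> rows. A smaller system is part
  of such a one and inherits independence by padding the coefficients with 0.\<close>

lemma digital_net_rows_independent:
  assumes net: "digital_net b t m q C" and c: "(\<Sum>j=1..q. c j) \<le> m - t"
  shows "rows_independent b m q C c"
proof (cases "q = 0")
  case True
  then show ?thesis by (simp add: rows_independent_def)
next
  case False
  \<comment> \<open>All missing rows are charged to the first coordinate.\<close>
  define c' where "c' j = (if j = 1 then c 1 + (m - t - (\<Sum>j=1..q. c j)) else c j)" for j
  have "{1..q} = insert 1 {2..q}" using False by auto
  then have "(\<Sum>j=1..q. c' j) = m - t"
    using c by (simp add: c'_def)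
  then have ri: "rows_independent b m q C c'"
    using net by (simp add: digital_net_def)
  have le: "c j \<le> c' j" for j by (simp add: c'_def)
  show ?thesis
    unfolding rows_independent_def
  proof (intro allI impI ballI)
    fix l :: "nat \<Rightarrow> nat \<Rightarrow> nat" and j a
    assume l: "\<forall>k<m. [(\<Sum>j=1..q. \<Sum>a=1..c j. l j a * C j a k) = 0] (mod b)"
      and j: "j \<in> {1..q}" and a: "a \<in> {1..c j}"
    define l' where "l' j a = (if a \<le> c j then l j a else 0)" for j a
    have "(\<Sum>a=1..c' j. l' j a * C j a k) = (\<Sum>a=1..c j. l j a * C j a k)" for j k
    proof -
      have "(\<Sum>a=1..c' j. l' j a * C j a k) = (\<Sum>a=1..c j. l' j a * C j a k)"
        using le[of j] by (intro sum.mono_neutral_right) (auto simp: l'_def)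
      also have "\<dots> = (\<Sum>a=1..c j. l j a * C j a k)"
        by (intro sum.cong) (auto simp: l'_def)
      finally show ?thesis .
    qed
    then have "\<forall>k<m. [(\<Sum>j=1..q. \<Sum>a=1..c' j. l' j a * C j a k) = 0] (mod b)"
      using l by simp
    then have "[l' j a = 0] (mod b)"
      using ri j a le[of j] unfolding rows_independent_def by auto
    then show "[l j a = 0] (mod b)"
      using a by (simp add: l'_def)
  qed
qed

text \<open>Net digits are linear in the digits of \<open>n\<close>, so the Walsh function becomes a
  character of the digit vector of \<open>n\<close> with coefficients \<open>v\<close>. Independence
  of the rows makes \<open>v\<close> nonzero modulo \<open>b\<close> unless \<open>l\<close>
  vanishes, and then one factor of the product is 0.\<close>

lemma sum_walsh_net_digit:
  assumes b: "b > 0" and c: "rows_independent b m q C c"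
    and l: "l \<in> (SIGMA j:{1..q}. {1..c j}) \<rightarrow>\<^sub>E {..<b}"
  shows "(\<Sum>n<b ^ m. walsh b (SIGMA j:{1..q}. {1..c j}) l (\<lambda>(j, a). net_digit b m C n j a)) =
     (if \<forall>x\<in>SIGMA j:{1..q}. {1..c j}. l x = 0 then of_nat b ^ m else 0)"
proof -
  let ?A = "SIGMA j:{1..q}. {1..c j}"
  define v where "v k = (\<Sum>j=1..q. \<Sum>a=1..c j. l (j, a) * C j a k)" for k
  have "walsh b ?A l (\<lambda>(j, a). net_digit b m C n j a) = (\<Prod>k<m. root_of_unity b ^ (v k * (n div b ^ k mod b)))" for n
  proof -
    have "walsh b ?A l (\<lambda>(j, a). net_digit b m C n j a) =
        (\<Prod>(j, a)\<in>?A. root_of_unity b ^ (l (j, a) * (\<Sum>k<m. C j a k * (n div b ^ k mod b))))"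
      unfolding walsh_def net_digit_def
      by (intro prod.cong refl) (auto simp: root_of_unity_power_eq_iff[OF b] mod_mult_right_eq)
    also have "\<dots> = root_of_unity b ^ (\<Sum>(j, a)\<in>?A. l (j, a) * (\<Sum>k<m. C j a k * (n div b ^ k mod b)))"
      by (simp add: power_sum case_prod_beta)
    also have "(\<Sum>(j, a)\<in>?A. l (j, a) * (\<Sum>k<m. C j a k * (n div b ^ k mod b))) =
        (\<Sum>(j, a)\<in>?A. \<Sum>k<m. l (j, a) * C j a k * (n div b ^ k mod b))"
      by (simp add: sum_distrib_left mult_ac case_prod_beta)
    also have "\<dots> = (\<Sum>j=1..q. \<Sum>a=1..c j. \<Sum>k<m. l (j, a) * C j a k * (n div b ^ k mod b))"
      by (rule sum.Sigma[symmetric]) auto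
    also have "\<dots> = (\<Sum>j=1..q. \<Sum>k<m. \<Sum>a=1..c j. l (j, a) * C j a k * (n div b ^ k mod b))"
      by (intro sum.cong refl sum.swap)
    also have "\<dots> = (\<Sum>k<m. v k * (n div b ^ k mod b))"
      unfolding v_def sum_distrib_right by (rule sum.swap)
    finally show ?thesis by (simp add: power_sum)
  qed
  then have "(\<Sum>n<b ^ m. walsh b ?A l (\<lambda>(j, a). net_digit b m C n j a)) =
      (\<Sum>n<b ^ m. \<Prod>k<m. root_of_unity b ^ (v k * (n div b ^ k mod b)))"
    by simp
  also have "\<dots> = (\<Prod>k<m. \<Sum>e<b. root_of_unity b ^ (v k * e))"
    by (rule sum_prod_digits[OF b])
  also have "\<dots> = (if \<forall>x\<in>?A. l x = 0 then of_nat b ^ m else 0)"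
  proof (cases "\<forall>x\<in>?A. l x = 0")
    case True
    then have "v k = 0" for k by (simp add: v_def)
    then show ?thesis using True by simp
  next
    case False
    then obtain j a where ja: "j \<in> {1..q}" "a \<in> {1..c j}" "l (j, a) \<noteq> 0" by auto
    have "\<exists>k<m. \<not> [v k = 0] (mod b)"
    proof (rule ccontr)
      assume "\<not> ?thesis"
      then have "[l (j, a) = 0] (mod b)"
        using c ja unfolding rows_independent_def v_def by (auto dest!: spec[of _ "\<lambda>j a. l (j, a)"])
      moreover have "l (j, a) < b" using l ja by auto
      ultimately show False using ja by (simp add: cong_def)
    qed
    then obtain k where k: "k < m" "\<not> b dvd v k"
      by (auto simp: cong_0_iff)
    have "(\<Sum>e<b. root_of_unity b ^ (v k * e)) = (\<Sum>e<b. root_of_unity b ^ ((v k mod b) * e))"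
      by (intro sum.cong refl) (simp add: root_of_unity_power_eq_iff[OF b] mod_mult_left_eq)
    also have "\<dots> = 0"
      using k b by (intro sum_root_of_unity_power) (auto simp: mod_greater_zero_iff_not_dvd)
    finally show ?thesis using k False by (auto intro!: prod_zero)
  qed
  finally show ?thesis .
qed

text \<open>Equidistribution: every pattern of the leading digits is equally frequent. The indicator
  of the pattern is expanded into characters, of which only the trivial one has a nonzero sum over
  the net.\<close>

lemma card_net_digit_eq:
  assumes b: "b > 0" and c: "rows_independent b m q C c" and y: "\<And>j a. y (j, a) < b"
  shows "real (card {n. n < b ^ m \<and> (\<forall>j\<in>{1..q}. \<forall>a\<in>{1..c j}. net_digit b m C n j a = y (j, a))}) =
     real b ^ m / real b ^ (\<Sum>j=1..q. c j)"
proof -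
  let ?A = "SIGMA j:{1..q}. {1..c j}"
  let ?z = "\<lambda>n (j, a). net_digit b m C n j a"
  define S where "S = {n. n < b ^ m \<and> (\<forall>j\<in>{1..q}. \<forall>a\<in>{1..c j}. net_digit b m C n j a = y (j, a))}"
  have fin: "finite ?A" "finite (?A \<rightarrow>\<^sub>E {..<b})" by (auto intro!: finite_PiE)
  have card: "card ?A = (\<Sum>j=1..q. c j)" by simp
  define l0 where "l0 = (\<lambda>x\<in>?A. 0 :: nat)"
  have l0: "l0 \<in> ?A \<rightarrow>\<^sub>E {..<b}" using b by (auto simp: l0_def)
  have l0_iff: "(\<forall>x\<in>?A. l x = 0) \<longleftrightarrow> l = l0" if "l \<in> ?A \<rightarrow>\<^sub>E {..<b}" for l
    using PiE_ext[OF that l0] by (auto simp: l0_def)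
  have "of_nat b ^ card ?A * complex_of_nat (card S) = (\<Sum>n<b ^ m. if n \<in> S then of_nat b ^ card ?A else 0)"
    by (simp add: sum.If_cases S_def Int_def mult.commute)
  also have "\<dots> = (\<Sum>n<b ^ m. \<Sum>l\<in>?A \<rightarrow>\<^sub>E {..<b}. walsh b ?A l (?z n) * cnj (walsh b ?A l y))"
  proof (rule sum.cong[OF refl])
    fix n assume n: "n \<in> {..<b ^ m}"
    have "(\<forall>p\<in>?A. ?z n p = y p) \<longleftrightarrow> n \<in> S" using n by (auto simp: S_def)
    then show "(if n \<in> S then of_nat b ^ card ?A else 0) =
        (\<Sum>l\<in>?A \<rightarrow>\<^sub>E {..<b}. walsh b ?A l (?z n) * cnj (walsh b ?A l y))"
      using y b by (subst sum_walsh_mult_cnj[OF fin(1) b]) (auto simp: net_digit_def)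
  qed
  also have "\<dots> = (\<Sum>l\<in>?A \<rightarrow>\<^sub>E {..<b}. cnj (walsh b ?A l y) * (\<Sum>n<b ^ m. walsh b ?A l (?z n)))"
    by (subst sum.swap) (simp add: sum_distrib_left mult.commute)
  also have "\<dots> = (\<Sum>l\<in>?A \<rightarrow>\<^sub>E {..<b}. if l = l0 then cnj (walsh b ?A l0 y) * of_nat b ^ m else 0)"
  proof (rule sum.cong[OF refl])
    fix l assume l: "l \<in> ?A \<rightarrow>\<^sub>E {..<b}"
    show "cnj (walsh b ?A l y) * (\<Sum>n<b ^ m. walsh b ?A l (?z n)) =
        (if l = l0 then cnj (walsh b ?A l0 y) * of_nat b ^ m else 0)"
      unfolding sum_walsh_net_digit[OF b c l] l0_iff[OF l] by (cases "l = l0") simp_all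
  qed
  also have "\<dots> = of_nat b ^ m"
    using l0 fin(2) by (simp add: walsh_zero l0_def)
  finally have "of_nat (b ^ card ?A * card S) = complex_of_nat (b ^ m)" by simp
  then have "b ^ card ?A * card S = b ^ m" by (simp only: of_nat_eq_iff)
  then have "real b ^ card ?A * real (card S) = real b ^ m"
    by (metis of_nat_mult of_nat_power)
  then show ?thesis
    unfolding card S_def[symmetric] using b by (simp add: field_simps)
qed

section \<open>The variance of Walsh polynomials under scrambled net sampling\<close>

text \<open>Scrambling acts on infinitely many digits; those of a net point after the
  \<open>m\<close>-th are 0.\<close>

definition padded_net_digit :: "nat \<Rightarrow> nat \<Rightarrow> (nat \<Rightarrow> nat \<Rightarrow> nat \<Rightarrow> nat) \<Rightarrow> nat \<Rightarrow> nat \<Rightarrow> nat \<Rightarrow> nat" where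
  "padded_net_digit b m C n j a = (if 1 \<le> a \<and> a \<le> m then net_digit b m C n j a else 0)"

lemma digit_net_point:
  assumes b2: "b \<ge> 2" and a: "a \<ge> 1"
  shows "digit b (net_point b m C n j) a = padded_net_digit b m C n j a"
proof -
  define e where "e p = padded_net_digit b m C n j (Suc p)" for p
  have e: "e p < b" for p
    using b2 by (simp add: e_def padded_net_digit_def net_digit_def)
  have "digit_series b e = (\<Sum>p<m. real (e p) / real b ^ Suc p)"
    unfolding digit_series_def by (rule suminf_finite) (auto simp: e_def padded_net_digit_def)
  also have "\<dots> = (\<Sum>p<m. real (net_digit b m C n j (Suc p)) / real b ^ Suc p)"
    by (intro sum.cong) (auto simp: e_def padded_net_digit_def)
  also have "\<dots> = net_point b m C n j"
    unfolding net_point_def by (rule sum.reindex_bij_witness[where i = "\<lambda>a. a - 1" and j = Suc]) auto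
  finally have np: "net_point b m C n j = digit_series b e" ..
  have "e (m + a) \<noteq> b - 1"
    using b2 by (simp add: e_def padded_net_digit_def)
  then have "\<exists>p>a - 1. e p \<noteq> b - 1"
    using a by (intro exI[of _ "m + a"]) auto
  from digit_digit_series[OF b2 e this] have "digit b (digit_series b e) (Suc (a - 1)) = e (a - 1)" .
  then show ?thesis using a by (simp add: np e_def)
qed

text \<open>The value is 0 when the frequency vanishes in coordinate \<open>j\<close>. Summed over
  \<open>j\<close>, the levels give the Niederreiter-Rosenbloom-Tsfasman weight of the
  frequency.\<close>

definition level :: "nat \<Rightarrow> (nat \<times> nat \<Rightarrow> nat) \<Rightarrow> nat \<Rightarrow> nat" where
  "level L k j = Max (insert 0 {a \<in> {1..L}. k (j, a) \<noteq> 0})"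

lemma level_ge: "a \<in> {1..L} \<Longrightarrow> k (j, a) \<noteq> 0 \<Longrightarrow> a \<le> level L k j"
  unfolding level_def by (intro Max_ge) auto

lemma level_le: "level L k j \<le> L"
  unfolding level_def by (subst Max_le_iff) auto

lemma level_nonzero:
  assumes "level L k j \<noteq> 0"
  shows "k (j, level L k j) \<noteq> 0"
proof -
  have "level L k j \<in> insert 0 {a \<in> {1..L}. k (j, a) \<noteq> 0}"
    unfolding level_def by (rule Max_in) auto
  then show ?thesis using assms by auto
qed

text \<open>Shortens given prefix lengths to total at most \<open>M\<close>, so that the net
  property applies to them, without losing more than necessary.\<close>

lemma exists_sum_eq_min:
  fixes e :: "'a \<Rightarrow> nat"
  assumes "finite J"
  shows "\<exists>c. (\<forall>j. c j \<le> e j) \<and> (\<Sum>j\<in>J. c j) = min M (\<Sum>j\<in>J. e j)"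
  using assms
proof (induction J)
  case empty
  then show ?case by (auto intro!: exI[of _ "\<lambda>_. 0"])
next
  case (insert i J)
  then obtain c where c: "\<forall>j. c j \<le> e j" "(\<Sum>j\<in>J. c j) = min M (\<Sum>j\<in>J. e j)" by blast
  define c' where "c' j = (if j = i then min (e i) (M - (\<Sum>j\<in>J. c j)) else c j)" for j
  have "(\<Sum>j\<in>J. c' j) = (\<Sum>j\<in>J. c j)"
    using insert.hyps by (intro sum.cong) (auto simp: c'_def)
  then have "(\<Sum>j\<in>insert i J. c' j) = min (e i) (M - (\<Sum>j\<in>J. c j)) + (\<Sum>j\<in>J. c j)"
    using insert.hyps by (simp add: c'_def)
  also have "\<dots> = min M (\<Sum>j\<in>insert i J. e j)"
    unfolding c(2) sum.insert[OF insert.hyps] by arith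
  finally have "(\<Sum>j\<in>insert i J. c' j) = min M (\<Sum>j\<in>insert i J. e j)" .
  moreover have "\<forall>j. c' j \<le> e j" using c(1) by (simp add: c'_def)
  ultimately show ?case by blast
qed

lemma sum_PiE_insert:
  assumes "x \<notin> S"
  shows "(\<Sum>y\<in>insert x S \<rightarrow>\<^sub>E T. F y) = (\<Sum>y\<in>S \<rightarrow>\<^sub>E T. \<Sum>e\<in>T. F (fun_upd y x e))"
proof -
  have "(\<Sum>y\<in>insert x S \<rightarrow>\<^sub>E T. F y) = (\<Sum>(e, y)\<in>T \<times> (S \<rightarrow>\<^sub>E T). F (fun_upd y x e))"
    unfolding PiE_insert_eq
    by (subst sum.reindex[OF inj_combinator[OF assms]]) (simp add: case_prod_beta comp_def)
  also have "\<dots> = (\<Sum>e\<in>T. \<Sum>y\<in>S \<rightarrow>\<^sub>E T. F (fun_upd y x e))"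
    by (simp add: sum.cartesian_product)
  finally show ?thesis by (simp add: sum.swap[of _ T])
qed

locale net_scrambling =
  fixes b s d m t :: nat and C :: "nat \<Rightarrow> nat \<Rightarrow> nat \<Rightarrow> nat"
  assumes base: "b \<ge> 2" and dim: "s \<ge> 1" "d \<ge> 1" and net: "digital_net b t m (d * s) C"
begin

sublocale interlaced_scrambling b d s "padded_net_digit b m C"
  using base dim by unfold_locales (simp_all add: padded_net_digit_def net_digit_def)

abbreviation "grid L \<equiv> {1..d * s} \<times> {1..L}"

lemma grid: "finite (grid L)" "grid L \<subseteq> positions"
  by auto

lemma card_padded_net_digit_eq:
  assumes c: "(\<Sum>j=1..d * s. c j) \<le> m - t" and y: "\<And>j a. y (j, a) < b"
  shows "real (card {n. n < b ^ m \<and> (\<forall>j\<in>{1..d * s}. \<forall>a\<in>{1..c j}. padded_net_digit b m C n j a = y (j, a))}) =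
     real b ^ m / real b ^ (\<Sum>j=1..d * s. c j)"
proof -
  have "a \<le> m" if "j \<in> {1..d * s}" "a \<in> {1..c j}" for j a
  proof -
    have "c j \<le> (\<Sum>j=1..d * s. c j)" using that(1) by (intro member_le_sum) auto
    then show ?thesis using c atLeastAtMost_iff[THEN iffD1, OF that(2)] by linarith
  qed
  then have "padded_net_digit b m C n j a = net_digit b m C n j a" if "j \<in> {1..d * s}" "a \<in> {1..c j}" for n j a
    using that by (simp add: padded_net_digit_def)
  then have "{n. n < b ^ m \<and> (\<forall>j\<in>{1..d * s}. \<forall>a\<in>{1..c j}. padded_net_digit b m C n j a = y (j, a))} =
      {n. n < b ^ m \<and> (\<forall>j\<in>{1..d * s}. \<forall>a\<in>{1..c j}. net_digit b m C n j a = y (j, a))}"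
    by (intro Collect_cong conj_cong refl ball_cong) auto
  then show ?thesis
    using card_net_digit_eq[where y = y, OF b0 digital_net_rows_independent[OF net c] y] by simp
qed

lemma W_eq_below_level:
  assumes "k \<in> grid L \<rightarrow>\<^sub>E {..<b}"
  shows "W (grid L) n k \<omega> = W (SIGMA j:{1..d * s}. {1..level L k j}) n k \<omega>"
proof -
  have "(SIGMA j:{1..d * s}. {1..level L k j}) \<subseteq> grid L"
    using level_le[of L k] by (fastforce intro: order_trans)
  moreover have "k x = 0" if x: "x \<in> grid L - (SIGMA j:{1..d * s}. {1..level L k j})" for x
  proof (rule ccontr)
    assume "k x \<noteq> 0"
    moreover obtain j a where ja: "x = (j, a)" by force
    ultimately have "a \<le> level L k j" using x by (intro level_ge) auto
    then show False using x ja by auto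
  qed
  ultimately show ?thesis
    unfolding W_def walsh_def by (intro prod.mono_neutral_right) auto
qed

text \<open>The scrambling is fixed here. By equidistribution the sum over the net is a multiple of
  the sum over all digit patterns up to the levels. In the latter the top digit of a coordinate
  enters only as the argument of one permutation, and summing it runs through all powers in a
  nontrivial character sum.\<close>

lemma sum_W_eq_0:
  assumes k: "k \<in> grid L \<rightarrow>\<^sub>E {..<b}" and nz: "x0 \<in> grid L" "k x0 \<noteq> 0"
    and lev: "(\<Sum>j=1..d * s. level L k j) \<le> m - t" and \<omega>: "good \<omega>"
  shows "(\<Sum>n<b ^ m. W (grid L) n k \<omega>) = 0"
proof -
  let ?dg = "\<lambda>n x. padded_net_digit b m C n (fst x) (snd x)"
  define B where "B = (SIGMA j:{1..d * s}. {1..level L k j})"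
  \<comment> \<open>The factor of the Walsh function at \<open>x\<close> for an arbitrary digit
    pattern \<open>y\<close>; it depends on the pattern only up to depth \<open>snd x\<close> in one
    coordinate.\<close>
  define w where "w y x = root_of_unity b ^ (k x * (\<omega> (fst x, map (\<lambda>a. y (fst x, a)) [1..<snd x]) (y x) mod b))"
    for y :: "nat \<times> nat \<Rightarrow> nat" and x
  have finB: "finite B" "finite (B \<rightarrow>\<^sub>E {..<b})" by (auto simp: B_def intro!: finite_PiE)
  have BL: "B \<subseteq> positions" by (auto simp: B_def)
  have w_cong: "w y x = w y' x" if "x \<in> B" "\<And>z. z \<in> B \<Longrightarrow> snd z \<le> snd x \<Longrightarrow> y z = y' z" for y y' x
  proof -
    have "map (\<lambda>a. y (fst x, a)) [1..<snd x] = map (\<lambda>a. y' (fst x, a)) [1..<snd x]"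
    proof (rule map_cong[OF refl])
      fix a assume "a \<in> set [1..<snd x]"
      then have "(fst x, a) \<in> B" "a \<le> snd x" using that(1) by (auto simp: B_def)
      then show "y (fst x, a) = y' (fst x, a)" using that(2) by simp
    qed
    moreover have "y x = y' x" using that by simp
    ultimately show ?thesis unfolding w_def by (simp only:)
  qed
  have WB: "W (grid L) n k \<omega> = (\<Prod>x\<in>B. w (?dg n) x)" for n
  proof -
    have "W (grid L) n k \<omega> = W B n k \<omega>"
      unfolding B_def by (rule W_eq_below_level[OF k])
    then show ?thesis
      by (simp add: W_def walsh_def w_def scrambled_digit_def key_def)
  qed
  have "(\<Sum>n<b ^ m. W (grid L) n k \<omega>) = (\<Sum>n<b ^ m. \<Sum>y\<in>B \<rightarrow>\<^sub>E {..<b}. if (\<forall>x\<in>B. ?dg n x = y x) then (\<Prod>x\<in>B. w y x) else 0)"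
  proof (rule sum.cong[OF refl])
    fix n
    have r: "restrict (?dg n) B \<in> B \<rightarrow>\<^sub>E {..<b}" using dg_less by auto
    have "(\<Sum>y\<in>B \<rightarrow>\<^sub>E {..<b}. if (\<forall>x\<in>B. ?dg n x = y x) then (\<Prod>x\<in>B. w y x) else 0) =
        (\<Sum>y\<in>B \<rightarrow>\<^sub>E {..<b}. if y = restrict (?dg n) B then (\<Prod>x\<in>B. w (?dg n) x) else 0)"
    proof (rule sum.cong[OF refl])
      fix y assume y: "y \<in> B \<rightarrow>\<^sub>E {..<b}"
      have iff: "(\<forall>x\<in>B. ?dg n x = y x) \<longleftrightarrow> y = restrict (?dg n) B"
      proof
        assume "\<forall>x\<in>B. ?dg n x = y x"
        then show "y = restrict (?dg n) B" by (intro PiE_ext[OF y r]) simp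
      qed simp
      show "(if (\<forall>x\<in>B. ?dg n x = y x) then (\<Prod>x\<in>B. w y x) else 0) =
          (if y = restrict (?dg n) B then (\<Prod>x\<in>B. w (?dg n) x) else 0)"
      proof (cases "y = restrict (?dg n) B")
        case True
        then have "(\<Prod>x\<in>B. w y x) = (\<Prod>x\<in>B. w (?dg n) x)"
          by (intro prod.cong refl w_cong) simp_all
        then show ?thesis using True iff by (simp only: if_True refl)
      next
        case False
        then show ?thesis using iff by (simp only: if_False)
      qed
    qed
    also have "\<dots> = (\<Prod>x\<in>B. w (?dg n) x)"
      using r finB(2) by simp
    finally show "W (grid L) n k \<omega> = (\<Sum>y\<in>B \<rightarrow>\<^sub>E {..<b}. if (\<forall>x\<in>B. ?dg n x = y x) then (\<Prod>x\<in>B. w y x) else 0)"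
      unfolding WB ..
  qed
  also have "\<dots> = (\<Sum>y\<in>B \<rightarrow>\<^sub>E {..<b}. of_nat (card {n. n < b ^ m \<and> (\<forall>x\<in>B. ?dg n x = y x)}) * (\<Prod>x\<in>B. w y x))"
    by (subst sum.swap) (simp add: sum.If_cases Int_def)
  also have "\<dots> = (\<Sum>y\<in>B \<rightarrow>\<^sub>E {..<b}. of_real (real b ^ m / real b ^ (\<Sum>j=1..d * s. level L k j)) * (\<Prod>x\<in>B. w y x))"
  proof (rule sum.cong[OF refl])
    fix y assume y: "y \<in> B \<rightarrow>\<^sub>E {..<b}"
    define y' where "y' x = (if x \<in> B then y x else 0)" for x
    have "y' (j, a) < b" for j a
      using y b0 by (auto simp: y'_def)
    note card_padded_net_digit_eq[where y = y', OF lev this]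
    moreover have "{n. n < b ^ m \<and> (\<forall>j\<in>{1..d * s}. \<forall>a\<in>{1..level L k j}. padded_net_digit b m C n j a = y' (j, a))} =
        {n. n < b ^ m \<and> (\<forall>x\<in>B. ?dg n x = y x)}"
      by (auto simp: B_def y'_def)
    ultimately have "real (card {n. n < b ^ m \<and> (\<forall>x\<in>B. ?dg n x = y x)}) =
        real b ^ m / real b ^ (\<Sum>j=1..d * s. level L k j)"
      by (simp only:)
    then show "of_nat (card {n. n < b ^ m \<and> (\<forall>x\<in>B. ?dg n x = y x)}) * (\<Prod>x\<in>B. w y x) =
        of_real (real b ^ m / real b ^ (\<Sum>j=1..d * s. level L k j)) * (\<Prod>x\<in>B. w y x)"
      by (simp only: of_real_of_nat_eq[where 'a = complex, symmetric])
  qed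
  also have "\<dots> = of_real (real b ^ m / real b ^ (\<Sum>j=1..d * s. level L k j)) * (\<Sum>y\<in>B \<rightarrow>\<^sub>E {..<b}. \<Prod>x\<in>B. w y x)"
    by (simp only: sum_distrib_left)
  also have "(\<Sum>y\<in>B \<rightarrow>\<^sub>E {..<b}. \<Prod>x\<in>B. w y x) = 0"
  proof -
    obtain j0 a0 where x0: "x0 = (j0, a0)" by force
    have j0: "j0 \<in> {1..d * s}" "a0 \<in> {1..L}" using nz x0 by auto
    \<comment> \<open>Being the top position of its coordinate in \<open>B\<close>, \<open>x\<close>
      selects no permutation at another position of \<open>B\<close>.\<close>
    define x where "x = (j0, level L k j0)"
    have "a0 \<le> level L k j0" using level_ge[OF j0(2)] nz x0 by blast
    then have l: "level L k j0 \<noteq> 0" using j0 by auto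
    then have kx: "k x \<noteq> 0" using level_nonzero x_def by blast
    have "x \<in> grid L" using level_le[of L k j0] l j0 by (simp add: x_def)
    then have kb: "k x < b" using k by blast
    have x: "x \<in> B" using l j0 by (simp add: x_def B_def)
    define B' where "B' = B - {x}"
    have B': "B = insert x B'" "x \<notin> B'" using x by (auto simp: B'_def)
    have zero: "(\<Sum>e<b. \<Prod>z\<in>B. w (fun_upd y x e) z) = 0" if "y \<in> B' \<rightarrow>\<^sub>E {..<b}" for y
    proof -
      have other: "w (fun_upd y x e) z = w (fun_upd y x 0) z" if z: "z \<in> B'" for e z
      proof (cases "fst z = j0")
        case False
        have "map (\<lambda>a. (fun_upd y x e) (fst z, a)) [1..<snd z] = map (\<lambda>a. (fun_upd y x 0) (fst z, a)) [1..<snd z]"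
          using False by (simp add: x_def)
        moreover have "(fun_upd y x e) z = (fun_upd y x 0) z" using False by (auto simp: x_def)
        ultimately show ?thesis unfolding w_def by (simp only:)
      next
        case True
        have "snd z \<noteq> level L k j0" using z True B' by (metis prod.collapse x_def)
        moreover have "snd z \<le> level L k j0" using z True by (auto simp: B'_def B_def)
        ultimately have lt: "snd z < level L k j0" by simp
        show ?thesis
        proof (rule w_cong)
          show "z \<in> B" using z B' by blast
          fix z' :: "nat \<times> nat" assume "z' \<in> B" "snd z' \<le> snd z"
          then have "z' \<noteq> x" using lt by (auto simp: x_def)
          then show "(fun_upd y x e) z' = (fun_upd y x 0) z'" by simp
        qed
      qed
      define \<kappa> where "\<kappa> = (j0, map (\<lambda>a. y (j0, a)) [1..<level L k j0])"
      have wx: "w (fun_upd y x e) x = root_of_unity b ^ (k x * (\<omega> \<kappa> e mod b))" for e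
      proof -
        have "map (\<lambda>a. (fun_upd y x e) (j0, a)) [1..<level L k j0] = map (\<lambda>a. y (j0, a)) [1..<level L k j0]"
          by (rule map_cong[OF refl]) (auto simp: x_def)
        moreover have "fst x = j0" "snd x = level L k j0" by (simp_all add: x_def)
        ultimately show ?thesis unfolding w_def \<kappa>_def by (simp only: fun_upd_same)
      qed
      have "\<kappa> \<in> keys"
      proof -
        have "y (j0, a) < b" if "a \<in> set [1..<level L k j0]" for a
        proof -
          have "(j0, a) \<in> B'" using that j0 by (auto simp: B'_def B_def x_def)
          then show ?thesis using \<open>y \<in> B' \<rightarrow>\<^sub>E {..<b}\<close> by blast
        qed
        then show ?thesis using j0 by (auto simp: \<kappa>_def)
      qed
      with \<omega>[unfolded good_def] have perm: "\<omega> \<kappa> permutes {..<b}" by (rule bspec)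
      have "(\<Sum>e<b. \<Prod>z\<in>B. w (fun_upd y x e) z) = (\<Sum>e<b. w (fun_upd y x e) x * (\<Prod>z\<in>B'. w (fun_upd y x 0) z))"
      proof (rule sum.cong[OF refl])
        fix e
        have "(\<Prod>z\<in>B'. w (fun_upd y x e) z) = (\<Prod>z\<in>B'. w (fun_upd y x 0) z)"
          by (rule prod.cong[OF refl]) (rule other)
        then show "(\<Prod>z\<in>B. w (fun_upd y x e) z) = w (fun_upd y x e) x * (\<Prod>z\<in>B'. w (fun_upd y x 0) z)"
          using finB(1) B' by simp
      qed
      also have "\<dots> = (\<Sum>e<b. root_of_unity b ^ (k x * (\<omega> \<kappa> e mod b))) * (\<Prod>z\<in>B'. w (fun_upd y x 0) z)"
        unfolding wx by (simp only: sum_distrib_right)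
      also have "(\<Sum>e<b. root_of_unity b ^ (k x * (\<omega> \<kappa> e mod b))) = (\<Sum>e<b. root_of_unity b ^ (k x * (e mod b)))"
        by (rule sum.permute[OF perm, symmetric, unfolded comp_def])
      also have "\<dots> = (\<Sum>e<b. root_of_unity b ^ (k x * e))"
        by (intro sum.cong) auto
      also have "\<dots> = 0"
        using kx kb by (intro sum_root_of_unity_power b0) auto
      finally show ?thesis unfolding mult_zero_left .
    qed
    show ?thesis
      unfolding B'(1) sum_PiE_insert[OF B'(2)] by (rule sum.neutral[OF ballI]) (rule zero[unfolded B'(1)])
  qed
  finally show ?thesis by simp
qed

section \<open>Second moments of the means of Walsh functions over the net\<close>

definition net_mean :: "nat \<Rightarrow> (nat \<times> nat \<Rightarrow> nat) \<Rightarrow> (nat \<times> nat list \<Rightarrow> nat \<Rightarrow> nat) \<Rightarrow> complex" where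
  "net_mean L k \<omega> = (\<Sum>n<b ^ m. W (grid L) n k \<omega>) / of_nat (b ^ m)"

lemma bounded_measurable_net_mean: "bounded_measurable \<Omega> (net_mean L k)"
  unfolding net_mean_def[abs_def] by (intro bounded_measurable_intros bounded_measurable_W grid)

lemma expectation_net_mean_mult_cnj:
  "Om.expectation (\<lambda>\<omega>. net_mean L k \<omega> * cnj (net_mean L l \<omega>)) =
    (\<Sum>n<b ^ m. \<Sum>n'<b ^ m. Om.expectation (\<lambda>\<omega>. W (grid L) n k \<omega> * cnj (W (grid L) n' l \<omega>))) / (of_nat (b ^ m))\<^sup>2"
proof -
  have int: "integrable \<Omega> (\<lambda>\<omega>. W (grid L) n k \<omega> * cnj (W (grid L) n' l \<omega>))" for n n'
    by (intro Om.integrable_bounded_measurable bounded_measurable_intros bounded_measurable_W grid)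
  have "Om.expectation (\<lambda>\<omega>. net_mean L k \<omega> * cnj (net_mean L l \<omega>)) =
     Om.expectation (\<lambda>\<omega>. (\<Sum>n<b ^ m. \<Sum>n'<b ^ m. W (grid L) n k \<omega> * cnj (W (grid L) n' l \<omega>)) / (of_nat (b ^ m))\<^sup>2)"
    by (simp add: net_mean_def sum_product power2_eq_square)
  also have "\<dots> = (\<Sum>n<b ^ m. \<Sum>n'<b ^ m. Om.expectation (\<lambda>\<omega>. W (grid L) n k \<omega> * cnj (W (grid L) n' l \<omega>))) / (of_nat (b ^ m))\<^sup>2"
    using int by (simp only: integral_divide_zero Bochner_Integration.integral_sum Bochner_Integration.integrable_sum)
  finally show ?thesis .
qed

lemma expectation_net_mean_orthogonal:
  assumes "k \<in> grid L \<rightarrow>\<^sub>E {..<b}" "l \<in> grid L \<rightarrow>\<^sub>E {..<b}" "k \<noteq> l"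
  shows "Om.expectation (\<lambda>\<omega>. net_mean L k \<omega> * cnj (net_mean L l \<omega>)) = 0"
  unfolding expectation_net_mean_mult_cnj using expectation_W_mult_cnj[OF grid assms(1,2)] assms(3) by simp

text \<open>Points that share fewer than \<open>level L k j - 1\<close> digits in some coordinate \<open>j\<close> have uncorrelated
  Walsh values, and the net property bounds the number of the remaining pairs.\<close>

lemma expectation_net_mean_le:
  assumes k: "k \<in> grid L \<rightarrow>\<^sub>E {..<b}" and lev: "m - t < (\<Sum>j=1..d * s. level L k j)"
  shows "Om.expectation (\<lambda>\<omega>. (cmod (net_mean L k \<omega>))\<^sup>2) \<le> real b ^ (d * s) / real b ^ (m - t)"
proof -
  let ?q = "d * s" and ?dg = "padded_net_digit b m C"
  let ?E = "\<lambda>n n'. Om.expectation (\<lambda>\<omega>. W (grid L) n k \<omega> * cnj (W (grid L) n' k \<omega>))"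
  \<comment> \<open>Correlated points share \<open>level - 1\<close> digits in each coordinate and
    so at least the first \<open>c j\<close>; these prefixes are short enough for exact
    counting.\<close>
  obtain c where c: "\<forall>j. c j \<le> level L k j - 1" "(\<Sum>j=1..?q. c j) = min (m - t) (\<Sum>j=1..?q. level L k j - 1)"
    using exists_sum_eq_min[of "{1..?q}" "\<lambda>j. level L k j - 1" "m - t"] by auto
  have cM: "(\<Sum>j=1..?q. c j) \<le> m - t" using c(2) by simp
  \<comment> \<open>Replacing a level by \<open>level - 1\<close> loses at most one digit in each of
    the \<open>d * s\<close> coordinates. This is the origin of the factor
    \<open>b ^ (d * s)\<close>.\<close>
  have "(\<Sum>j=1..?q. level L k j) \<le> (\<Sum>j=1..?q. (level L k j - 1) + 1)"
    by (intro sum_mono) simp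
  also have "\<dots> = (\<Sum>j=1..?q. level L k j - 1) + ?q"
    by (simp only: sum.distrib) simp
  finally have sum_c: "m - t \<le> (\<Sum>j=1..?q. c j) + ?q"
    using c(2) lev by linarith
  have E1: "cmod (?E n n') \<le> 1" for n n'
  proof -
    have "cmod (?E n n') \<le> Om.expectation (\<lambda>\<omega>. cmod (W (grid L) n k \<omega> * cnj (W (grid L) n' k \<omega>)))"
      by (rule integral_norm_bound)
    then show ?thesis by (simp add: norm_mult W_def Om.prob_space)
  qed
  define S where "S n = {n'. n' < b ^ m \<and> (\<forall>j\<in>{1..?q}. \<forall>a\<in>{1..c j}. ?dg n' j a = ?dg n j a)}" for n
  have E0: "?E n n' = 0" if n': "n' < b ^ m" "n' \<notin> S n" for n n'
  proof (rule expectation_W_mult_cnj[OF grid k k])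
    obtain j a where ja: "j \<in> {1..?q}" "a \<in> {1..c j}" "?dg n' j a \<noteq> ?dg n j a"
      using n' by (auto simp: S_def)
    \<comment> \<open>The digit in which the points differ comes strictly before this top position,
      so they use different permutations there, and the frequency is nonzero there.\<close>
    let ?x = "(j, level L k j)"
    have lt: "a < level L k j" using ja(2) c(1)[rule_format, of j] by auto
    then have "level L k j \<noteq> 0" by simp
    then have "k ?x \<noteq> 0" by (rule level_nonzero)
    moreover have "?x \<in> grid L" using ja(1) lt level_le[of L k j] by auto
    moreover have "key n ?x \<noteq> key n' ?x"
    proof
      assume "key n ?x = key n' ?x"
      then have "\<forall>a\<in>set [1..<level L k j]. ?dg n j a = ?dg n' j a"
        by (simp add: key_def)
      moreover have "a \<in> set [1..<level L k j]" using ja(2) lt by auto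
      ultimately show False using ja(3) by metis
    qed
    ultimately show "\<not> (k = k \<and> (\<forall>x\<in>grid L. k x \<noteq> 0 \<longrightarrow> key n x = key n' x))" by blast
  qed
  have cardS: "real (card (S n)) \<le> real b ^ ?q * (real b ^ m / real b ^ (m - t))" for n
  proof -
    have "real (card (S n)) = real b ^ m / real b ^ (\<Sum>j=1..?q. c j)"
      unfolding S_def using card_padded_net_digit_eq[OF cM, of "\<lambda>(j, a). ?dg n j a"] dg_less by simp
    also have "\<dots> \<le> real b ^ m / (real b ^ (m - t) / real b ^ ?q)"
    proof (intro divide_left_mono)
      have "real b ^ (m - t) \<le> real b ^ ((\<Sum>j=1..?q. c j) + ?q)"
        using sum_c b0 by (intro power_increasing) auto
      then show "real b ^ (m - t) / real b ^ ?q \<le> real b ^ (\<Sum>j=1..?q. c j)"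
        using b0 by (simp add: field_simps power_add)
    qed (use b0 in auto)
    finally show ?thesis by (simp add: mult.commute)
  qed
  have "complex_of_real (Om.expectation (\<lambda>\<omega>. (cmod (net_mean L k \<omega>))\<^sup>2)) =
      (\<Sum>n<b ^ m. \<Sum>n'<b ^ m. ?E n n') / (of_nat (b ^ m))\<^sup>2"
    unfolding Om.of_real_expectation_cmod_square[OF bounded_measurable_net_mean] expectation_net_mean_mult_cnj ..
  then have e1: "cmod (complex_of_real (Om.expectation (\<lambda>\<omega>. (cmod (net_mean L k \<omega>))\<^sup>2))) =
      cmod (\<Sum>n<b ^ m. \<Sum>n'<b ^ m. ?E n n') / (real (b ^ m))\<^sup>2"
    by (simp only: norm_divide norm_power norm_of_nat)
  have e2: "cmod (complex_of_real (Om.expectation (\<lambda>\<omega>. (cmod (net_mean L k \<omega>))\<^sup>2))) =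
      Om.expectation (\<lambda>\<omega>. (cmod (net_mean L k \<omega>))\<^sup>2)"
    by (simp add: integral_nonneg_AE)
  have e3: "cmod (\<Sum>n<b ^ m. \<Sum>n'<b ^ m. ?E n n') \<le> real (b ^ m) * (real b ^ ?q * (real b ^ m / real b ^ (m - t)))"
  proof -
    have "cmod (\<Sum>n'<b ^ m. ?E n n') \<le> real b ^ ?q * (real b ^ m / real b ^ (m - t))" for n
    proof -
      have "(\<Sum>n'<b ^ m. ?E n n') = (\<Sum>n'\<in>S n. ?E n n')"
        using E0 by (intro sum.mono_neutral_right) (auto simp: S_def)
      also have "cmod \<dots> \<le> of_nat (card (S n)) * 1"
        using E1 by (intro sum_norm_bound)
      finally show ?thesis using cardS[of n] by simp
    qed
    then have "cmod (\<Sum>n<b ^ m. \<Sum>n'<b ^ m. ?E n n') \<le> of_nat (card {..<b ^ m}) * (real b ^ ?q * (real b ^ m / real b ^ (m - t)))"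
      by (intro sum_norm_bound)
    then show ?thesis by simp
  qed
  have "Om.expectation (\<lambda>\<omega>. (cmod (net_mean L k \<omega>))\<^sup>2) \<le>
      real (b ^ m) * (real b ^ ?q * (real b ^ m / real b ^ (m - t))) / (real (b ^ m))\<^sup>2"
    unfolding e1[unfolded e2] by (rule divide_right_mono[OF e3]) simp
  also have "\<dots> = real b ^ ?q / real b ^ (m - t)"
    using b0 by (simp add: power2_eq_square field_simps)
  finally show ?thesis .
qed

lemma expectation_net_mean_eq_0:
  assumes k: "k \<in> grid L \<rightarrow>\<^sub>E {..<b}" and nz: "x0 \<in> grid L" "k x0 \<noteq> 0"
    and lev: "(\<Sum>j=1..d * s. level L k j) \<le> m - t"
  shows "Om.expectation (\<lambda>\<omega>. (cmod (net_mean L k \<omega>))\<^sup>2) = 0"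
proof -
  have "AE \<omega> in \<Omega>. (cmod (net_mean L k \<omega>))\<^sup>2 = 0"
    using AE_good
  proof eventually_elim
    case (elim \<omega>)
    then show ?case unfolding net_mean_def sum_W_eq_0[OF k nz lev elim] by simp
  qed
  then have "Om.expectation (\<lambda>\<omega>. (cmod (net_mean L k \<omega>))\<^sup>2) = Om.expectation (\<lambda>\<omega>. 0)"
    using bounded_measurable_net_mean[of L k] by (intro integral_cong_AE) (auto simp: bounded_measurable_def)
  then show ?thesis by simp
qed

text \<open>Orthogonality splits the second moment by frequency. The low level sums drop out, and
  the others share one bound on the gain.\<close>

lemma expectation_walsh_polynomial_le:
  fixes c :: "(nat \<times> nat \<Rightarrow> nat) \<Rightarrow> complex" and L :: nat
  defines "K \<equiv> {k \<in> grid L \<rightarrow>\<^sub>E {..<b}. \<exists>x\<in>grid L. k x \<noteq> 0}"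
  shows "Om.expectation (\<lambda>\<omega>. (cmod (\<Sum>k\<in>K. c k * net_mean L k \<omega>))\<^sup>2) \<le>
    real b ^ (d * s) / real b ^ (m - t) * (\<Sum>k | k \<in> K \<and> m - t < (\<Sum>j=1..d * s. level L k j). (cmod (c k))\<^sup>2)"
proof -
  let ?G = "real b ^ (d * s) / real b ^ (m - t)"
  have finK: "finite K"
    unfolding K_def using grid by (intro finite_subset[OF _ finite_PiE[of "grid L" "\<lambda>_. {..<b}"]]) auto
  have "Om.expectation (\<lambda>\<omega>. (cmod (\<Sum>k\<in>K. c k * net_mean L k \<omega>))\<^sup>2) =
      (\<Sum>k\<in>K. (cmod (c k))\<^sup>2 * Om.expectation (\<lambda>\<omega>. (cmod (net_mean L k \<omega>))\<^sup>2))"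
    by (rule Om.expectation_cmod_square_orthogonal_sum[OF finK bounded_measurable_net_mean])
       (unfold K_def mem_Collect_eq, elim conjE, rule expectation_net_mean_orthogonal)
  also have "\<dots> \<le> (\<Sum>k\<in>K. if m - t < (\<Sum>j=1..d * s. level L k j) then ?G * (cmod (c k))\<^sup>2 else 0)"
  proof (rule sum_mono)
    fix k assume k: "k \<in> K"
    then have kP: "k \<in> grid L \<rightarrow>\<^sub>E {..<b}" by (simp add: K_def)
    show "(cmod (c k))\<^sup>2 * Om.expectation (\<lambda>\<omega>. (cmod (net_mean L k \<omega>))\<^sup>2) \<le>
        (if m - t < (\<Sum>j=1..d * s. level L k j) then ?G * (cmod (c k))\<^sup>2 else 0)"
    proof (cases "m - t < (\<Sum>j=1..d * s. level L k j)")
      case True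
      have "(cmod (c k))\<^sup>2 * Om.expectation (\<lambda>\<omega>. (cmod (net_mean L k \<omega>))\<^sup>2) \<le> (cmod (c k))\<^sup>2 * ?G"
        by (intro mult_left_mono expectation_net_mean_le[OF kP True]) simp
      then show ?thesis using True by (simp only: if_True mult.commute)
    next
      case False
      obtain x0 where "x0 \<in> grid L" "k x0 \<noteq> 0" using k by (auto simp: K_def)
      from expectation_net_mean_eq_0[OF kP this] False show ?thesis by simp
    qed
  qed
  also have "\<dots> = ?G * (\<Sum>k | k \<in> K \<and> m - t < (\<Sum>j=1..d * s. level L k j). (cmod (c k))\<^sup>2)"
    using finK by (simp add: sum.If_cases Int_def sum_distrib_left)
  finally show ?thesis .
qed

end

section \<open>Decay of the Walsh coefficients of smooth functions\<close>

text \<open>The \<open>r\<close> largest values have at least the average of all of them. Removing a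
  minimal element never lowers the average, so it is repeated until \<open>r\<close> elements
  remain.\<close>

lemma exists_large_subset:
  fixes l :: "'a \<Rightarrow> nat"
  assumes "finite J" "r \<ge> 1" "r \<le> card J"
  shows "\<exists>w\<subseteq>J. card w = r \<and> r * (\<Sum>j\<in>J. l j) \<le> card J * (\<Sum>j\<in>w. l j)"
  using assms(1,3)
proof (induction "card J - r" arbitrary: J)
  case 0
  then have "card J = r" by simp
  then show ?case by blast
next
  case (Suc n)
  then have J: "finite J" "J \<noteq> {}" "card J > r" by auto
  define i where "i = arg_min_on l J"
  have i: "i \<in> J" "\<And>j. j \<in> J \<Longrightarrow> l i \<le> l j"
    using arg_min_if_finite(1)[OF J(1,2)] arg_min_least[OF J(1,2)] by (auto simp: i_def)
  have cJ: "card (J - {i}) = card J - 1" using i(1) J by simp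
  have "n = card (J - {i}) - r" "finite (J - {i})" "r \<le> card (J - {i})"
    using Suc.hyps(2) J cJ by auto
  from Suc.hyps(1)[OF this] obtain w where w: "w \<subseteq> J - {i}" "card w = r"
    "r * (\<Sum>j\<in>J - {i}. l j) \<le> (card J - 1) * (\<Sum>j\<in>w. l j)"
    unfolding cJ by blast
  have sum_J: "(\<Sum>j\<in>J. l j) = l i + (\<Sum>j\<in>J - {i}. l j)"
    using J(1) i(1) by (simp add: sum.remove)
  have "card J * l i \<le> (\<Sum>j\<in>J. l j)"
    using i(2) sum_mono[of J "\<lambda>_. l i" l] by simp
  obtain c where c: "card J = Suc c" "c \<ge> 1" using J(3) assms(2) by (cases "card J") auto
  have "c * (\<Sum>j\<in>J. l j) + (\<Sum>j\<in>J. l j) = card J * l i + card J * (\<Sum>j\<in>J - {i}. l j)"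
    by (simp add: c sum_J algebra_simps)
  with \<open>card J * l i \<le> _\<close> have "c * (\<Sum>j\<in>J. l j) \<le> card J * (\<Sum>j\<in>J - {i}. l j)"
    by linarith
  then have "r * (c * (\<Sum>j\<in>J. l j)) \<le> r * (card J * (\<Sum>j\<in>J - {i}. l j))"
    by (rule mult_left_mono) simp
  also have "\<dots> = card J * (r * (\<Sum>j\<in>J - {i}. l j))" by simp
  also have "\<dots> \<le> card J * (c * (\<Sum>j\<in>w. l j))"
    using w(3) c by (intro mult_left_mono) auto
  finally have "c * (r * (\<Sum>j\<in>J. l j)) \<le> c * (card J * (\<Sum>j\<in>w. l j))"
    by (simp only: mult_ac)
  then have "r * (\<Sum>j\<in>J. l j) \<le> card J * (\<Sum>j\<in>w. l j)"
    using c(2) by simp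
  then show ?case using w by blast
qed

text \<open>Take all of \<open>J\<close> if that is allowed and its \<alpha> largest values
  otherwise; since \<open>card J \<le> d\<close>, either choice carries the share
  \<open>min \<alpha> d / d\<close>.\<close>

lemma exists_dominating_subset:
  fixes l :: "'a \<Rightarrow> nat"
  assumes J: "finite J" "J \<noteq> {}" "card J \<le> d" and \<alpha>: "\<alpha> \<ge> 1"
  shows "\<exists>w\<subseteq>J. card w \<in> {1..\<alpha>} \<and> min \<alpha> d * (\<Sum>j\<in>J. l j) \<le> d * (\<Sum>j\<in>w. l j)"
proof (cases "card J \<le> \<alpha>")
  case True
  have "card J \<ge> 1" using J by (simp add: Suc_le_eq card_gt_0_iff)
  then show ?thesis using True by (intro exI[of _ J]) (simp add: mult_right_mono)
next
  case False
  then obtain w where w: "w \<subseteq> J" "card w = \<alpha>" "\<alpha> * (\<Sum>j\<in>J. l j) \<le> card J * (\<Sum>j\<in>w. l j)"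
    using exists_large_subset[OF J(1) \<alpha>, of l] by auto
  have "min \<alpha> d * (\<Sum>j\<in>J. l j) \<le> \<alpha> * (\<Sum>j\<in>J. l j)" by (intro mult_right_mono) auto
  also note w(3)
  also have "card J * (\<Sum>j\<in>w. l j) \<le> d * (\<Sum>j\<in>w. l j)" using J(3) by (intro mult_right_mono) auto
  finally show ?thesis using w \<alpha> by auto
qed

lemma mixed_partial_eq_foldr:
  "mixed_partial u \<nu> g = foldr partial (concat (map (\<lambda>i. replicate (\<nu> i) i) (sorted_list_of_set u))) g"
proof -
  have "foldr (\<lambda>i g. (partial i ^^ \<nu> i) g) is g = foldr partial (concat (map (\<lambda>i. replicate (\<nu> i) i) is)) g" for "is"
    by (induction "is") (simp_all add: foldr_replicate)
  then show ?thesis by (simp add: mixed_partial_def)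
qed

lemma digit_series_update:
  assumes b2: "b \<ge> 2" and e: "\<And>p. e p < b" "\<And>p. e' p < b" and eq: "\<And>r. r \<noteq> p \<Longrightarrow> e' r = e r"
  shows "digit_series b e' = digit_series b e + (real (e' p) - real (e p)) / real b ^ Suc p"
proof -
  have "digit_series b e' - digit_series b e =
      (\<Sum>r. real (e' r) / real b ^ Suc r - real (e r) / real b ^ Suc r)"
    unfolding digit_series_def
    by (rule suminf_diff) (rule summable_digits[OF b2], rule e)+
  also have "\<dots> = (\<Sum>r\<in>{p}. real (e' r) / real b ^ Suc r - real (e r) / real b ^ Suc r)"
    by (rule suminf_finite) (auto simp: eq)
  also have "\<dots> = (real (e' p) - real (e p)) / real b ^ Suc p"
    by (simp add: diff_divide_distrib)
  finally show ?thesis by simp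
qed

text \<open>A lower bound for the distance from 1 of the other \<open>b\<close>-th roots of unity.
  The cap at 1 makes its powers decrease, so that the number of differences can be replaced by its
  upper bound.\<close>

definition root_gap :: "nat \<Rightarrow> real" where
  "root_gap b = Min (insert 1 ((\<lambda>e. cmod (root_of_unity b ^ e - 1)) ` {1..<b}))"

lemma root_gap_pos: "b > 0 \<Longrightarrow> root_gap b > 0"
  unfolding root_gap_def by (subst Min_gr_iff) (auto simp: root_of_unity_power_eq_1_iff dest: dvd_imp_le)

lemma root_gap_le: "0 < e \<Longrightarrow> e < b \<Longrightarrow> root_gap b \<le> cmod (root_of_unity b ^ e - 1)"
  unfolding root_gap_def by (intro Min_le) auto

lemma root_gap_le_1: "root_gap b \<le> 1"
  unfolding root_gap_def by (intro Min_le) auto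

text \<open>\<open>group_of\<close> and \<open>depth_of\<close> invert
  \<open>interlaced_position\<close>: they name the interlaced coordinate, and the digit index
  counted from 0, at which a source digit lands.\<close>

definition group_of :: "nat \<Rightarrow> nat \<Rightarrow> nat" where
  "group_of d j = (j - 1) div d + 1"

definition depth_of :: "nat \<Rightarrow> nat \<times> nat \<Rightarrow> nat" where
  "depth_of d x = (snd x - 1) * d + (fst x - 1) mod d"

lemma interlaced_position_group_depth:
  assumes "d \<ge> 1" "fst x \<ge> 1" "snd x \<ge> 1"
  shows "interlaced_position d (group_of d (fst x)) (depth_of d x) = x"
proof -
  have "(fst x - 1) mod d < d" using assms(1) by simp
  then have "depth_of d x mod d = (fst x - 1) mod d" "depth_of d x div d = snd x - 1"
    by (simp_all add: depth_of_def)
  then show ?thesis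
    using assms by (simp add: interlaced_position_def group_of_def prod_eq_iff div_mult_mod_eq)
qed

section \<open>Differences along turns of scrambled digits\<close>

context interlaced_scrambling
begin

lemma group_of_in: "j \<in> {1..d * s} \<Longrightarrow> group_of d j \<in> {1..s}"
  using d1 by (auto simp: group_of_def Suc_le_eq less_mult_imp_div_less mult.commute)

lemma pos_group_depth: "x \<in> positions \<Longrightarrow> pos (group_of d (fst x)) (depth_of d x) = x"
  by (rule interlaced_position_group_depth[OF d1]) auto

text \<open>Differences on the probability space. They have two readings: paired with a Walsh
  function they multiply a coefficient by known factors, and evaluated on the point they are
  ordinary iterated differences.\<close>

fun turn_differences ::
    "(nat \<times> nat list) list \<Rightarrow> ((nat \<times> nat list \<Rightarrow> nat \<Rightarrow> nat) \<Rightarrow> complex) \<Rightarrow>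
     (nat \<times> nat list \<Rightarrow> nat \<Rightarrow> nat) \<Rightarrow> complex" where
  "turn_differences [] Z \<omega> = Z \<omega>"
| "turn_differences (\<kappa> # \<kappa>s) Z \<omega> = turn_differences \<kappa>s Z (turn \<kappa> \<omega>) - turn_differences \<kappa>s Z \<omega>"

lemma bounded_measurable_turn:
  assumes "bounded_measurable \<Omega> Z" "\<kappa> \<in> keys"
  shows "bounded_measurable \<Omega> (\<lambda>\<omega>. Z (turn \<kappa> \<omega>))"
proof -
  obtain B where Z: "Z \<in> borel_measurable \<Omega>" "\<forall>\<omega>\<in>space \<Omega>. cmod (Z \<omega>) \<le> B"
    using assms(1) by (auto simp: bounded_measurable_def)
  show ?thesis
    using measurable_compose[OF measurable_turn[OF assms(2)] Z(1)] Z(2)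
      measurable_space[OF measurable_turn[OF assms(2)]]
    by (intro bounded_measurableI[where B = B]) auto
qed

lemma bounded_measurable_turn_differences:
  assumes "bounded_measurable \<Omega> Z" "set \<kappa>s \<subseteq> keys"
  shows "bounded_measurable \<Omega> (turn_differences \<kappa>s Z)"
  using assms(2)
proof (induction \<kappa>s)
  case Nil
  have "turn_differences [] Z = Z" by (rule ext) simp
  then show ?case using assms(1) by simp
next
  case (Cons \<kappa> \<kappa>s)
  have "turn_differences (\<kappa> # \<kappa>s) Z = (\<lambda>\<omega>. turn_differences \<kappa>s Z (turn \<kappa> \<omega>) - turn_differences \<kappa>s Z \<omega>)"
    by (rule ext) simp
  then show ?case
    using Cons by (simp only:) (intro bounded_measurable_diff bounded_measurable_turn, auto)
qed

text \<open>Summation by parts: invariance of the law moves each turn from \<open>Z\<close> to the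
  Walsh function, which is an eigenfunction of it.\<close>

lemma expectation_turn_differences:
  assumes A: "finite A" "A \<subseteq> positions" and Z: "bounded_measurable \<Omega> Z" and xs: "set xs \<subseteq> A"
  shows "Om.expectation (\<lambda>\<omega>. turn_differences (map (key n) xs) Z \<omega> * cnj (W A n k \<omega>)) =
    (\<Prod>x\<leftarrow>xs. root_of_unity b ^ k x - 1) * Om.expectation (\<lambda>\<omega>. Z \<omega> * cnj (W A n k \<omega>))"
  using xs
proof (induction xs)
  case (Cons x xs)
  have x: "x \<in> A" and xs: "set xs \<subseteq> A" using Cons.prems by auto
  have \<kappa>: "key n x \<in> keys" by (rule key_in_keys) (use x A in blast)
  have "set (map (key n) xs) \<subseteq> keys"
    unfolding set_map by (intro image_subsetI key_in_keys) (use xs A in blast)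
  from bounded_measurable_turn_differences[OF Z this]
  have T: "bounded_measurable \<Omega> (turn_differences (map (key n) xs) Z)" .
  let ?T = "turn_differences (map (key n) xs) Z"
  have Wb: "bounded_measurable \<Omega> (W A n k)" by (rule bounded_measurable_W[OF A(2)])
  have TW: "bounded_measurable \<Omega> (\<lambda>\<omega>. ?T \<omega> * cnj (W A n k \<omega>))"
    by (intro bounded_measurable_intros T Wb)
  have TW': "bounded_measurable \<Omega> (\<lambda>\<omega>. ?T (turn (key n x) \<omega>) * cnj (W A n k \<omega>))"
    by (intro bounded_measurable_intros bounded_measurable_turn T Wb \<kappa>)
  have one: "root_of_unity b ^ k x * cnj (root_of_unity b ^ k x) = 1"
    by (simp add: root_of_unity_power_mult_cnj_eq_1_iff[OF b0] del: complex_cnj_power)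
  have "Om.expectation (\<lambda>\<omega>. ?T (turn (key n x) \<omega>) * cnj (W A n k \<omega>)) =
      Om.expectation (\<lambda>\<omega>. root_of_unity b ^ k x * (?T (turn (key n x) \<omega>) * cnj (W A n k (turn (key n x) \<omega>))))"
  proof (rule integral_cong_AE)
    show "AE \<omega> in \<Omega>. ?T (turn (key n x) \<omega>) * cnj (W A n k \<omega>) =
        root_of_unity b ^ k x * (?T (turn (key n x) \<omega>) * cnj (W A n k (turn (key n x) \<omega>)))"
      using AE_good
    proof eventually_elim
      case (elim \<omega>)
      have "root_of_unity b ^ k x * (?T (turn (key n x) \<omega>) * cnj (W A n k (turn (key n x) \<omega>))) =
          (root_of_unity b ^ k x * cnj (root_of_unity b ^ k x)) * (?T (turn (key n x) \<omega>) * cnj (W A n k \<omega>))"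
        unfolding W_turn[OF elim A x] complex_cnj_mult by (simp only: mult_ac)
      then show ?case unfolding one mult_1_left by (rule sym)
    qed
    show "(\<lambda>\<omega>. ?T (turn (key n x) \<omega>) * cnj (W A n k \<omega>)) \<in> borel_measurable \<Omega>"
      using TW' by (simp add: bounded_measurable_def)
    have "bounded_measurable \<Omega> (\<lambda>\<omega>. root_of_unity b ^ k x * (?T (turn (key n x) \<omega>) * cnj (W A n k (turn (key n x) \<omega>))))"
      by (intro bounded_measurable_intros bounded_measurable_turn T Wb \<kappa>)
    then show "(\<lambda>\<omega>. root_of_unity b ^ k x * (?T (turn (key n x) \<omega>) * cnj (W A n k (turn (key n x) \<omega>)))) \<in> borel_measurable \<Omega>"
      by (simp add: bounded_measurable_def)
  qed
  also have "\<dots> = root_of_unity b ^ k x * Om.expectation (\<lambda>\<omega>. ?T \<omega> * cnj (W A n k \<omega>))"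
    using expectation_turn[OF \<kappa>, of "\<lambda>\<omega>. ?T \<omega> * cnj (W A n k \<omega>)"] TW
    by (simp add: bounded_measurable_def)
  finally have 1: "Om.expectation (\<lambda>\<omega>. ?T (turn (key n x) \<omega>) * cnj (W A n k \<omega>)) =
      root_of_unity b ^ k x * Om.expectation (\<lambda>\<omega>. ?T \<omega> * cnj (W A n k \<omega>))" .
  have "Om.expectation (\<lambda>\<omega>. turn_differences (map (key n) (x # xs)) Z \<omega> * cnj (W A n k \<omega>)) =
      Om.expectation (\<lambda>\<omega>. ?T (turn (key n x) \<omega>) * cnj (W A n k \<omega>) - ?T \<omega> * cnj (W A n k \<omega>))"
    by (simp add: left_diff_distrib)
  also have "\<dots> = Om.expectation (\<lambda>\<omega>. ?T (turn (key n x) \<omega>) * cnj (W A n k \<omega>)) - Om.expectation (\<lambda>\<omega>. ?T \<omega> * cnj (W A n k \<omega>))"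
    by (intro Bochner_Integration.integral_diff Om.integrable_bounded_measurable TW TW')
  also have "\<dots> = (root_of_unity b ^ k x - 1) * Om.expectation (\<lambda>\<omega>. ?T \<omega> * cnj (W A n k \<omega>))"
    unfolding 1 by (simp add: left_diff_distrib)
  finally show ?case
    unfolding Cons.IH[OF xs] by (simp add: mult.assoc)
qed simp

text \<open>The displacement of the interlaced coordinate when the digit at \<open>x\<close> is
  turned. It is random because the turn wraps around at \<open>b - 1\<close>.\<close>

definition jump :: "nat \<Rightarrow> (nat \<times> nat list \<Rightarrow> nat \<Rightarrow> nat) \<Rightarrow> nat \<times> nat \<Rightarrow> real" where
  "jump n \<omega> x = (real ((scrambled_digit n \<omega> x + 1) mod b) - real (scrambled_digit n \<omega> x)) / real b ^ Suc (depth_of d x)"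

abbreviation jumps :: "nat \<Rightarrow> (nat \<times> nat list \<Rightarrow> nat \<Rightarrow> nat) \<Rightarrow> (nat \<times> nat) list \<Rightarrow> (nat \<times> real) list" where
  "jumps n \<omega> xs \<equiv> map (\<lambda>x. (group_of d (fst x), jump n \<omega> x)) xs"

lemma jump_in:
  "jump n \<omega> x \<in> {1 / real b ^ Suc (depth_of d x), - real (b - 1) / real b ^ Suc (depth_of d x)}"
proof -
  have "scrambled_digit n \<omega> x < b" by simp
  then consider "scrambled_digit n \<omega> x + 1 < b" | "scrambled_digit n \<omega> x = b - 1" by linarith
  then show ?thesis
  proof cases
    case 2
    then have "(scrambled_digit n \<omega> x + 1) mod b = 0" using b0 by simp
    then show ?thesis using 2 by (simp add: jump_def)
  qed (simp add: jump_def)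
qed

text \<open>Turning one digit leaves the jumps at the other positions unchanged, so the same list of
  steps serves at every corner of the iterated difference.\<close>

lemma jump_turn:
  assumes "good \<omega>" "x \<in> positions" "y \<in> positions" "y \<noteq> x"
  shows "jump n (turn (key n x) \<omega>) y = jump n \<omega> y"
proof -
  have "key n y \<noteq> key n x" using key_eq_imp_eq[OF assms(3,2)] assms(4) by blast
  then have "scrambled_digit n (turn (key n x) \<omega>) y = scrambled_digit n \<omega> y"
    by (simp only: scrambled_digit_turn[OF assms(1,3)] if_False)
  then show ?thesis by (simp only: jump_def)
qed

lemma point_turn:
  assumes \<omega>: "good \<omega>" and x: "x \<in> positions"
  shows "point n (turn (key n x) \<omega>) =
    fun_upd (point n \<omega>) (group_of d (fst x)) (point n \<omega> (group_of d (fst x)) + jump n \<omega> x)"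
proof
  fix i
  let ?i = "group_of d (fst x)" and ?p = "depth_of d x"
  have i1: "?i \<in> {1..s}" by (rule group_of_in) (use x in auto)
  have other: "scrambled_digit n (turn (key n x) \<omega>) (pos i r) = scrambled_digit n \<omega> (pos i r)"
    if "i \<in> {1..s}" "i \<noteq> ?i \<or> r \<noteq> ?p" for i r
  proof -
    have "pos i r \<noteq> x"
      using interlaced_position_inj[OF d1, of i ?i r ?p] that i1 pos_group_depth[OF x] by auto
    then have "key n (pos i r) \<noteq> key n x"
      using key_eq_imp_eq[OF pos_in_positions[OF that(1)] x] by blast
    then show ?thesis
      by (simp only: scrambled_digit_turn[OF \<omega> pos_in_positions[OF that(1)]] if_False)
  qed
  show "point n (turn (key n x) \<omega>) i = (fun_upd (point n \<omega>) ?i (point n \<omega> ?i + jump n \<omega> x)) i"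
  proof (cases "i = ?i")
    case True
    have "digit_series b (\<lambda>r. scrambled_digit n (turn (key n x) \<omega>) (pos ?i r)) =
        digit_series b (\<lambda>r. scrambled_digit n \<omega> (pos ?i r)) +
        (real (scrambled_digit n (turn (key n x) \<omega>) (pos ?i ?p)) - real (scrambled_digit n \<omega> (pos ?i ?p))) / real b ^ Suc ?p"
      by (rule digit_series_update[OF b2]) (simp_all only: scrambled_digit_less other[OF i1] simp_thms)
    also have "pos ?i ?p = x" by (rule pos_group_depth[OF x])
    also have "scrambled_digit n (turn (key n x) \<omega>) x = (scrambled_digit n \<omega> x + 1) mod b"
      by (simp only: scrambled_digit_turn[OF \<omega> x] if_True refl)
    finally show ?thesis
      using i1 unfolding True point_def jump_def by simp
  next
    case False
    show ?thesis
    proof (cases "i \<in> {1..s}")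
      case True
      then show ?thesis using False other[OF True] by (simp add: point_def)
    next
      case out: False
      then have "point n \<omega>' i = undefined" for \<omega>'
        unfolding point_def restrict_apply by (simp only: if_False)
      then show ?thesis using False by (simp only: fun_upd_other not_False_eq_True)
    qed
  qed
qed

text \<open>For a fixed scrambling the jumps are mere numbers, since the turned positions are
  distinct. Every corner is the point of some scrambling and hence lies in the cube, which gives the
  membership in the shift domain.\<close>

lemma turn_differences_eq_iterated_difference:
  assumes u: "u \<subseteq> {1..s}" and "good \<omega>" "set xs \<subseteq> positions" "distinct xs"
    "(\<lambda>x. group_of d (fst x)) ` set xs \<subseteq> u"
  shows "restrict (point n \<omega>) u \<in> shift_domain u (jumps n \<omega> xs)"
    and "turn_differences (map (key n) xs) (\<lambda>\<omega>. g (restrict (point n \<omega>) u)) \<omega> =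
      iterated_difference (jumps n \<omega> xs) g (restrict (point n \<omega>) u)"
proof -
  have "restrict (point n \<omega>) u \<in> shift_domain u (jumps n \<omega> xs) \<and>
     turn_differences (map (key n) xs) (\<lambda>\<omega>. g (restrict (point n \<omega>) u)) \<omega> =
      iterated_difference (jumps n \<omega> xs) g (restrict (point n \<omega>) u)"
    using assms(2-)
  proof (induction xs arbitrary: \<omega>)
    case Nil
    have "point n \<omega> i \<in> {0..1}" if "i \<in> u" for i
      using PiE_mem[OF point_in_cube] u that by blast
    then have "\<forall>i\<in>u. point n \<omega> i \<in> {0..1}" by blast
    then have "restrict (point n \<omega>) u \<in> u \<rightarrow>\<^sub>E {0..1}"
      by (simp only: restrict_PiE_iff)
    then show ?case
      unfolding list.map shift_domain.simps turn_differences.simps iterated_difference.simps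
      by (rule conjI) (rule refl)
  next
    case (Cons x xs)
    let ?i = "group_of d (fst x)"
    have x: "x \<in> positions" and xs: "set xs \<subseteq> positions" "distinct xs" "x \<notin> set xs"
        "(\<lambda>x. group_of d (fst x)) ` set xs \<subseteq> u" and i: "?i \<in> u"
      using Cons.prems by simp_all
    have \<kappa>: "key n x \<in> keys" by (rule key_in_keys[OF x])
    have j: "jumps n (turn (key n x) \<omega>) xs = jumps n \<omega> xs"
    proof (rule map_cong[OF refl])
      fix y assume "y \<in> set xs"
      then have "y \<in> positions" "y \<noteq> x" using xs by auto
      from jump_turn[OF Cons.prems(1) x this]
      show "(group_of d (fst y), jump n (turn (key n x) \<omega>) y) = (group_of d (fst y), jump n \<omega> y)" by simp
    qed
    have p: "restrict (point n (turn (key n x) \<omega>)) u =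
        fun_upd (restrict (point n \<omega>) u) ?i (restrict (point n \<omega>) u ?i + jump n \<omega> x)"
      unfolding point_turn[OF Cons.prems(1) x] using i by (auto simp: fun_eq_iff)
    note IH1 = Cons.IH[OF Cons.prems(1) xs(1,2,4)]
    note IH2 = Cons.IH[OF good_turn[OF Cons.prems(1) \<kappa>] xs(1,2,4), unfolded j p]
    show ?case
      unfolding list.map turn_differences.simps iterated_difference.simps shift_domain.simps mem_Collect_eq
      using IH1 IH2 by (simp only: p[symmetric] simp_thms)
  qed
  then show "restrict (point n \<omega>) u \<in> shift_domain u (jumps n \<omega> xs)"
    and "turn_differences (map (key n) xs) (\<lambda>\<omega>. g (restrict (point n \<omega>) u)) \<omega> =
      iterated_difference (jumps n \<omega> xs) g (restrict (point n \<omega>) u)"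
    by blast+
qed

end

lemma integrable_cmod_square_continuous_on_cube:
  assumes "continuous_on (u \<rightarrow>\<^sub>E {0..1}) g"
  shows "integrable (cube u) (\<lambda>x. (cmod (g x))\<^sup>2)"
proof -
  obtain B where "\<And>x. x \<in> u \<rightarrow>\<^sub>E {0..1} \<Longrightarrow> cmod (g x) \<le> B"
    using bounded_continuous_on_cube[OF assms] by metis
  then have "bounded_measurable (cube u) g"
    by (intro bounded_measurableI[where B = B] borel_measurable_continuous_on_cube assms) simp
  then show ?thesis
    by (rule prob_space.integrable_cmod_square_bounded_measurable[OF prob_space_cube])
qed

lemma mixed_partial_le_smooth_norm:
  assumes "u \<subseteq> {1..s}" "u \<noteq> {}" "\<nu> \<in> u \<rightarrow>\<^sub>E {1..\<alpha>}"
  shows "(LINT x|cube u. (cmod (mixed_partial u \<nu> (marginal s u f) x))\<^sup>2) \<le> (smooth_norm s \<alpha> f)\<^sup>2"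
proof -
  let ?I = "\<lambda>u \<nu>. LINT x|cube u. (cmod (mixed_partial u \<nu> (marginal s u f) x))\<^sup>2"
  have nonneg: "0 \<le> ?I u \<nu>" for u \<nu>
    by (rule integral_nonneg_AE) simp
  have fin: "finite (u \<rightarrow>\<^sub>E {1..\<alpha>})"
    using assms(1) by (intro finite_PiE finite_subset[OF assms(1)]) auto
  have "?I u \<nu> \<le> (\<Sum>\<nu>\<in>u \<rightarrow>\<^sub>E {1..\<alpha>}. ?I u \<nu>)"
    by (rule member_le_sum[OF assms(3) nonneg fin])
  also have "\<dots> \<le> (\<Sum>u\<in>Pow {1..s} - {{}}. \<Sum>\<nu>\<in>u \<rightarrow>\<^sub>E {1..\<alpha>}. ?I u \<nu>)"
    by (rule member_le_sum[where f = "\<lambda>u. \<Sum>\<nu>\<in>u \<rightarrow>\<^sub>E {1..\<alpha>}. ?I u \<nu>"])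
       (use assms in \<open>auto intro!: sum_nonneg nonneg\<close>)
  also have "\<dots> \<le> (smooth_norm s \<alpha> f)\<^sup>2"
    unfolding smooth_norm_def by (subst real_sqrt_pow2) (auto intro!: add_nonneg_nonneg sum_nonneg nonneg)
  finally show ?thesis .
qed

section \<open>Walsh coefficients as integrals over the cube, and their mean square bounds\<close>

context interlaced_scrambling
begin

lemma AE_digit_point:
  "AE \<omega> in \<Omega>. \<forall>i\<in>{1..s}. \<forall>r. digit b (point n \<omega> i) (Suc r) = scrambled_digit n \<omega> (pos i r)"
proof -
  have "AE \<omega> in \<Omega>. \<forall>a0. \<exists>a>a0. scrambled_digit n \<omega> (j, a) \<noteq> b - 1" if "j \<in> {1..d * s}" for j
    using AE_scrambled_digit_not_max[OF that] by (simp only: AE_all_countable) blast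
  then have "AE \<omega> in \<Omega>. \<forall>j\<in>{1..d * s}. \<forall>a0. \<exists>a>a0. scrambled_digit n \<omega> (j, a) \<noteq> b - 1"
    by (subst AE_ball_countable) auto
  then show ?thesis
  proof (rule eventually_mono)
    fix \<omega> assume elim: "\<forall>j\<in>{1..d * s}. \<forall>a0. \<exists>a>a0. scrambled_digit n \<omega> (j, a) \<noteq> b - 1"
    show "\<forall>i\<in>{1..s}. \<forall>r. digit b (point n \<omega> i) (Suc r) = scrambled_digit n \<omega> (pos i r)"
    proof (intro ballI allI)
      fix i r assume i: "i \<in> {1..s}"
      have "fst (pos i 0) \<in> {1..d * s}"
        using pos_in_positions[OF i, of 0] by (simp only: mem_Times_iff)
      then obtain a where a: "a > r + 1" "scrambled_digit n \<omega> (fst (pos i 0), a) \<noteq> b - 1"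
        using elim by blast
      have "(a - 1) * d \<ge> a - 1" using d1 by simp
      then have "(a - 1) * d > r" using a(1) by linarith
      moreover have "pos i ((a - 1) * d) = (fst (pos i 0), a)"
        using a(1) d1 by (simp add: interlaced_position_def)
      ultimately have "\<exists>p>r. scrambled_digit n \<omega> (pos i p) \<noteq> b - 1"
        using a(2) by metis
      from digit_digit_series[where e = "\<lambda>p. scrambled_digit n \<omega> (pos i p)", OF b2 scrambled_digit_less this]
      show "digit b (point n \<omega> i) (Suc r) = scrambled_digit n \<omega> (pos i r)"
        using i by (simp only: point_def restrict_apply if_True)
    qed
  qed
qed

text \<open>The Walsh function as a function of the real point. This form lets Fubini's theorem on
  the cube act on the coefficients.\<close>

definition walsh_cube :: "(nat \<times> nat) set \<Rightarrow> (nat \<times> nat \<Rightarrow> nat) \<Rightarrow> (nat \<Rightarrow> real) \<Rightarrow> complex" where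
  "walsh_cube A k x = walsh b A k (\<lambda>p. digit b (x (group_of d (fst p))) (Suc (depth_of d p)))"

lemma AE_W_eq_walsh_cube:
  assumes "A \<subseteq> positions"
  shows "AE \<omega> in \<Omega>. W A n k \<omega> = walsh_cube A k (point n \<omega>)"
proof (rule eventually_mono[OF AE_digit_point[of n]])
  fix \<omega> assume elim: "\<forall>i\<in>{1..s}. \<forall>r. digit b (point n \<omega> i) (Suc r) = scrambled_digit n \<omega> (pos i r)"
  show "W A n k \<omega> = walsh_cube A k (point n \<omega>)"
    unfolding W_def walsh_cube_def
  proof (rule walsh_cong)
    fix p assume "p \<in> A"
    then have p: "p \<in> positions" using assms by blast
    have "group_of d (fst p) \<in> {1..s}" by (rule group_of_in) (use p in auto)
    then show "scrambled_digit n \<omega> p = digit b (point n \<omega> (group_of d (fst p))) (Suc (depth_of d p))"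
      using elim pos_group_depth[OF p] by metis
  qed
qed

lemma measurable_walsh_cube:
  assumes "finite A" "A \<subseteq> positions"
  shows "walsh_cube A k \<in> borel_measurable (cube {1..s})"
proof -
  have "(\<lambda>x. root_of_unity b ^ (k p * digit b (x (group_of d (fst p))) (Suc (depth_of d p)))) \<in> borel_measurable (cube {1..s})"
    if "p \<in> A" for p
  proof -
    have "group_of d (fst p) \<in> {1..s}" by (rule group_of_in) (use that assms in auto)
    from measurable_cube_coordinate[OF this]
    have x: "(\<lambda>x. x (group_of d (fst p))) \<in> borel_measurable (cube {1..s})" .
    have "(\<lambda>x. digit b x a) \<in> measurable borel (count_space UNIV)" for a
      unfolding digit_def by measurable
    from measurable_compose[OF x this]
    show ?thesis by (rule measurable_compose) simp
  qed
  then show ?thesis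
    unfolding walsh_cube_def[abs_def] walsh_def by (rule borel_measurable_prod)
qed

lemma walsh_cube_merge:
  assumes "\<And>p. p \<in> A \<Longrightarrow> k p \<noteq> 0 \<Longrightarrow> group_of d (fst p) \<in> u"
  shows "walsh_cube A k (merge u v (x, y)) = walsh_cube A k x"
  unfolding walsh_cube_def walsh_def
proof (rule prod.cong[OF refl])
  fix p assume "p \<in> A"
  then show "root_of_unity b ^ (k p * digit b (merge u v (x, y) (group_of d (fst p))) (Suc (depth_of d p))) =
      root_of_unity b ^ (k p * digit b (x (group_of d (fst p))) (Suc (depth_of d p)))"
    using assms[of p] by (cases "k p = 0") (simp_all add: merge_def)
qed

lemma expectation_point_mult_W:
  assumes A: "finite A" "A \<subseteq> positions" and f: "f \<in> borel_measurable (cube {1..s})"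
  shows "Om.expectation (\<lambda>\<omega>. f (point n \<omega>) * cnj (W A n k \<omega>)) = (LINT x|cube {1..s}. f x * cnj (walsh_cube A k x))"
proof -
  have cm: "(\<lambda>x. cnj (g x)) \<in> borel_measurable M" if "g \<in> borel_measurable M" for g :: "'c \<Rightarrow> complex" and M
    using that measurable_compose[OF that, of cnj borel]
      borel_measurable_continuous_onI[OF continuous_on_cnj[OF continuous_on_id]] by blast
  have m: "(\<lambda>x. f x * cnj (walsh_cube A k x)) \<in> borel_measurable (cube {1..s})"
    by (intro borel_measurable_times f cm measurable_walsh_cube A)
  have W: "W A n k \<in> borel_measurable \<Omega>"
    using bounded_measurable_W[OF A(2)] by (simp add: bounded_measurable_def)
  have "Om.expectation (\<lambda>\<omega>. f (point n \<omega>) * cnj (W A n k \<omega>)) =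
      Om.expectation (\<lambda>\<omega>. f (point n \<omega>) * cnj (walsh_cube A k (point n \<omega>)))"
  proof (rule integral_cong_AE)
    show "(\<lambda>\<omega>. f (point n \<omega>) * cnj (W A n k \<omega>)) \<in> borel_measurable \<Omega>"
      by (intro borel_measurable_times measurable_compose[OF measurable_point f] cm W)
    show "(\<lambda>\<omega>. f (point n \<omega>) * cnj (walsh_cube A k (point n \<omega>))) \<in> borel_measurable \<Omega>"
      by (rule measurable_compose[OF measurable_point m])
    show "AE \<omega> in \<Omega>. f (point n \<omega>) * cnj (W A n k \<omega>) = f (point n \<omega>) * cnj (walsh_cube A k (point n \<omega>))"
      using AE_W_eq_walsh_cube[OF A(2), of n k] by eventually_elim simp
  qed
  also have "\<dots> = (LINT x|distr \<Omega> (cube {1..s}) (point n). f x * cnj (walsh_cube A k x))"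
    by (rule integral_distr[OF measurable_point m, symmetric])
  finally show ?thesis unfolding distr_point(2) .
qed

text \<open>A Walsh function whose frequency vanishes outside the groups in \<open>u\<close> depends
  only on the coordinates in \<open>u\<close>, so the remaining variables of \<open>f\<close>
  integrate out. This is how the marginals of the Sobolev norm enter.\<close>

lemma expectation_marginal_mult_W:
  assumes u: "u \<subseteq> {1..s}" and f: "continuous_on ({1..s} \<rightarrow>\<^sub>E {0..1}) f"
    and A: "finite A" "A \<subseteq> positions" and k: "\<And>p. p \<in> A \<Longrightarrow> k p \<noteq> 0 \<Longrightarrow> group_of d (fst p) \<in> u"
  shows "Om.expectation (\<lambda>\<omega>. f (point n \<omega>) * cnj (W A n k \<omega>)) =
    Om.expectation (\<lambda>\<omega>. marginal s u f (restrict (point n \<omega>) u) * cnj (W A n k \<omega>))"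
proof -
  let ?v = "{1..s} - u"
  let ?g = "\<lambda>x. marginal s u f (restrict x u)"
  have uv: "u \<union> ?v = {1..s}" "u \<inter> ?v = {}" using u by auto
  have fin: "finite u" "finite ?v" using u finite_subset by auto
  interpret Cv: prob_space "cube ?v" by (rule prob_space_cube)
  have cg: "continuous_on (u \<rightarrow>\<^sub>E {0..1}) (marginal s u f)"
    by (rule continuous_on_marginal[OF u f])
  have mr: "(\<lambda>x. restrict x u) \<in> measurable (cube {1..s}) (cube u)"
    unfolding cube_def by (rule measurable_restrict_subset[OF u])
  have mf: "f \<in> borel_measurable (cube {1..s})"
    by (rule borel_measurable_continuous_on_cube[OF f])
  have mg: "?g \<in> borel_measurable (cube {1..s})"
    by (rule measurable_compose[OF mr borel_measurable_continuous_on_cube[OF cg]])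
  have fold: "(LINT x|cube {1..s}. h x * cnj (walsh_cube A k x)) =
      (LINT x|cube u. (LINT y|cube ?v. h (merge u ?v (x, y))) * cnj (walsh_cube A k x))"
    if h: "bounded_measurable (cube {1..s}) h" for h
  proof -
    have "bounded_measurable (cube {1..s}) (walsh_cube A k)"
      by (rule bounded_measurableI[where B = 1, OF measurable_walsh_cube[OF A]]) (simp add: walsh_cube_def)
    then have "integrable (cube {1..s}) (\<lambda>x. h x * cnj (walsh_cube A k x))"
      by (intro prob_space.integrable_bounded_measurable[OF prob_space_cube] bounded_measurable_intros h)
    then have "(LINT x|cube {1..s}. h x * cnj (walsh_cube A k x)) =
        (LINT x|cube u. (LINT y|cube ?v. h (merge u ?v (x, y)) * cnj (walsh_cube A k (merge u ?v (x, y)))))"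
      using cube.product_integral_fold[OF uv(2) fin, of "\<lambda>x. h x * cnj (walsh_cube A k x)"]
      unfolding uv(1) cube_def[symmetric] by simp
    moreover have "walsh_cube A k (merge u ?v (x, y)) = walsh_cube A k x" for x y
      by (rule walsh_cube_merge) (rule k)
    ultimately show ?thesis by simp
  qed
  have bm: "bounded_measurable (cube {1..s}) f"
  proof -
    obtain B where "\<And>x. x \<in> {1..s} \<rightarrow>\<^sub>E {0..1} \<Longrightarrow> cmod (f x) \<le> B"
      using bounded_continuous_on_cube[OF f] by metis
    then show ?thesis by (intro bounded_measurableI[where B = B] mf) (simp only: space_cube)
  qed
  have bmg: "bounded_measurable (cube {1..s}) ?g"
  proof -
    obtain B where B: "\<And>x. x \<in> u \<rightarrow>\<^sub>E {0..1} \<Longrightarrow> cmod (marginal s u f x) \<le> B"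
      using bounded_continuous_on_cube[OF cg] by metis
    show ?thesis
    proof (rule bounded_measurableI[where B = B, OF mg])
      fix x assume "x \<in> space (cube {1..s})"
      from measurable_space[OF mr this] show "cmod (?g x) \<le> B" unfolding space_cube by (rule B)
    qed
  qed
  have "Om.expectation (\<lambda>\<omega>. f (point n \<omega>) * cnj (W A n k \<omega>)) =
      (LINT x|cube u. (LINT y|cube ?v. f (merge u ?v (x, y))) * cnj (walsh_cube A k x))"
    unfolding expectation_point_mult_W[OF A mf] by (rule fold[OF bm])
  also have "\<dots> = (LINT x|cube u. (LINT y|cube ?v. ?g (merge u ?v (x, y))) * cnj (walsh_cube A k x))"
  proof (rule Bochner_Integration.integral_cong[OF refl])
    fix x assume "x \<in> space (cube u)"
    then have "restrict (merge u ?v (x, y)) u = x" for y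
      by (auto simp: merge_def fun_eq_iff PiE_iff extensional_def)
    then have "(LINT y|cube ?v. ?g (merge u ?v (x, y))) = (LINT y|cube ?v. marginal s u f x)"
      by (simp only:)
    also have "\<dots> = marginal s u f x"
      unfolding lebesgue_integral_const Cv.prob_space by (rule scaleR_one)
    finally show "(LINT y|cube ?v. f (merge u ?v (x, y))) * cnj (walsh_cube A k x) =
        (LINT y|cube ?v. ?g (merge u ?v (x, y))) * cnj (walsh_cube A k x)"
      by (simp only: marginal_def)
  qed
  also have "\<dots> = Om.expectation (\<lambda>\<omega>. ?g (point n \<omega>) * cnj (W A n k \<omega>))"
    unfolding expectation_point_mult_W[OF A mg] by (rule fold[OF bmg, symmetric])
  finally show ?thesis .
qed

text \<open>All lists of steps that the random jumps can produce. Summing over them replaces a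
  difference with random steps by differences with fixed steps, at the price of a factor
  \<open>2 ^ length xs\<close>.\<close>

fun jump_lists :: "(nat \<times> nat) list \<Rightarrow> (nat \<times> real) list set" where
  "jump_lists [] = {[]}"
| "jump_lists (x # xs) = (\<lambda>(h, hs). (group_of d (fst x), h) # hs) `
     ({1 / real b ^ Suc (depth_of d x), - real (b - 1) / real b ^ Suc (depth_of d x)} \<times> jump_lists xs)"

lemma finite_jump_lists: "finite (jump_lists xs)"
  by (induction xs) auto

lemma card_jump_lists: "card (jump_lists xs) \<le> 2 ^ length xs"
proof (induction xs)
  case (Cons x xs)
  let ?H = "{1 / real b ^ Suc (depth_of d x), - real (b - 1) / real b ^ Suc (depth_of d x)}"
  have "card (jump_lists (x # xs)) \<le> card (?H \<times> jump_lists xs)"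
    unfolding jump_lists.simps by (rule card_image_le) (simp add: finite_jump_lists)
  also have "\<dots> = card ?H * card (jump_lists xs)" by (rule card_cartesian_product)
  also have "\<dots> \<le> 2 * 2 ^ length xs"
    by (intro mult_mono Cons card_insert_le_m1) auto
  finally show ?case by simp
qed simp

lemma jumps_in_jump_lists: "jumps n \<omega> xs \<in> jump_lists xs"
proof (induction xs)
  case (Cons x xs)
  then show ?case
    using jump_in[of n \<omega> x] unfolding jump_lists.simps list.map by (intro image_eqI[where x = "(jump n \<omega> x, jumps n \<omega> xs)"]) auto
qed simp

lemma jump_lists_bounds:
  "hs \<in> jump_lists xs \<Longrightarrow> map fst hs = map (\<lambda>x. group_of d (fst x)) xs \<and>
     \<bar>\<Prod>(i, h)\<leftarrow>hs. h\<bar> \<le> 1 / real b ^ (\<Sum>x\<leftarrow>xs. depth_of d x)"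
proof (induction xs arbitrary: hs)
  case (Cons x xs)
  then obtain h hs' where h: "hs = (group_of d (fst x), h) # hs'" "hs' \<in> jump_lists xs"
    "h \<in> {1 / real b ^ Suc (depth_of d x), - real (b - 1) / real b ^ Suc (depth_of d x)}" by auto
  \<comment> \<open>Both values are at most \<open>b\<close> times the weight of the digit; this
    \<open>b\<close> cancels the \<open>Suc\<close> in the exponent.\<close>
  have "\<bar>h\<bar> \<le> real b / real b ^ Suc (depth_of d x)"
  proof -
    have B: "real b ^ Suc (depth_of d x) > 0" using b0 by simp
    have c: "real (b - 1) \<le> real b" "1 \<le> real b" using b0 by auto
    from h(3) consider "\<bar>h\<bar> = 1 / real b ^ Suc (depth_of d x)" | "\<bar>h\<bar> = real (b - 1) / real b ^ Suc (depth_of d x)"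
      using B by (auto simp only: abs_divide abs_minus_cancel abs_of_nat abs_one abs_of_pos insert_iff empty_iff)
    then show ?thesis
      using B c by cases (simp_all only: divide_right_mono less_imp_le)
  qed
  also have "\<dots> = 1 / real b ^ depth_of d x" using b0 by simp
  finally have "\<bar>h\<bar> * \<bar>\<Prod>(i, h)\<leftarrow>hs'. h\<bar> \<le> (1 / real b ^ depth_of d x) * (1 / real b ^ (\<Sum>x\<leftarrow>xs. depth_of d x))"
    using Cons.IH[OF h(2)] by (intro mult_mono) auto
  then show ?case
    using Cons.IH[OF h(2)] h(1) by (simp add: abs_mult power_add)
qed simp

lemma distr_restrict_point:
  assumes "u \<subseteq> {1..s}"
  shows "(\<lambda>\<omega>. restrict (point n \<omega>) u) \<in> measurable \<Omega> (cube u)"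
    and "distr \<Omega> (cube u) (\<lambda>\<omega>. restrict (point n \<omega>) u) = cube u"
proof -
  have mr: "(\<lambda>x. restrict x u) \<in> measurable (cube {1..s}) (cube u)"
    unfolding cube_def by (rule measurable_restrict_subset[OF assms])
  show "(\<lambda>\<omega>. restrict (point n \<omega>) u) \<in> measurable \<Omega> (cube u)"
    by (rule measurable_compose[OF measurable_point mr])
  have "distr \<Omega> (cube u) ((\<lambda>x. restrict x u) \<circ> point n) =
      distr (distr \<Omega> (cube {1..s}) (point n)) (cube u) (\<lambda>x. restrict x u)"
    by (rule distr_distr[OF mr measurable_point, symmetric])
  also have "\<dots> = distr (cube {1..s}) (cube u) (\<lambda>x. restrict x u)"
    unfolding distr_point(2) ..
  also have "\<dots> = cube u"
    unfolding cube_def using assms finite_subset[OF assms] by (intro cube.distr_PiM_restrict_finite) auto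
  finally show "distr \<Omega> (cube u) (\<lambda>\<omega>. restrict (point n \<omega>) u) = cube u"
    by (simp only: comp_def)
qed

text \<open>The square at the actual step list is at most the sum of the squares over all possible
  lists. For each fixed list the restricted point is uniform on the cube, so the bound by
  derivatives applies.\<close>

lemma expectation_turn_differences_le:
  assumes u: "u \<subseteq> {1..s}" and g: "cube_smooth u g"
    and xs: "set xs \<subseteq> positions" "distinct xs" "(\<lambda>x. group_of d (fst x)) ` set xs \<subseteq> u"
  shows "Om.expectation (\<lambda>\<omega>. (cmod (turn_differences (map (key n) xs) (\<lambda>\<omega>. g (restrict (point n \<omega>) u)) \<omega>))\<^sup>2)
    \<le> 2 ^ length xs * (1 / real b ^ (\<Sum>x\<leftarrow>xs. depth_of d x))\<^sup>2 *
       (LINT x|cube u. (cmod (foldr partial (rev (map (\<lambda>x. group_of d (fst x)) xs)) g x))\<^sup>2)"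
    (is "Om.expectation (\<lambda>\<omega>. (cmod (?T \<omega>))\<^sup>2) \<le> 2 ^ length xs * ?P\<^sup>2 * ?I")
proof -
  have finu: "finite u" using u by (rule finite_subset) simp
  let ?X = "\<lambda>\<omega>. restrict (point n \<omega>) u"
  let ?is = "rev (map (\<lambda>x. group_of d (fst x)) xs)"
  define F where "F hs x = indicator (shift_domain u hs) x *\<^sub>R iterated_difference hs g x" for hs x
  have fst_hs: "fst ` set hs \<subseteq> u" if "hs \<in> jump_lists xs" for hs
  proof -
    have "fst ` set hs = set (map fst hs)" by simp
    also have "\<dots> = (\<lambda>x. group_of d (fst x)) ` set xs"
      using jump_lists_bounds[OF that] by simp
    finally show ?thesis using xs(3) by simp
  qed
  have mF: "F hs \<in> borel_measurable (cube u)" if "hs \<in> jump_lists xs" for hs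
    unfolding F_def[abs_def]
    by (rule measurable_compose[OF measurable_cube_ident
          measurable_iterated_difference[OF finu fst_hs[OF that] cube_smooth_continuous[OF g]]])
  have mZ: "bounded_measurable \<Omega> (\<lambda>\<omega>. g (?X \<omega>))"
  proof -
    obtain B where B: "\<And>x. x \<in> u \<rightarrow>\<^sub>E {0..1} \<Longrightarrow> cmod (g x) \<le> B"
      using bounded_continuous_on_cube[OF cube_smooth_continuous[OF g]] by metis
    show ?thesis
    proof (rule bounded_measurableI[where B = B])
      show "(\<lambda>\<omega>. g (?X \<omega>)) \<in> borel_measurable \<Omega>"
        by (rule measurable_compose[OF distr_restrict_point(1)[OF u]
              borel_measurable_continuous_on_cube[OF cube_smooth_continuous[OF g]]])
      fix \<omega> assume "\<omega> \<in> space \<Omega>"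
      from measurable_space[OF distr_restrict_point(1)[OF u] this]
      show "cmod (g (?X \<omega>)) \<le> B" unfolding space_cube by (rule B)
    qed
  qed
  have keys: "set (map (key n) xs) \<subseteq> keys"
    unfolding set_map by (intro image_subsetI key_in_keys) (use xs(1) in blast)
  have "\<forall>js\<in>lists u. continuous_on (u \<rightarrow>\<^sub>E {0..1}) (foldr partial js g)"
    using g by (simp add: cube_smooth_def)
  moreover have "?is \<in> lists u" using xs(3) by auto
  ultimately have cont: "continuous_on (u \<rightarrow>\<^sub>E {0..1}) (foldr partial ?is g)" by blast
  have I: "(\<integral>\<^sup>+x. ennreal ((cmod (foldr partial ?is g x))\<^sup>2) \<partial>cube u) = ennreal ?I"
    by (intro nn_integral_eq_integral integrable_cmod_square_continuous_on_cube cont) simp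
  have I0: "?I \<ge> 0" by (rule integral_nonneg_AE) simp
  have "ennreal (Om.expectation (\<lambda>\<omega>. (cmod (?T \<omega>))\<^sup>2)) = (\<integral>\<^sup>+\<omega>. ennreal ((cmod (?T \<omega>))\<^sup>2) \<partial>\<Omega>)"
    by (intro nn_integral_eq_integral[symmetric] Om.integrable_cmod_square_bounded_measurable
        bounded_measurable_turn_differences mZ keys) simp
  also have "\<dots> \<le> (\<integral>\<^sup>+\<omega>. (\<Sum>hs\<in>jump_lists xs. ennreal ((cmod (F hs (?X \<omega>)))\<^sup>2)) \<partial>\<Omega>)"
  proof (rule nn_integral_mono_AE)
    show "AE \<omega> in \<Omega>. ennreal ((cmod (?T \<omega>))\<^sup>2) \<le> (\<Sum>hs\<in>jump_lists xs. ennreal ((cmod (F hs (?X \<omega>)))\<^sup>2))"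
      using AE_good
    proof eventually_elim
      case (elim \<omega>)
      note td = turn_differences_eq_iterated_difference[OF u elim xs, of n]
      have "?T \<omega> = F (jumps n \<omega> xs) (?X \<omega>)"
        unfolding td(2) F_def using td(1) by simp
      then show ?case
        using member_le_sum[OF jumps_in_jump_lists[of n \<omega> xs], of "\<lambda>hs. ennreal ((cmod (F hs (?X \<omega>)))\<^sup>2)"]
          finite_jump_lists by simp
    qed
  qed
  also have "\<dots> = (\<Sum>hs\<in>jump_lists xs. \<integral>\<^sup>+\<omega>. ennreal ((cmod (F hs (?X \<omega>)))\<^sup>2) \<partial>\<Omega>)"
    using mF measurable_compose[OF distr_restrict_point(1)[OF u] mF]
    by (intro nn_integral_sum) measurable
  also have "\<dots> \<le> (\<Sum>hs\<in>jump_lists xs. ennreal (?P\<^sup>2 * ?I))"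
  proof (rule sum_mono)
    fix hs assume hs: "hs \<in> jump_lists xs"
    have mF2: "(\<lambda>x. ennreal ((cmod (F hs x))\<^sup>2)) \<in> borel_measurable (cube u)"
      using mF[OF hs] by measurable
    have "(\<integral>\<^sup>+\<omega>. ennreal ((cmod (F hs (?X \<omega>)))\<^sup>2) \<partial>\<Omega>) =
        (\<integral>\<^sup>+x. ennreal ((cmod (F hs x))\<^sup>2) \<partial>distr \<Omega> (cube u) ?X)"
      by (rule nn_integral_distr[OF distr_restrict_point(1)[OF u], symmetric]) (use mF2 in simp)
    also have "\<dots> = (\<integral>\<^sup>+x. ennreal ((cmod (F hs x))\<^sup>2) \<partial>cube u)"
      unfolding distr_restrict_point(2)[OF u] ..
    also have "\<dots> \<le> ennreal ((\<Prod>(i, h)\<leftarrow>hs. h)\<^sup>2) *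
        (\<integral>\<^sup>+x. ennreal ((cmod (foldr partial (rev (map fst hs)) g x))\<^sup>2) \<partial>cube u)"
      unfolding F_def by (rule nn_integral_iterated_difference_le[OF finu fst_hs[OF hs] g])
    also have "rev (map fst hs) = ?is" using jump_lists_bounds[OF hs] by simp
    also have "ennreal ((\<Prod>(i, h)\<leftarrow>hs. h)\<^sup>2) * (\<integral>\<^sup>+x. ennreal ((cmod (foldr partial ?is g x))\<^sup>2) \<partial>cube u) \<le> ennreal (?P\<^sup>2) * ennreal ?I"
    proof -
      have "\<bar>\<Prod>(i, h)\<leftarrow>hs. h\<bar>\<^sup>2 \<le> ?P\<^sup>2"
        using jump_lists_bounds[OF hs] by (intro power_mono) auto
      then show ?thesis unfolding I by (intro mult_right_mono ennreal_leI) auto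
    qed
    also have "\<dots> = ennreal (?P\<^sup>2 * ?I)" using I0 by (simp add: ennreal_mult)
    finally show "(\<integral>\<^sup>+\<omega>. ennreal ((cmod (F hs (?X \<omega>)))\<^sup>2) \<partial>\<Omega>) \<le> ennreal (?P\<^sup>2 * ?I)" .
  qed
  also have "\<dots> = ennreal (real (card (jump_lists xs)) * (?P\<^sup>2 * ?I))"
    using I0 by (simp add: ennreal_mult ennreal_of_nat_eq_real_of_nat)
  finally have "Om.expectation (\<lambda>\<omega>. (cmod (?T \<omega>))\<^sup>2) \<le> real (card (jump_lists xs)) * (?P\<^sup>2 * ?I)"
    using I0 by (subst (asm) ennreal_le_iff) auto
  also have "\<dots> \<le> 2 ^ length xs * (?P\<^sup>2 * ?I)"
  proof (rule mult_right_mono)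
    have "real (card (jump_lists xs)) \<le> real (2 ^ length xs)"
      using card_jump_lists by (simp only: of_nat_le_iff)
    then show "real (card (jump_lists xs)) \<le> 2 ^ length xs" by simp
  qed (use I0 in simp)
  finally show ?thesis by (simp only: mult.assoc)
qed

end

text \<open>For at most \<open>q\<close> differences: \<open>2 ^ q\<close> counts the step lists,
  the power of \<open>b\<close> pays for depths falling short of \<open>d\<close> times the level by
  at most \<open>d\<close> each, and the power of \<open>root_gap b\<close> divides out the factors
  produced by the turns.\<close>

definition decay_const :: "nat \<Rightarrow> nat \<Rightarrow> nat \<Rightarrow> real" where
  "decay_const b d q = 2 ^ q * real b ^ (2 * (d * q)) / root_gap b ^ (2 * q)"

lemma decay_const_pos: "b > 0 \<Longrightarrow> decay_const b d q > 0"
  unfolding decay_const_def using root_gap_pos[of b] by simp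

lemma card_group_le:
  assumes "d \<ge> 1" "J \<subseteq> {1..}"
  shows "card {j \<in> J. group_of d j = i} \<le> d"
proof -
  have "{j \<in> J. group_of d j = i} \<subseteq> {(i - 1) * d + 1..(i - 1) * d + d}"
  proof
    fix j assume "j \<in> {j \<in> J. group_of d j = i}"
    then have j: "j \<ge> 1" "(j - 1) div d = i - 1" using assms by (auto simp: group_of_def)
    have "j - 1 = (i - 1) * d + (j - 1) mod d" using j(2) div_mult_mod_eq[of "j - 1" d] by simp
    moreover have "(j - 1) mod d < d" using assms(1) by simp
    ultimately show "j \<in> {(i - 1) * d + 1..(i - 1) * d + d}" using j(1) by auto
  qed
  from card_mono[OF _ this] show ?thesis by simp
qed

text \<open>In each group of \<open>d\<close> interlaced coordinates the at most \<open>\<alpha>\<close> deepest levels already carry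
  a fraction \<open>min \<alpha> d / d\<close> of the total level; these are the digits that are differenced.\<close>

lemma exists_dominating_positions:
  fixes l :: "nat \<Rightarrow> nat"
  assumes d: "d \<ge> 1" and \<alpha>: "\<alpha> \<ge> 1" and J: "finite J" "J \<subseteq> {1..}"
  obtains ws \<nu> where "set ws \<subseteq> J" "distinct ws" "\<nu> \<in> group_of d ` J \<rightarrow>\<^sub>E {1..\<alpha>}"
    "map (group_of d) ws = concat (map (\<lambda>i. replicate (\<nu> i) i) (sorted_list_of_set (group_of d ` J)))"
    "min \<alpha> d * (\<Sum>j\<in>J. l j) \<le> d * (\<Sum>j\<leftarrow>ws. l j)"
proof -
  let ?u = "group_of d ` J" and ?J = "\<lambda>i. {j \<in> J. group_of d j = i}"
  have "\<forall>i\<in>?u. \<exists>w\<subseteq>?J i. card w \<in> {1..\<alpha>} \<and> min \<alpha> d * (\<Sum>j\<in>?J i. l j) \<le> d * (\<Sum>j\<in>w. l j)"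
  proof
    fix i assume "i \<in> ?u"
    then have "?J i \<noteq> {}" by blast
    moreover have "finite (?J i)" using J by simp
    ultimately show "\<exists>w\<subseteq>?J i. card w \<in> {1..\<alpha>} \<and> min \<alpha> d * (\<Sum>j\<in>?J i. l j) \<le> d * (\<Sum>j\<in>w. l j)"
      by (intro exists_dominating_subset card_group_le d J \<alpha>)
  qed
  from bchoice[OF this] obtain w where wall:
    "\<forall>i\<in>?u. w i \<subseteq> ?J i \<and> card (w i) \<in> {1..\<alpha>} \<and> min \<alpha> d * (\<Sum>j\<in>?J i. l j) \<le> d * (\<Sum>j\<in>w i. l j)" ..
  have w: "w i \<subseteq> ?J i" "card (w i) \<in> {1..\<alpha>}" "min \<alpha> d * (\<Sum>j\<in>?J i. l j) \<le> d * (\<Sum>j\<in>w i. l j)"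
    if "i \<in> ?u" for i
    by (rule conjunct1[OF bspec[OF wall that]])
      (rule conjunct1[OF conjunct2[OF bspec[OF wall that]]], rule conjunct2[OF conjunct2[OF bspec[OF wall that]]])
  have finw: "finite (w i)" if "i \<in> ?u" for i
    using w(1)[OF that] J(1) by (auto intro: finite_subset)
  define us where "us = sorted_list_of_set ?u"
  have us: "set us = ?u" "distinct us" using J(1) by (simp_all add: us_def)
  \<comment> \<open>The indices are listed group by group in increasing order, so that the
    derivatives appear in the order in which \<open>mixed_partial\<close> takes them.\<close>
  define ws where "ws = concat (map (\<lambda>i. sorted_list_of_set (w i)) us)"
  define \<nu> where "\<nu> = (\<lambda>i\<in>?u. card (w i))"
  have set_ws: "set ws = (\<Union>i\<in>?u. w i)"
    unfolding ws_def using us(1) finw by simp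
  have disj: "w i \<inter> w i' = {}" if "i \<in> ?u" "i' \<in> ?u" "i \<noteq> i'" for i i'
    using w(1)[OF that(1)] w(1)[OF that(2)] that(3) by blast
  have "distinct ws \<and> map (group_of d) ws = concat (map (\<lambda>i. replicate (\<nu> i) i) us)
      \<and> (\<Sum>j\<leftarrow>ws. l j) = (\<Sum>i\<leftarrow>us. \<Sum>j\<in>w i. l j)"
  proof -
    have "distinct (concat (map (\<lambda>i. sorted_list_of_set (w i)) is)) \<and>
        map (group_of d) (concat (map (\<lambda>i. sorted_list_of_set (w i)) is)) = concat (map (\<lambda>i. replicate (\<nu> i) i) is) \<and>
        (\<Sum>j\<leftarrow>concat (map (\<lambda>i. sorted_list_of_set (w i)) is). l j) = (\<Sum>i\<leftarrow>is. \<Sum>j\<in>w i. l j)"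
      if "set is \<subseteq> ?u" "distinct is" for "is"
      using that
    proof (induction "is")
      case (Cons i js)
      have i: "i \<in> ?u" and js: "set js \<subseteq> ?u" "distinct js" "i \<notin> set js" using Cons.prems by auto
      have "w i \<inter> w i' = {}" if "i' \<in> set js" for i'
        using disj[OF i, of i'] that js by blast
      then have d1: "w i \<inter> (\<Union>i'\<in>set js. w i') = {}" by blast
      have d2: "set (concat (map (\<lambda>i. sorted_list_of_set (w i)) js)) = (\<Union>i'\<in>set js. w i')"
        using js finw by (auto simp: subset_iff)
      have "map (group_of d) (sorted_list_of_set (w i)) = map (\<lambda>_. i) (sorted_list_of_set (w i))"
        using w(1)[OF i] finw[OF i] by (intro map_cong refl) auto
      also have "\<dots> = replicate (\<nu> i) i"
        using i by (simp add: map_replicate_const \<nu>_def)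
      finally have m: "map (group_of d) (sorted_list_of_set (w i)) = replicate (\<nu> i) i" .
      have s: "(\<Sum>j\<leftarrow>sorted_list_of_set (w i). l j) = (\<Sum>j\<in>w i. l j)"
        using finw[OF i] by (simp add: sum_list_distinct_conv_sum_set)
      show ?case
        using Cons.IH[OF js(1,2)] d1 d2 m s finw[OF i] by simp
    qed simp
    from this[of us] us show ?thesis unfolding ws_def by simp
  qed
  moreover have "set ws \<subseteq> J" unfolding set_ws using w(1) by blast
  moreover have "\<nu> \<in> ?u \<rightarrow>\<^sub>E {1..\<alpha>}" using w(2) by (simp add: \<nu>_def)
  moreover have "min \<alpha> d * (\<Sum>j\<in>J. l j) \<le> d * (\<Sum>i\<leftarrow>us. \<Sum>j\<in>w i. l j)"
  proof -
    have "(\<Sum>j\<in>J. l j) = (\<Sum>i\<in>?u. \<Sum>j\<in>?J i. l j)"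
      by (rule sum.image_gen[OF J(1)])
    then have "min \<alpha> d * (\<Sum>j\<in>J. l j) = (\<Sum>i\<in>?u. min \<alpha> d * (\<Sum>j\<in>?J i. l j))"
      by (simp only: sum_distrib_left)
    also have "\<dots> \<le> (\<Sum>i\<in>?u. d * (\<Sum>j\<in>w i. l j))"
      by (rule sum_mono) (rule w(3))
    also have "\<dots> = d * (\<Sum>i\<leftarrow>us. \<Sum>j\<in>w i. l j)"
      using us by (simp add: sum_list_distinct_conv_sum_set sum_distrib_left)
    finally show ?thesis .
  qed
  ultimately show ?thesis using that[of ws \<nu>] unfolding us_def by simp
qed

context interlaced_scrambling
begin

text \<open>The differenced digits depend on the levels alone, so one function \<open>?T\<close>
  serves all frequencies in \<open>K\<close>, and Bessel's inequality bounds their squared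
  coefficients together.\<close>

lemma walsh_coefficient_decay:
  fixes l :: "nat \<Rightarrow> nat" and L :: nat
  assumes f: "cube_smooth {1..s} f" and \<alpha>: "\<alpha> \<ge> 1" and nz: "j0 \<in> {1..d * s}" "l j0 \<noteq> 0"
  defines "A \<equiv> {1..d * s} \<times> {1..L}"
  defines "K \<equiv> {k \<in> A \<rightarrow>\<^sub>E {..<b}. \<forall>j\<in>{1..d * s}. level L k j = l j}"
  shows "(\<Sum>k\<in>K. (cmod (Om.expectation (\<lambda>\<omega>. f (point n \<omega>) * cnj (W A n k \<omega>))))\<^sup>2)
    \<le> decay_const b d (d * s) * (smooth_norm s \<alpha> f)\<^sup>2 / real b ^ (2 * min \<alpha> d * (\<Sum>j=1..d * s. l j))"
    (is "?lhs \<le> ?rhs")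
proof (cases "K = {}")
  case True
  have "0 \<le> ?rhs" using decay_const_pos[OF b0] by (intro divide_nonneg_nonneg mult_nonneg_nonneg) (auto simp: less_imp_le)
  then show ?thesis using True by simp
next
  case False
  let ?q = "d * s"
  have A: "finite A" "A \<subseteq> positions" by (auto simp: A_def)
  have finK: "finite K"
    unfolding K_def using A by (intro finite_subset[OF _ finite_PiE[of A "\<lambda>_. {..<b}"]]) auto
  \<comment> \<open>A witness shows that the prescribed levels do not exceed \<open>L\<close>, so
    the top positions lie in the grid.\<close>
  obtain k1 where k1: "k1 \<in> K" using False by blast
  have lL: "l j \<le> L" if "j \<in> {1..?q}" for j
    using k1 that level_le[of L k1 j] by (auto simp: K_def)
  define J where "J = {j \<in> {1..?q}. l j \<noteq> 0}"
  have J: "finite J" "J \<subseteq> {1..}" by (auto simp: J_def)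
  define u where "u = group_of d ` J"
  have u: "u \<subseteq> {1..s}" using group_of_in by (auto simp: u_def J_def)
  have une: "u \<noteq> {}" using nz by (auto simp: u_def J_def)
  obtain ws \<nu> where ws: "set ws \<subseteq> J" "distinct ws" and \<nu>: "\<nu> \<in> u \<rightarrow>\<^sub>E {1..\<alpha>}"
    and groups: "map (group_of d) ws = concat (map (\<lambda>i. replicate (\<nu> i) i) (sorted_list_of_set u))"
    and dom: "min \<alpha> d * (\<Sum>j\<in>J. l j) \<le> d * (\<Sum>j\<leftarrow>ws. l j)"
    unfolding u_def by (rule exists_dominating_positions[OF d1 \<alpha> J, of l])
  \<comment> \<open>Reversed to match the reversal in the bound for iterated differences.\<close>
  define xs where "xs = rev (map (\<lambda>j. (j, l j)) ws)"
  have set_xs: "set xs = (\<lambda>j. (j, l j)) ` set ws" by (simp add: xs_def)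
  have xsA: "set xs \<subseteq> A"
  proof
    fix x assume "x \<in> set xs"
    then obtain j where "j \<in> J" "x = (j, l j)" using set_xs ws(1) by blast
    then show "x \<in> A" using lL[of j] by (auto simp: J_def A_def)
  qed
  have xs_pos: "set xs \<subseteq> positions" using xsA A(2) by blast
  have xs_dist: "distinct xs" using ws(2) by (auto simp: xs_def distinct_map inj_on_def)
  have xs_u: "(\<lambda>x. group_of d (fst x)) ` set xs \<subseteq> u"
    unfolding set_xs u_def using ws(1) by auto
  have len: "length xs \<le> ?q"
  proof -
    have "length xs = card (set ws)" using ws(2) by (simp add: xs_def distinct_card)
    also have "\<dots> \<le> card {1..?q}" using ws(1) by (intro card_mono) (auto simp: J_def)
    finally show ?thesis by simp
  qed
  let ?g = "marginal s u f"
  have g: "cube_smooth u ?g" by (rule cube_smooth_marginal[OF u f])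
  let ?Z = "\<lambda>\<omega>. ?g (restrict (point n \<omega>) u)"
  let ?T = "turn_differences (map (key n) xs) ?Z"
  have bZ: "bounded_measurable \<Omega> ?Z"
  proof -
    obtain B where B: "\<And>x. x \<in> u \<rightarrow>\<^sub>E {0..1} \<Longrightarrow> cmod (?g x) \<le> B"
      using bounded_continuous_on_cube[OF cube_smooth_continuous[OF g]] by metis
    show ?thesis
    proof (rule bounded_measurableI[where B = B])
      show "?Z \<in> borel_measurable \<Omega>"
        by (rule measurable_compose[OF distr_restrict_point(1)[OF u]
              borel_measurable_continuous_on_cube[OF cube_smooth_continuous[OF g]]])
      fix \<omega> assume "\<omega> \<in> space \<Omega>"
      from measurable_space[OF distr_restrict_point(1)[OF u] this]
      show "cmod (?Z \<omega>) \<le> B" unfolding space_cube by (rule B)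
    qed
  qed
  have keys: "set (map (key n) xs) \<subseteq> keys"
    unfolding set_map by (intro image_subsetI key_in_keys) (use xs_pos in blast)
  have bT: "bounded_measurable \<Omega> ?T" by (rule bounded_measurable_turn_differences[OF bZ keys])
  let ?\<gamma> = "root_gap b"
  have \<gamma>: "0 < ?\<gamma>" "?\<gamma> \<le> 1" by (rule root_gap_pos[OF b0], rule root_gap_le_1)
  have coef: "(cmod (Om.expectation (\<lambda>\<omega>. f (point n \<omega>) * cnj (W A n k \<omega>))))\<^sup>2 \<le>
      (cmod (Om.expectation (\<lambda>\<omega>. ?T \<omega> * cnj (W A n k \<omega>))))\<^sup>2 / ?\<gamma> ^ (2 * ?q)" if k: "k \<in> K" for k
  proof -
    have kA: "k \<in> A \<rightarrow>\<^sub>E {..<b}" and kl: "\<And>j. j \<in> {1..?q} \<Longrightarrow> level L k j = l j"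
      using k by (auto simp: K_def)
    have supp: "group_of d (fst p) \<in> u" if p: "p \<in> A" "k p \<noteq> 0" for p
    proof -
      obtain j a where ja: "p = (j, a)" by force
      have "j \<in> {1..?q}" "a \<in> {1..L}" using p(1) ja by (auto simp: A_def)
      moreover have "a \<le> level L k j" using level_ge[OF \<open>a \<in> {1..L}\<close>, of k j] p(2) ja by simp
      ultimately have "j \<in> J" using kl[of j] by (auto simp: J_def)
      then show ?thesis using ja by (auto simp: u_def)
    qed
    have eq: "Om.expectation (\<lambda>\<omega>. f (point n \<omega>) * cnj (W A n k \<omega>)) = Om.expectation (\<lambda>\<omega>. ?Z \<omega> * cnj (W A n k \<omega>))"
      by (rule expectation_marginal_mult_W[OF u cube_smooth_continuous[OF f] A supp])
    \<comment> \<open>Only top digits are differenced, and there the frequency is nonzero by the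
      definition of the level.\<close>
    have gap: "?\<gamma> \<le> cmod (root_of_unity b ^ k x - 1)" if "x \<in> set xs" for x
    proof -
      have "x \<in> (\<lambda>j. (j, l j)) ` set ws" using that unfolding set_xs .
      then obtain j where j: "x = (j, l j)" "j \<in> set ws" by (rule imageE)
      have jJ: "j \<in> {1..?q}" "l j \<noteq> 0" using subsetD[OF ws(1) j(2)] unfolding J_def mem_Collect_eq by simp_all
      have "k (j, level L k j) \<noteq> 0"
        by (rule level_nonzero) (unfold kl[OF jJ(1)], rule jJ(2))
      then have "k x \<noteq> 0" unfolding kl[OF jJ(1)] j(1) .
      moreover have "k x < b" using PiE_mem[OF kA subsetD[OF xsA that]] unfolding lessThan_iff .
      ultimately show ?thesis by (intro root_gap_le) (simp_all only: neq0_conv)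
    qed
    have "?\<gamma> ^ length xs \<le> cmod (\<Prod>x\<leftarrow>xs. root_of_unity b ^ k x - 1)"
      using gap
    proof (induction xs)
      case (Cons x xs)
      have "?\<gamma> \<le> cmod (root_of_unity b ^ k x - 1)" by (rule Cons.prems) simp
      moreover have "?\<gamma> ^ length xs \<le> cmod (\<Prod>x\<leftarrow>xs. root_of_unity b ^ k x - 1)"
        by (rule Cons.IH) (rule Cons.prems, simp)
      ultimately have "?\<gamma> * ?\<gamma> ^ length xs \<le> cmod (root_of_unity b ^ k x - 1) * cmod (\<Prod>x\<leftarrow>xs. root_of_unity b ^ k x - 1)"
        by (rule mult_mono) (use \<gamma> in simp_all)
      then show ?case by (simp add: norm_mult)
    qed simp
    moreover have "?\<gamma> ^ ?q \<le> ?\<gamma> ^ length xs"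
      using \<gamma> len by (intro power_decreasing) auto
    ultimately have "?\<gamma> ^ ?q * cmod (Om.expectation (\<lambda>\<omega>. ?Z \<omega> * cnj (W A n k \<omega>))) \<le>
        cmod (\<Prod>x\<leftarrow>xs. root_of_unity b ^ k x - 1) * cmod (Om.expectation (\<lambda>\<omega>. ?Z \<omega> * cnj (W A n k \<omega>)))"
      by (intro mult_right_mono) auto
    also have "\<dots> = cmod (Om.expectation (\<lambda>\<omega>. ?T \<omega> * cnj (W A n k \<omega>)))"
      unfolding expectation_turn_differences[OF A bZ xsA] by (simp only: norm_mult)
    finally have "(?\<gamma> ^ ?q * cmod (Om.expectation (\<lambda>\<omega>. ?Z \<omega> * cnj (W A n k \<omega>))))\<^sup>2 \<le>
        (cmod (Om.expectation (\<lambda>\<omega>. ?T \<omega> * cnj (W A n k \<omega>))))\<^sup>2"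
      using \<gamma> by (intro power_mono) auto
    then show ?thesis
      unfolding eq using \<gamma>
      by (simp add: pos_le_divide_eq power_mult_distrib power_mult[symmetric] mult.commute)
  qed
  define P where "P = (\<Sum>x\<leftarrow>xs. depth_of d x)"
  define I where "I = (LINT x|cube u. (cmod (mixed_partial u \<nu> ?g x))\<^sup>2)"
  have I: "0 \<le> I" "I \<le> (smooth_norm s \<alpha> f)\<^sup>2"
    unfolding I_def by (rule integral_nonneg_AE, simp) (rule mixed_partial_le_smooth_norm[OF u une \<nu>])
  have "rev (map (\<lambda>x. group_of d (fst x)) xs) = map (group_of d) ws"
    by (simp add: xs_def rev_map comp_def)
  then have mp: "foldr partial (rev (map (\<lambda>x. group_of d (fst x)) xs)) ?g = mixed_partial u \<nu> ?g"
    unfolding mixed_partial_eq_foldr groups[symmetric] by (simp only:)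
  \<comment> \<open>A digit at level \<open>l\<close> has depth at least \<open>d * (l - 1)\<close>,
    so each differenced digit loses at most \<open>d\<close>, and there are at most
    \<open>d * s\<close> of them.\<close>
  have PP: "min \<alpha> d * (\<Sum>j=1..?q. l j) \<le> P + d * ?q"
  proof -
    have e: "(\<Sum>j=1..?q. l j) = (\<Sum>j\<in>J. l j)"
      by (rule sum.mono_neutral_right) (auto simp: J_def)
    have "d * (\<Sum>j\<leftarrow>ws. l j) \<le> P + d * length ws"
    proof -
      have "P = (\<Sum>j\<leftarrow>ws. depth_of d (j, l j))"
        by (simp add: P_def xs_def rev_map[symmetric] comp_def sum_list_rev flip: rev_map)
      moreover have "d * (\<Sum>j\<leftarrow>js. l j) \<le> (\<Sum>j\<leftarrow>js. depth_of d (j, l j)) + d * length js" for js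
      proof (induction js)
        case (Cons j js)
        have "d * l j \<le> depth_of d (j, l j) + d"
          by (cases "l j") (simp_all add: depth_of_def mult.commute)
        then show ?case using Cons by (simp add: algebra_simps)
      qed simp
      ultimately show ?thesis by simp
    qed
    moreover have "d * length ws \<le> d * ?q" using len by (simp add: xs_def)
    ultimately show ?thesis unfolding e using dom by linarith
  qed
  have P2: "(1 / real b ^ P)\<^sup>2 \<le> real b ^ (2 * (d * ?q)) / real b ^ (2 * min \<alpha> d * (\<Sum>j=1..?q. l j))"
  proof -
    have "2 * min \<alpha> d * (\<Sum>j=1..?q. l j) = 2 * (min \<alpha> d * (\<Sum>j=1..?q. l j))" by (simp only: mult.assoc)
    also have "\<dots> \<le> 2 * P + 2 * (d * ?q)" using PP by linarith
    finally have "real b ^ (2 * min \<alpha> d * (\<Sum>j=1..?q. l j)) \<le> real b ^ (2 * P + 2 * (d * ?q))"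
      using b0 by (intro power_increasing) auto
    then have "real b ^ (2 * min \<alpha> d * (\<Sum>j=1..?q. l j)) \<le> (real b ^ P)\<^sup>2 * real b ^ (2 * (d * ?q))"
      by (simp only: power_add power_mult[symmetric] mult.commute[of 2 P])
    then show ?thesis
      using b0 by (simp add: power_divide divide_simps mult.commute)
  qed
  have "?lhs \<le> (\<Sum>k\<in>K. (cmod (Om.expectation (\<lambda>\<omega>. ?T \<omega> * cnj (W A n k \<omega>))))\<^sup>2 / ?\<gamma> ^ (2 * ?q))"
    by (rule sum_mono) (rule coef)
  also have "\<dots> = (\<Sum>k\<in>K. (cmod (Om.expectation (\<lambda>\<omega>. ?T \<omega> * cnj (W A n k \<omega>))))\<^sup>2) / ?\<gamma> ^ (2 * ?q)"
    by (simp only: sum_divide_distrib)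
  also have "\<dots> \<le> Om.expectation (\<lambda>\<omega>. (cmod (?T \<omega>))\<^sup>2) / ?\<gamma> ^ (2 * ?q)"
  proof (rule divide_right_mono)
    show "(\<Sum>k\<in>K. (cmod (Om.expectation (\<lambda>\<omega>. ?T \<omega> * cnj (W A n k \<omega>))))\<^sup>2) \<le> Om.expectation (\<lambda>\<omega>. (cmod (?T \<omega>))\<^sup>2)"
      by (rule Om.bessel_inequality[OF finK bounded_measurable_W[OF A(2)] _ bT])
         (unfold K_def mem_Collect_eq, elim conjE, rule expectation_W_orthonormal[OF A])
  qed (use \<gamma> in simp)
  also have "\<dots> \<le> (2 ^ length xs * (1 / real b ^ P)\<^sup>2 * I) / ?\<gamma> ^ (2 * ?q)"
  proof (rule divide_right_mono)
    show "Om.expectation (\<lambda>\<omega>. (cmod (?T \<omega>))\<^sup>2) \<le> 2 ^ length xs * (1 / real b ^ P)\<^sup>2 * I"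
      using expectation_turn_differences_le[OF u g xs_pos xs_dist xs_u, of n] unfolding mp P_def I_def .
  qed (use \<gamma> in simp)
  also have "\<dots> \<le> (2 ^ ?q * (real b ^ (2 * (d * ?q)) / real b ^ (2 * min \<alpha> d * (\<Sum>j=1..?q. l j))) * (smooth_norm s \<alpha> f)\<^sup>2) / ?\<gamma> ^ (2 * ?q)"
    using I P2 len \<gamma> by (intro divide_right_mono mult_mono power_increasing) auto
  also have "\<dots> = ?rhs"
    by (simp add: decay_const_def)
  finally show ?thesis .
qed

end

section \<open>Summation over level vectors\<close>

lemma card_sum_eq_le:
  assumes "q \<ge> 1"
  shows "card {l \<in> {1..q} \<rightarrow>\<^sub>E {0..L :: nat}. (\<Sum>j=1..q. l j) = n} \<le> (n + 1) ^ (q - 1)"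
proof -
  let ?S = "{l \<in> {1..q} \<rightarrow>\<^sub>E {0..L}. (\<Sum>j=1..q. l j) = n}"
  obtain r where q: "q = Suc r" using assms by (cases q) auto
  have last: "l q = n - (\<Sum>j=1..r. l j)" "(\<Sum>j=1..r. l j) \<le> n" if "l \<in> ?S" for l
    using that by (auto simp: q)
  \<comment> \<open>The last entry is determined by the others and the total.\<close>
  have "inj_on (\<lambda>l. restrict l {1..r}) ?S"
  proof (rule inj_onI)
    fix l l' assume l: "l \<in> ?S" "l' \<in> ?S" and eq: "restrict l {1..r} = restrict l' {1..r}"
    have e: "l j = l' j" if "j \<in> {1..r}" for j
      using fun_cong[OF eq, of j] that by (simp only: restrict_apply if_True)
    then have "(\<Sum>j=1..r. l j) = (\<Sum>j=1..r. l' j)" by (intro sum.cong) auto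
    then have "l q = l' q" using last[OF l(1)] last[OF l(2)] by simp
    then have "l j = l' j" if "j \<in> {1..q}" for j
      using e that q by (cases "j = q") auto
    moreover have "l \<in> {1..q} \<rightarrow>\<^sub>E {0..L}" "l' \<in> {1..q} \<rightarrow>\<^sub>E {0..L}" using l by blast+
    ultimately show "l = l'" by (intro PiE_ext)
  qed
  moreover have "(\<lambda>l. restrict l {1..r}) ` ?S \<subseteq> {1..r} \<rightarrow>\<^sub>E {0..n}"
  proof (rule image_subsetI)
    fix l assume l: "l \<in> ?S"
    have "l j \<le> n" if "j \<in> {1..r}" for j
      using member_le_sum[OF that, of l] last(2)[OF l] by simp
    then have "\<forall>j\<in>{1..r}. l j \<in> {0..n}" by simp
    then show "restrict l {1..r} \<in> {1..r} \<rightarrow>\<^sub>E {0..n}" by (simp only: restrict_PiE_iff)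
  qed
  ultimately have "card ?S \<le> card ({1..r} \<rightarrow>\<^sub>E {0..n})"
    by (rule card_inj_on_le) (auto intro!: finite_PiE)
  also have "\<dots> = (n + 1) ^ r" by (simp add: card_PiE)
  finally show ?thesis by (simp add: q)
qed

lemma summable_power_times_half: "summable (\<lambda>i. (1 + real i) ^ r * (1 / 2) ^ i)"
proof -
  have lim0: "(\<lambda>i. 1 / (1 + real i)) \<longlonglongrightarrow> 0"
    using LIMSEQ_inverse_real_of_nat by (simp add: inverse_eq_divide add.commute)
  have "(\<lambda>i. (1 + 1 / (1 + real i)) ^ r) \<longlonglongrightarrow> (1 + 0) ^ r"
    by (intro tendsto_intros lim0)
  then have "(\<lambda>i. (1 + 1 / (1 + real i)) ^ r) \<longlonglongrightarrow> 1" by simp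
  \<comment> \<open>Any bound below 2 for the ratio of the polynomial parts would do; with the
    factor 1/2, the bound 3/2 gives the ratio 3/4.\<close>
  from order_tendstoD(2)[OF this, of "3 / 2"] obtain N where
    N: "\<And>i. i \<ge> N \<Longrightarrow> (1 + 1 / (1 + real i)) ^ r < 3 / 2"
    by (auto simp: eventually_sequentially)
  show ?thesis
  proof (rule summable_ratio_test[where c = "3 / 4" and N = N])
    fix i assume i: "i \<ge> N"
    have "1 + real (Suc i) = (1 + 1 / (1 + real i)) * (1 + real i)" by (simp add: field_simps)
    then have "(1 + real (Suc i)) ^ r = (1 + 1 / (1 + real i)) ^ r * (1 + real i) ^ r"
      by (simp only: power_mult_distrib)
    also have "\<dots> \<le> 3 / 2 * (1 + real i) ^ r"
      using N[OF i] by (intro mult_right_mono) auto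
    finally show "norm ((1 + real (Suc i)) ^ r * (1 / 2) ^ Suc i) \<le> 3 / 4 * norm ((1 + real i) ^ r * (1 / 2) ^ i)"
      by (simp add: abs_mult power_abs field_simps)
  qed simp
qed

text \<open>What remains of the sum over level sums beyond \<open>M\<close> after the factors
  \<open>(M + 2) ^ (q - 1)\<close> and \<open>1 / b ^ (2 * r * M)\<close> are split off and the
  remaining geometric decay is weakened to powers of 1/2.\<close>

definition level_const :: "nat \<Rightarrow> real" where
  "level_const q = (\<Sum>i. (1 + real i) ^ (q - 1) * (1 / 2) ^ i)"

lemma level_const_pos: "level_const q > 0"
  unfolding level_const_def by (intro suminf_pos summable_power_times_half) simp

text \<open>The vectors are grouped by their sum \<open>n\<close>; polynomially many share a given
  sum, while the terms decay geometrically. The bound is free of \<open>L\<close>, which later tends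
  to infinity.\<close>

lemma sum_levels_le:
  assumes q: "q \<ge> 1" and b: "b \<ge> 2" and r: "r \<ge> 1"
  shows "(\<Sum>l | l \<in> {1..q} \<rightarrow>\<^sub>E {0..L} \<and> M < (\<Sum>j=1..q. l j). 1 / real b ^ (2 * r * (\<Sum>j=1..q. l j)))
    \<le> level_const q * real (M + 2) ^ (q - 1) / real b ^ (2 * r * M)"
proof -
  let ?P = "{l. l \<in> {1..q} \<rightarrow>\<^sub>E {0..L} \<and> M < (\<Sum>j=1..q. l j)}"
  have fin: "finite ({1..q} \<rightarrow>\<^sub>E {0..L})" by (intro finite_PiE) auto
  have finP: "finite ?P" by (rule finite_subset[OF _ fin]) blast
  \<comment> \<open>A crude upper bound for every level sum in play; it only makes the range of
    \<open>n\<close> finite and disappears into the series.\<close>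
  define H where "H = (\<Sum>l\<in>{1..q} \<rightarrow>\<^sub>E {0..L}. \<Sum>j=1..q. l j)"
  define N where "N = M + 1 + H"
  have "(\<lambda>l. \<Sum>j=1..q. l j) ` ?P \<subseteq> {M + 1..<N}"
  proof (rule image_subsetI)
    fix l assume "l \<in> ?P"
    then have l: "l \<in> {1..q} \<rightarrow>\<^sub>E {0..L}" "M < (\<Sum>j=1..q. l j)" by blast+
    have "(\<Sum>j=1..q. l j) \<le> H"
      unfolding H_def by (rule member_le_sum[OF l(1)]) (use fin in auto)
    then show "(\<Sum>j=1..q. l j) \<in> {M + 1..<N}" using l(2) by (simp add: N_def)
  qed
  then have "(\<Sum>l\<in>?P. 1 / real b ^ (2 * r * (\<Sum>j=1..q. l j))) =
      (\<Sum>n\<in>{M + 1..<N}. \<Sum>l | l \<in> ?P \<and> (\<Sum>j=1..q. l j) = n. 1 / real b ^ (2 * r * (\<Sum>j=1..q. l j)))"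
    using finP by (intro sum.group[symmetric]) auto
  also have "\<dots> \<le> (\<Sum>n\<in>{M + 1..<N}. real (n + 1) ^ (q - 1) / real b ^ (2 * r * n))"
  proof (rule sum_mono)
    fix n
    let ?Q = "{l. l \<in> ?P \<and> (\<Sum>j=1..q. l j) = n}"
    have "(\<Sum>l\<in>?Q. 1 / real b ^ (2 * r * (\<Sum>j=1..q. l j))) = (\<Sum>l\<in>?Q. 1 / real b ^ (2 * r * n))"
      by (rule sum.cong) auto
    also have "\<dots> = real (card ?Q) / real b ^ (2 * r * n)" by simp
    also have "\<dots> \<le> real (n + 1) ^ (q - 1) / real b ^ (2 * r * n)"
    proof (rule divide_right_mono)
      have "card ?Q \<le> card {l \<in> {1..q} \<rightarrow>\<^sub>E {0..L}. (\<Sum>j=1..q. l j) = n}"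
        using fin by (intro card_mono) auto
      also have "\<dots> \<le> (n + 1) ^ (q - 1)" by (rule card_sum_eq_le[OF q])
      finally have "real (card ?Q) \<le> real ((n + 1) ^ (q - 1))" by (simp only: of_nat_le_iff)
      then show "real (card ?Q) \<le> real (n + 1) ^ (q - 1)" by (simp only: of_nat_power)
    qed simp
    finally show "(\<Sum>l\<in>?Q. 1 / real b ^ (2 * r * (\<Sum>j=1..q. l j))) \<le> real (n + 1) ^ (q - 1) / real b ^ (2 * r * n)" .
  qed
  also have "\<dots> = (\<Sum>i<H. real (M + 2 + i) ^ (q - 1) / real b ^ (2 * r * (M + 1 + i)))"
    unfolding N_def
    by (rule sum.reindex_bij_witness[where i = "\<lambda>i. M + 1 + i" and j = "\<lambda>n. n - (M + 1)"]) auto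
  also have "\<dots> \<le> (\<Sum>i<H. real (M + 2) ^ (q - 1) / real b ^ (2 * r * M) * ((1 + real i) ^ (q - 1) * (1 / 2) ^ i))"
  proof (rule sum_mono)
    fix i
    \<comment> \<open>This inequality separates \<open>M\<close> from the summation index.\<close>
    have "real (M + 2 + i) \<le> real (M + 2) * (1 + real i)" by (simp add: algebra_simps)
    then have 1: "real (M + 2 + i) ^ (q - 1) \<le> real (M + 2) ^ (q - 1) * (1 + real i) ^ (q - 1)"
      unfolding power_mult_distrib[symmetric] by (intro power_mono) auto
    have "(2 :: real) ^ i \<le> real b ^ i" using b by (intro power_mono) auto
    also have "\<dots> \<le> real b ^ (2 * r * (1 + i))"
    proof (rule power_increasing)
      have "1 * i \<le> 2 * r * (1 + i)" using r by (intro mult_le_mono) auto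
      then show "i \<le> 2 * r * (1 + i)" by simp
    qed (use b in simp)
    finally have "real b ^ (2 * r * M) * 2 ^ i \<le> real b ^ (2 * r * M) * real b ^ (2 * r * (1 + i))"
      by (intro mult_left_mono) auto
    then have 2: "real b ^ (2 * r * M) * 2 ^ i \<le> real b ^ (2 * r * (M + 1 + i))"
      by (simp only: power_add[symmetric] distrib_left[symmetric] add.assoc)
    have "real (M + 2 + i) ^ (q - 1) / real b ^ (2 * r * (M + 1 + i)) \<le>
        real (M + 2) ^ (q - 1) * (1 + real i) ^ (q - 1) / (real b ^ (2 * r * M) * 2 ^ i)"
      using 1 2 b by (intro frac_le) auto
    then show "real (M + 2 + i) ^ (q - 1) / real b ^ (2 * r * (M + 1 + i)) \<le>
        real (M + 2) ^ (q - 1) / real b ^ (2 * r * M) * ((1 + real i) ^ (q - 1) * (1 / 2) ^ i)"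
      by (simp add: power_divide)
  qed
  also have "\<dots> = real (M + 2) ^ (q - 1) / real b ^ (2 * r * M) * (\<Sum>i<H. (1 + real i) ^ (q - 1) * (1 / 2) ^ i)"
    by (simp only: sum_distrib_left)
  also have "\<dots> \<le> real (M + 2) ^ (q - 1) / real b ^ (2 * r * M) * level_const q"
    unfolding level_const_def
    by (intro mult_left_mono sum_le_suminf summable_power_times_half) auto
  finally show ?thesis by (simp add: mult.commute)
qed

section \<open>The variance for smooth integrands\<close>

lemma tendsto_coordinatewise:
  fixes l :: "'i \<Rightarrow> 'a :: topological_space"
  assumes "\<And>i. ((\<lambda>c. f c i) \<longlongrightarrow> l i) F"
  shows "(f \<longlongrightarrow> l) F"
proof -
  have "limitin (product_topology (\<lambda>_. euclidean) UNIV) f l F"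
    unfolding limitin_componentwise using assms by (simp add: limitin_canonical_iff)
  then show ?thesis by (simp add: euclidean_product_topology limitin_canonical_iff)
qed

lemma cmod_add_square_le: "(cmod (x + y))\<^sup>2 \<le> 2 * (cmod x)\<^sup>2 + 2 * (cmod y)\<^sup>2"
proof -
  have "(cmod (x + y))\<^sup>2 \<le> (cmod x + cmod y)\<^sup>2"
    by (intro power_mono norm_triangle_ineq) simp
  also have "\<dots> \<le> 2 * (cmod x)\<^sup>2 + 2 * (cmod y)\<^sup>2"
    using sum_squares_bound[of "cmod x" "cmod y"] by (simp add: power2_sum)
  finally show ?thesis .
qed

lemma cmod_mean_square_le:
  assumes N: "N > 0"
  shows "(cmod ((\<Sum>n<N. x n) / of_nat N))\<^sup>2 \<le> (\<Sum>n<N. (cmod (x n))\<^sup>2) / real N"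
proof -
  have "(cmod (\<Sum>n<N. x n))\<^sup>2 \<le> (\<Sum>n<N. cmod (x n))\<^sup>2"
    by (intro power_mono norm_sum) simp
  also have "\<dots> \<le> real N * (\<Sum>n<N. (cmod (x n))\<^sup>2)"
    using sum_squared_le_sum_of_squares[of "\<lambda>n. cmod (x n)" "{..<N}"] by (simp add: mult.commute)
  finally show ?thesis
    using N by (simp add: norm_divide power_divide power2_eq_square divide_simps mult.commute)
qed

context prob_space
begin

lemma integrable_if_cmod_square_integrable:
  fixes X :: "'a \<Rightarrow> complex"
  assumes [measurable]: "X \<in> borel_measurable M" and i: "integrable M (\<lambda>w. (cmod (X w))\<^sup>2)"
  shows "integrable M X"
proof -
  have "integrable M (\<lambda>w. cmod (X w))"
    by (rule square_integrable_imp_integrable[OF _ i]) measurable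
  then show ?thesis unfolding integrable_norm_iff[OF assms(1)] .
qed

lemma integrable_cmod_square_diff:
  fixes X Y :: "'a \<Rightarrow> complex"
  assumes X: "X \<in> borel_measurable M" "integrable M (\<lambda>w. (cmod (X w))\<^sup>2)"
    and Y: "Y \<in> borel_measurable M" "integrable M (\<lambda>w. (cmod (Y w))\<^sup>2)"
  shows "integrable M (\<lambda>w. (cmod (X w - Y w))\<^sup>2)"
proof (rule Bochner_Integration.integrable_bound)
  show "integrable M (\<lambda>w. 2 * (cmod (X w))\<^sup>2 + 2 * (cmod (Y w))\<^sup>2)"
    using X Y by simp
  show "AE w in M. norm ((cmod (X w - Y w))\<^sup>2) \<le> norm (2 * (cmod (X w))\<^sup>2 + 2 * (cmod (Y w))\<^sup>2)"
  proof (rule AE_I2)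
    fix w
    show "norm ((cmod (X w - Y w))\<^sup>2) \<le> norm (2 * (cmod (X w))\<^sup>2 + 2 * (cmod (Y w))\<^sup>2)"
      using cmod_add_square_le[of "X w" "- Y w"] by simp
  qed
qed (use X Y in measurable)

text \<open>The mean minimises the mean square deviation. A more convenient centre, such as the
  coefficient at frequency 0 or the mean of an approximant, may therefore replace it.\<close>

lemma complex_variance_le:
  fixes X :: "'a \<Rightarrow> complex"
  assumes X: "X \<in> borel_measurable M" "integrable M (\<lambda>w. (cmod (X w))\<^sup>2)"
  shows "complex_variance M X \<le> expectation (\<lambda>w. (cmod (X w - a))\<^sup>2)"
proof -
  define \<mu> where "\<mu> = expectation X"
  have iX: "integrable M X" by (rule integrable_if_cmod_square_integrable[OF X])
  have i2: "integrable M (\<lambda>w. (cmod (X w - \<mu>))\<^sup>2)"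
    by (rule integrable_cmod_square_diff[OF X]) auto
  have iR: "integrable M (\<lambda>w. (X w - \<mu>) * cnj (\<mu> - a))" using iX by simp
  have eq: "(cmod (X w - a))\<^sup>2 = (cmod (X w - \<mu>))\<^sup>2 + ((cmod (\<mu> - a))\<^sup>2 + 2 * Re ((X w - \<mu>) * cnj (\<mu> - a)))" for w
    by (simp add: cmod_power2) (simp add: power2_eq_square algebra_simps)
  have "expectation (\<lambda>w. Re ((X w - \<mu>) * cnj (\<mu> - a))) = Re (expectation (\<lambda>w. (X w - \<mu>) * cnj (\<mu> - a)))"
    by (rule integral_Re[OF iR])
  also have "\<dots> = 0"
    using iX by (simp add: \<mu>_def prob_space)
  finally have "expectation (\<lambda>w. (cmod (X w - a))\<^sup>2) = expectation (\<lambda>w. (cmod (X w - \<mu>))\<^sup>2) + (cmod (\<mu> - a))\<^sup>2"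
    unfolding eq using i2 integrable_Re[OF iR] by (simp add: prob_space del: complex_mult_cnj times_complex.sel)
  then show ?thesis unfolding complex_variance_def \<mu>_def by simp
qed

end

section \<open>Truncation to finitely many digits\<close>

context net_scrambling
begin

lemma pos_in_grid:
  assumes "i \<in> {1..s}" "p < d * L"
  shows "pos i p \<in> grid L"
proof -
  have "p div d < L" using assms(2) by (simp add: less_mult_imp_div_less mult.commute)
  then show ?thesis
    using pos_in_positions[OF assms(1), of p] by (auto simp: interlaced_position_def)
qed

text \<open>Keeping \<open>d * L\<close> interlaced digits amounts to keeping \<open>L\<close>
  digits of each source coordinate, so the value depends only on the digits in
  \<open>grid L\<close>.\<close>

definition truncated_point :: "nat \<Rightarrow> nat \<Rightarrow> (nat \<times> nat list \<Rightarrow> nat \<Rightarrow> nat) \<Rightarrow> nat \<Rightarrow> real" where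
  "truncated_point L n \<omega> = (\<lambda>i\<in>{1..s}. \<Sum>p<d * L. real (scrambled_digit n \<omega> (pos i p)) / real b ^ Suc p)"

lemma truncated_point_in_cube: "truncated_point L n \<omega> \<in> {1..s} \<rightarrow>\<^sub>E {0..1}"
proof -
  have *: "(\<Sum>p<Q. real (scrambled_digit n \<omega> (pos i p)) / real b ^ Suc p) \<in> {0..1}" for i Q
  proof -
    have "(\<Sum>p<Q. real (scrambled_digit n \<omega> (pos i p)) / real b ^ Suc p) \<le> digit_series b (\<lambda>p. scrambled_digit n \<omega> (pos i p))"
      unfolding digit_series_def by (intro sum_le_suminf summable_digits b2) auto
    also have "\<dots> \<le> 1" by (intro digit_series_le_1 b2) simp
    finally show ?thesis by (simp add: sum_nonneg)
  qed
  show ?thesis unfolding truncated_point_def restrict_PiE_iff by (intro ballI *)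
qed

lemma truncated_point_tendsto: "(\<lambda>L. truncated_point L n \<omega>) \<longlonglongrightarrow> point n \<omega>"
proof (rule tendsto_coordinatewise)
  fix i
  show "(\<lambda>L. truncated_point L n \<omega> i) \<longlonglongrightarrow> point n \<omega> i"
  proof (cases "i \<in> {1..s}")
    case True
    have "(\<lambda>Q. \<Sum>p<Q. real (scrambled_digit n \<omega> (pos i p)) / real b ^ Suc p) \<longlonglongrightarrow> digit_series b (\<lambda>p. scrambled_digit n \<omega> (pos i p))"
      unfolding digit_series_def by (intro summable_LIMSEQ summable_digits b2) auto
    moreover have "filterlim (\<lambda>L. d * L) sequentially sequentially"
      using dim by (intro filterlim_subseq strict_monoI) auto
    ultimately show ?thesis
      unfolding truncated_point_def point_def restrict_apply'[OF True]
      by (rule filterlim_compose)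
  next
    case False
    show ?thesis unfolding truncated_point_def point_def restrict_apply if_not_P[OF False] by (rule tendsto_const)
  qed
qed

text \<open>The coefficients are the same for all points and scramblings, so averaging over the net
  replaces each Walsh function by its net mean.\<close>

lemma walsh_expansion_truncated_point:
  obtains c where "\<And>n \<omega>. f (truncated_point L n \<omega>) = (\<Sum>k\<in>grid L \<rightarrow>\<^sub>E {..<b}. c k * W (grid L) n k \<omega>)"
proof -
  define G where "G y = f (\<lambda>i\<in>{1..s}. \<Sum>p<d * L. real (y (pos i p)) / real b ^ Suc p)" for y
  have "f (truncated_point L n \<omega>) = (\<Sum>k\<in>grid L \<rightarrow>\<^sub>E {..<b}.
      ((\<Sum>y\<in>grid L \<rightarrow>\<^sub>E {..<b}. G y * cnj (walsh b (grid L) k y)) / of_nat b ^ card (grid L)) * W (grid L) n k \<omega>)" for n \<omega>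
  proof -
    have "(\<lambda>i\<in>{1..s}. \<Sum>p<d * L. real (restrict (scrambled_digit n \<omega>) (grid L) (pos i p)) / real b ^ Suc p) = truncated_point L n \<omega>"
      unfolding truncated_point_def
      by (intro restrict_ext sum.cong refl) (simp only: restrict_apply'[OF pos_in_grid] lessThan_iff)
    then have "f (truncated_point L n \<omega>) = G (restrict (scrambled_digit n \<omega>) (grid L))"
      by (simp only: G_def)
    then show ?thesis
      unfolding W_def using walsh_fourier_inversion[OF grid(1) b0 scrambled_digit_less, of G] by (simp only:)
  qed
  then show ?thesis by (rule that)
qed

lemma bounded_measurable_truncated_point: "bounded_measurable \<Omega> (\<lambda>\<omega>. f (truncated_point L n \<omega>))"
proof -
  obtain c where c: "\<And>n \<omega>. f (truncated_point L n \<omega>) = (\<Sum>k\<in>grid L \<rightarrow>\<^sub>E {..<b}. c k * W (grid L) n k \<omega>)"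
    using walsh_expansion_truncated_point[where f = f and L = L] by blast
  show ?thesis
    unfolding c by (intro bounded_measurable_intros bounded_measurable_W grid(2))
qed

lemma bounded_measurable_point:
  assumes f: "continuous_on ({1..s} \<rightarrow>\<^sub>E {0..1}) f"
  shows "bounded_measurable \<Omega> (\<lambda>\<omega>. f (point n \<omega>))"
proof -
  obtain B where B: "\<And>x. x \<in> {1..s} \<rightarrow>\<^sub>E {0..1} \<Longrightarrow> cmod (f x) \<le> B"
    using bounded_continuous_on_cube[OF f] by blast
  show ?thesis
    by (intro bounded_measurableI[where B = B] measurable_compose[OF measurable_point]
        borel_measurable_continuous_on_cube f B point_in_cube)
qed

lemma truncation_error_tendsto_0:
  assumes f: "continuous_on ({1..s} \<rightarrow>\<^sub>E {0..1}) f"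
  shows "(\<lambda>L. Om.expectation (\<lambda>\<omega>. (cmod (f (point n \<omega>) - f (truncated_point L n \<omega>)))\<^sup>2)) \<longlonglongrightarrow> 0"
proof -
  obtain B where B: "\<And>x. x \<in> {1..s} \<rightarrow>\<^sub>E {0..1} \<Longrightarrow> cmod (f x) \<le> B"
    using bounded_continuous_on_cube[OF f] by blast
  have bm: "bounded_measurable \<Omega> (\<lambda>\<omega>. f (point n \<omega>) - f (truncated_point L n \<omega>))" for L
    by (intro bounded_measurable_diff bounded_measurable_point bounded_measurable_truncated_point f)
  have "(\<lambda>L. Om.expectation (\<lambda>\<omega>. (cmod (f (point n \<omega>) - f (truncated_point L n \<omega>)))\<^sup>2)) \<longlonglongrightarrow> Om.expectation (\<lambda>\<omega>. 0)"
  proof (rule integral_dominated_convergence[where w = "\<lambda>_. (B + B)\<^sup>2"])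
    show "(\<lambda>\<omega>. (cmod (f (point n \<omega>) - f (truncated_point L n \<omega>)))\<^sup>2) \<in> borel_measurable \<Omega>" for L
      by (rule borel_measurable_integrable[OF Om.integrable_cmod_square_bounded_measurable[OF bm]])
    show "AE \<omega> in \<Omega>. (\<lambda>L. (cmod (f (point n \<omega>) - f (truncated_point L n \<omega>)))\<^sup>2) \<longlonglongrightarrow> 0"
    proof (rule AE_I2)
      fix \<omega>
      have "(\<lambda>L. f (truncated_point L n \<omega>)) \<longlonglongrightarrow> f (point n \<omega>)"
        by (rule continuous_on_tendsto_compose[OF f truncated_point_tendsto point_in_cube])
           (rule always_eventually, rule allI, rule truncated_point_in_cube)
      from tendsto_power[OF tendsto_norm[OF tendsto_diff[OF tendsto_const this]], of "f (point n \<omega>)" 2]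
      show "(\<lambda>L. (cmod (f (point n \<omega>) - f (truncated_point L n \<omega>)))\<^sup>2) \<longlonglongrightarrow> 0" by simp
    qed
    show "AE \<omega> in \<Omega>. norm ((cmod (f (point n \<omega>) - f (truncated_point L n \<omega>)))\<^sup>2) \<le> (B + B)\<^sup>2" for L
    proof (rule AE_I2)
      fix \<omega>
      have "cmod (f (point n \<omega>) - f (truncated_point L n \<omega>)) \<le> cmod (f (point n \<omega>)) + cmod (f (truncated_point L n \<omega>))"
        by (rule norm_triangle_ineq4)
      also have "\<dots> \<le> B + B"
        by (intro add_mono B point_in_cube truncated_point_in_cube)
      finally have "(cmod (f (point n \<omega>) - f (truncated_point L n \<omega>)))\<^sup>2 \<le> (B + B)\<^sup>2"
        by (rule power_mono) simp
      then show "norm ((cmod (f (point n \<omega>) - f (truncated_point L n \<omega>)))\<^sup>2) \<le> (B + B)\<^sup>2" by simp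
    qed
  qed auto
  then show ?thesis by simp
qed

text \<open>The frequencies are sorted by their vector of levels; within one class the decay
  estimate applies, and the classes are then summed.\<close>

lemma sum_walsh_coefficients_le:
  assumes f: "cube_smooth {1..s} f" and \<alpha>: "\<alpha> \<ge> 1"
  shows "(\<Sum>k | k \<in> grid L \<rightarrow>\<^sub>E {..<b} \<and> M < (\<Sum>j=1..d * s. level L k j).
      (cmod (Om.expectation (\<lambda>\<omega>. f (point n \<omega>) * cnj (W (grid L) n k \<omega>))))\<^sup>2)
    \<le> decay_const b d (d * s) * level_const (d * s) * (smooth_norm s \<alpha> f)\<^sup>2 *
       (real (M + 2) ^ (d * s - 1) / real b ^ (2 * min \<alpha> d * M))"
proof -
  let ?q = "d * s"
  let ?\<phi> = "\<lambda>k. (cmod (Om.expectation (\<lambda>\<omega>. f (point n \<omega>) * cnj (W (grid L) n k \<omega>))))\<^sup>2"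
  let ?D = "decay_const b d ?q * (smooth_norm s \<alpha> f)\<^sup>2"
  define K where "K = {k. k \<in> grid L \<rightarrow>\<^sub>E {..<b} \<and> M < (\<Sum>j=1..?q. level L k j)}"
  define P where "P = {l. l \<in> {1..?q} \<rightarrow>\<^sub>E {0..L} \<and> M < (\<Sum>j=1..?q. l j)}"
  define lev where "lev k = restrict (level L k) {1..?q}" for k
  have lev_sum: "(\<Sum>j=1..?q. lev k j) = (\<Sum>j=1..?q. level L k j)" for k
    unfolding lev_def by (rule sum.cong[OF refl]) (rule restrict_apply')
  have finK: "finite K"
    unfolding K_def using grid by (intro finite_subset[OF _ finite_PiE[of "grid L" "\<lambda>_. {..<b}"]]) auto
  have finP: "finite P"
    unfolding P_def by (rule finite_subset[OF _ finite_PiE[of "{1..?q}" "\<lambda>_. {0..L}"]]) auto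
  have "lev k \<in> P" if "k \<in> K" for k
  proof -
    have "lev k \<in> {1..?q} \<rightarrow>\<^sub>E {0..L}"
      unfolding lev_def restrict_PiE_iff by (simp add: level_le)
    then show ?thesis using that unfolding K_def P_def mem_Collect_eq lev_sum by blast
  qed
  then have "(\<Sum>k\<in>K. ?\<phi> k) = (\<Sum>l\<in>P. \<Sum>k | k \<in> K \<and> lev k = l. ?\<phi> k)"
    by (intro sum.group[symmetric] finK finP image_subsetI)
  also have "\<dots> \<le> (\<Sum>l\<in>P. ?D * (1 / real b ^ (2 * min \<alpha> d * (\<Sum>j=1..?q. l j))))"
  proof (rule sum_mono)
    fix l assume "l \<in> P"
    then have l: "M < (\<Sum>j=1..?q. l j)" unfolding P_def by blast
    have "\<exists>j\<in>{1..?q}. l j \<noteq> 0"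
    proof (rule ccontr)
      assume "\<not> ?thesis"
      then have "(\<Sum>j=1..?q. l j) = 0" by (intro sum.neutral) blast
      then show False using l by simp
    qed
    then obtain j0 where j0: "j0 \<in> {1..?q}" "l j0 \<noteq> 0" by blast
    have "(\<Sum>k | k \<in> K \<and> lev k = l. ?\<phi> k) \<le> (\<Sum>k\<in>{k \<in> grid L \<rightarrow>\<^sub>E {..<b}. \<forall>j\<in>{1..?q}. level L k j = l j}. ?\<phi> k)"
    proof (rule sum_mono2)
      show "finite {k \<in> grid L \<rightarrow>\<^sub>E {..<b}. \<forall>j\<in>{1..?q}. level L k j = l j}"
        using grid by (intro finite_subset[OF _ finite_PiE[of "grid L" "\<lambda>_. {..<b}"]]) auto
      show "{k. k \<in> K \<and> lev k = l} \<subseteq> {k \<in> grid L \<rightarrow>\<^sub>E {..<b}. \<forall>j\<in>{1..?q}. level L k j = l j}"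
      proof
        fix k assume "k \<in> {k. k \<in> K \<and> lev k = l}"
        then have k: "k \<in> grid L \<rightarrow>\<^sub>E {..<b}" "lev k = l" unfolding K_def by blast+
        have "level L k j = l j" if "j \<in> {1..?q}" for j
          unfolding k(2)[symmetric] lev_def restrict_apply'[OF that] ..
        then show "k \<in> {k \<in> grid L \<rightarrow>\<^sub>E {..<b}. \<forall>j\<in>{1..?q}. level L k j = l j}" using k(1) by blast
      qed
    qed simp
    also have "\<dots> \<le> ?D / real b ^ (2 * min \<alpha> d * (\<Sum>j=1..?q. l j))"
      by (rule walsh_coefficient_decay[where l = l and ?j0.0 = j0, OF f \<alpha> j0])
    finally show "(\<Sum>k | k \<in> K \<and> lev k = l. ?\<phi> k) \<le> ?D * (1 / real b ^ (2 * min \<alpha> d * (\<Sum>j=1..?q. l j)))"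
      by simp
  qed
  also have "\<dots> = ?D * (\<Sum>l\<in>P. 1 / real b ^ (2 * min \<alpha> d * (\<Sum>j=1..?q. l j)))"
    by (simp only: sum_distrib_left)
  also have "\<dots> \<le> ?D * (level_const ?q * real (M + 2) ^ (?q - 1) / real b ^ (2 * min \<alpha> d * M))"
  proof (rule mult_left_mono)
    show "(\<Sum>l\<in>P. 1 / real b ^ (2 * min \<alpha> d * (\<Sum>j=1..?q. l j))) \<le>
        level_const ?q * real (M + 2) ^ (?q - 1) / real b ^ (2 * min \<alpha> d * M)"
      unfolding P_def by (rule sum_levels_le) (use dim \<alpha> b2 in auto)
    show "0 \<le> ?D" using decay_const_pos[OF b0] by (simp add: less_imp_le)
  qed
  finally show ?thesis unfolding K_def by (simp add: mult_ac)
qed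

end

context net_scrambling
begin

text \<open>The coefficients \<open>c k\<close> belong to a step function, to which the decay
  estimate does not apply. They differ from the coefficients of \<open>f\<close> by those of the
  truncation error, whose squares sum to at most \<open>err 0\<close> by Bessel's inequality. The
  factor 4 arises from splitting a square in two twice.\<close>

lemma point_estimator_variance_le_truncation:
  fixes L :: nat
  assumes f: "cube_smooth {1..s} f" and \<alpha>: "\<alpha> \<ge> 1"
  defines "err \<equiv> \<lambda>n. Om.expectation (\<lambda>\<omega>. (cmod (f (point n \<omega>) - f (truncated_point L n \<omega>)))\<^sup>2)"
    and "G \<equiv> real b ^ (d * s) / real b ^ (m - t)"
    and "B \<equiv> decay_const b d (d * s) * level_const (d * s) * (smooth_norm s \<alpha> f)\<^sup>2 *
      (real (m - t + 2) ^ (d * s - 1) / real b ^ (2 * min \<alpha> d * (m - t)))"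
  shows "complex_variance \<Omega> (\<lambda>\<omega>. (\<Sum>n<b ^ m. f (point n \<omega>)) / of_nat (b ^ m))
    \<le> 4 * G * B + (4 * G * err 0 + 2 * ((\<Sum>n<b ^ m. err n) / real (b ^ m)))"
proof -
  have N: "b ^ m > 0" using b0 by simp
  have cont: "continuous_on ({1..s} \<rightarrow>\<^sub>E {0..1}) f" by (rule cube_smooth_continuous[OF f])
  define e where "e n \<omega> = f (point n \<omega>) - f (truncated_point L n \<omega>)" for n \<omega>
  have bm_e: "bounded_measurable \<Omega> (e n)" for n
    unfolding e_def[abs_def]
    by (intro bounded_measurable_diff bounded_measurable_point bounded_measurable_truncated_point cont)
  have err: "err n = Om.expectation (\<lambda>\<omega>. (cmod (e n \<omega>))\<^sup>2)" for n
    unfolding err_def e_def ..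
  obtain c where c: "\<And>n \<omega>. f (truncated_point L n \<omega>) = (\<Sum>k\<in>grid L \<rightarrow>\<^sub>E {..<b}. c k * W (grid L) n k \<omega>)"
    using walsh_expansion_truncated_point[where f = f and L = L] by blast
  define K where "K = {k \<in> grid L \<rightarrow>\<^sub>E {..<b}. \<exists>x\<in>grid L. k x \<noteq> 0}"
  define k0 :: "nat \<times> nat \<Rightarrow> nat" where "k0 = (\<lambda>x\<in>grid L. 0)"
  have finG: "finite (grid L \<rightarrow>\<^sub>E {..<b})" by (intro finite_PiE grid(1)) simp
  have finK: "finite K" unfolding K_def by (rule finite_subset[OF _ finG]) blast
  have k0: "k0 x = 0" if "x \<in> grid L" for x
    unfolding k0_def by (rule restrict_apply'[OF that])
  have k0_notin: "k0 \<notin> K"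
    unfolding K_def mem_Collect_eq by (intro notI, elim conjE bexE, erule notE, rule k0)
  have all: "grid L \<rightarrow>\<^sub>E {..<b} = insert k0 K"
  proof (intro equalityI subsetI)
    fix k assume k: "k \<in> grid L \<rightarrow>\<^sub>E {..<b}"
    show "k \<in> insert k0 K"
    proof (cases "\<exists>x\<in>grid L. k x \<noteq> 0")
      case True
      then show ?thesis using k unfolding K_def by blast
    next
      case False
      have "k x = 0" if "x \<in> grid L" for x
        by (rule ccontr) (rule notE[OF False bexI[OF _ that]])
      then have "restrict k (grid L) = k0" unfolding k0_def by (rule restrict_ext)
      then show ?thesis unfolding PiE_restrict[OF k] by (simp only: insertI1)
    qed
  next
    fix k assume "k \<in> insert k0 K"
    moreover have "k0 \<in> grid L \<rightarrow>\<^sub>E {..<b}"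
      unfolding k0_def restrict_PiE_iff using b0 by simp
    ultimately show "k \<in> grid L \<rightarrow>\<^sub>E {..<b}" unfolding K_def by blast
  qed
  have "walsh b (grid L) k0 y = 1" for y by (rule walsh_zero) (rule k0)
  then have 1: "net_mean L k0 \<omega> = 1" for \<omega>
    unfolding net_mean_def W_def using N by (simp only:) simp
  have mean: "(\<Sum>n<b ^ m. f (truncated_point L n \<omega>)) / of_nat (b ^ m) = c k0 + (\<Sum>k\<in>K. c k * net_mean L k \<omega>)" for \<omega>
  proof -
    have "(\<Sum>n<b ^ m. f (truncated_point L n \<omega>)) = (\<Sum>k\<in>grid L \<rightarrow>\<^sub>E {..<b}. c k * (\<Sum>n<b ^ m. W (grid L) n k \<omega>))"
      unfolding c by (subst sum.swap) (simp only: sum_distrib_left)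
    then have "(\<Sum>n<b ^ m. f (truncated_point L n \<omega>)) / of_nat (b ^ m) = (\<Sum>k\<in>grid L \<rightarrow>\<^sub>E {..<b}. c k * net_mean L k \<omega>)"
      by (simp only: net_mean_def times_divide_eq_right sum_divide_distrib[symmetric])
    also have "\<dots> = c k0 + (\<Sum>k\<in>K. c k * net_mean L k \<omega>)"
      unfolding all sum.insert[OF finK k0_notin] 1 mult_1_right ..
    finally show ?thesis .
  qed
  define Z where "Z \<omega> = (\<Sum>k\<in>K. c k * net_mean L k \<omega>)" for \<omega>
  define D where "D \<omega> = (\<Sum>n<b ^ m. e n \<omega>) / of_nat (b ^ m)" for \<omega>
  have bmZ: "bounded_measurable \<Omega> Z"
    unfolding Z_def[abs_def] by (intro bounded_measurable_intros bounded_measurable_net_mean)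
  have bmD: "bounded_measurable \<Omega> D"
    unfolding D_def[abs_def] by (intro bounded_measurable_intros bm_e)
  let ?est = "\<lambda>\<omega>. (\<Sum>n<b ^ m. f (point n \<omega>)) / of_nat (b ^ m)"
  have bm_est: "bounded_measurable \<Omega> ?est"
    by (intro bounded_measurable_intros bounded_measurable_point cont)
  have split: "?est \<omega> - c k0 = Z \<omega> + D \<omega>" for \<omega>
  proof -
    have "D \<omega> = ?est \<omega> - (\<Sum>n<b ^ m. f (truncated_point L n \<omega>)) / of_nat (b ^ m)"
      unfolding D_def e_def sum_subtractf diff_divide_distrib ..
    moreover have "x - a = z + (x - (a + z))" for x a z :: complex by simp
    ultimately show ?thesis unfolding mean Z_def by (simp only:)
  qed
  have sqZ: "integrable \<Omega> (\<lambda>\<omega>. (cmod (Z \<omega>))\<^sup>2)" and sqD: "integrable \<Omega> (\<lambda>\<omega>. (cmod (D \<omega>))\<^sup>2)"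
    and sqe: "integrable \<Omega> (\<lambda>\<omega>. (cmod (e n \<omega>))\<^sup>2)" for n
    by (rule Om.integrable_cmod_square_bounded_measurable[OF bmZ],
        rule Om.integrable_cmod_square_bounded_measurable[OF bmD],
        rule Om.integrable_cmod_square_bounded_measurable[OF bm_e])
  \<comment> \<open>The coefficient at frequency 0 is the mean of the truncated estimator and serves
    as the centre.\<close>
  have "complex_variance \<Omega> ?est \<le> Om.expectation (\<lambda>\<omega>. (cmod (?est \<omega> - c k0))\<^sup>2)"
    by (rule Om.complex_variance_le[OF _ Om.integrable_cmod_square_bounded_measurable[OF bm_est]])
       (use bm_est in \<open>simp only: bounded_measurable_def\<close>)
  also have "\<dots> = Om.expectation (\<lambda>\<omega>. (cmod (Z \<omega> + D \<omega>))\<^sup>2)"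
    unfolding split ..
  also have "\<dots> \<le> Om.expectation (\<lambda>\<omega>. 2 * (cmod (Z \<omega>))\<^sup>2 + 2 * (cmod (D \<omega>))\<^sup>2)"
    by (rule integral_mono[OF Om.integrable_cmod_square_bounded_measurable[OF bounded_measurable_add[OF bmZ bmD]]
          Bochner_Integration.integrable_add[OF integrable_mult_right[OF sqZ] integrable_mult_right[OF sqD]]
          cmod_add_square_le])
  also have "\<dots> = 2 * Om.expectation (\<lambda>\<omega>. (cmod (Z \<omega>))\<^sup>2) + 2 * Om.expectation (\<lambda>\<omega>. (cmod (D \<omega>))\<^sup>2)"
    using sqZ sqD by simp
  finally have 1: "complex_variance \<Omega> ?est \<le>
      2 * Om.expectation (\<lambda>\<omega>. (cmod (Z \<omega>))\<^sup>2) + 2 * Om.expectation (\<lambda>\<omega>. (cmod (D \<omega>))\<^sup>2)" .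
  have "Om.expectation (\<lambda>\<omega>. (cmod (D \<omega>))\<^sup>2) \<le> Om.expectation (\<lambda>\<omega>. (\<Sum>n<b ^ m. (cmod (e n \<omega>))\<^sup>2) / real (b ^ m))"
  proof (rule integral_mono[OF sqD])
    show "integrable \<Omega> (\<lambda>\<omega>. (\<Sum>n<b ^ m. (cmod (e n \<omega>))\<^sup>2) / real (b ^ m))"
      by (intro integrable_divide_zero Bochner_Integration.integrable_sum sqe)
    show "(cmod (D \<omega>))\<^sup>2 \<le> (\<Sum>n<b ^ m. (cmod (e n \<omega>))\<^sup>2) / real (b ^ m)" for \<omega>
      unfolding D_def by (rule cmod_mean_square_le[OF N])
  qed
  also have "\<dots> = (\<Sum>n<b ^ m. err n) / real (b ^ m)"
    unfolding err integral_divide_zero using sqe by (subst Bochner_Integration.integral_sum) auto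
  finally have 2: "Om.expectation (\<lambda>\<omega>. (cmod (D \<omega>))\<^sup>2) \<le> (\<Sum>n<b ^ m. err n) / real (b ^ m)" .
  define H where "H = {k \<in> grid L \<rightarrow>\<^sub>E {..<b}. m - t < (\<Sum>j=1..d * s. level L k j)}"
  have finH: "finite H" unfolding H_def by (rule finite_subset[OF _ finG]) blast
  \<comment> \<open>The coefficients \<open>c\<close> do not depend on the point, so they can be
    computed at point 0.\<close>
  define \<phi> where "\<phi> k = Om.expectation (\<lambda>\<omega>. f (point 0 \<omega>) * cnj (W (grid L) 0 k \<omega>))" for k
  define \<epsilon> where "\<epsilon> k = Om.expectation (\<lambda>\<omega>. e 0 \<omega> * cnj (W (grid L) 0 k \<omega>))" for k
  have ck: "c k = \<phi> k + - \<epsilon> k" if k: "k \<in> grid L \<rightarrow>\<^sub>E {..<b}" for k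
  proof -
    have "\<phi> k - \<epsilon> k = Om.expectation (\<lambda>\<omega>. f (point 0 \<omega>) * cnj (W (grid L) 0 k \<omega>) - e 0 \<omega> * cnj (W (grid L) 0 k \<omega>))"
      unfolding \<phi>_def \<epsilon>_def
      by (rule Bochner_Integration.integral_diff[symmetric])
         (intro Om.integrable_bounded_measurable bounded_measurable_intros bounded_measurable_point cont
            bounded_measurable_W grid(2) bm_e)+
    also have "\<dots> = Om.expectation (\<lambda>\<omega>. \<Sum>l\<in>grid L \<rightarrow>\<^sub>E {..<b}. c l * (W (grid L) 0 l \<omega> * cnj (W (grid L) 0 k \<omega>)))"
    proof (rule Bochner_Integration.integral_cong[OF refl])
      fix \<omega>
      have "f (point 0 \<omega>) * cnj (W (grid L) 0 k \<omega>) - e 0 \<omega> * cnj (W (grid L) 0 k \<omega>) =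
          f (truncated_point L 0 \<omega>) * cnj (W (grid L) 0 k \<omega>)"
        unfolding e_def by (simp add: left_diff_distrib)
      then show "f (point 0 \<omega>) * cnj (W (grid L) 0 k \<omega>) - e 0 \<omega> * cnj (W (grid L) 0 k \<omega>) =
          (\<Sum>l\<in>grid L \<rightarrow>\<^sub>E {..<b}. c l * (W (grid L) 0 l \<omega> * cnj (W (grid L) 0 k \<omega>)))"
        unfolding c by (simp only: sum_distrib_right mult.assoc)
    qed
    also have "\<dots> = (\<Sum>l\<in>grid L \<rightarrow>\<^sub>E {..<b}. Om.expectation (\<lambda>\<omega>. c l * (W (grid L) 0 l \<omega> * cnj (W (grid L) 0 k \<omega>))))"
      by (rule Bochner_Integration.integral_sum)
         (intro Om.integrable_bounded_measurable bounded_measurable_intros bounded_measurable_W grid(2))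
    also have "\<dots> = (\<Sum>l\<in>grid L \<rightarrow>\<^sub>E {..<b}. if l = k then c l else 0)"
    proof (rule sum.cong[OF refl])
      fix l assume l: "l \<in> grid L \<rightarrow>\<^sub>E {..<b}"
      show "Om.expectation (\<lambda>\<omega>. c l * (W (grid L) 0 l \<omega> * cnj (W (grid L) 0 k \<omega>))) = (if l = k then c l else 0)"
        unfolding integral_mult_right_zero expectation_W_orthonormal[OF grid l k] by simp
    qed
    also have "\<dots> = c k" using k finG by (simp only: sum.delta if_True)
    finally show ?thesis by (simp only: add_uminus_conv_diff)
  qed
  have "(\<Sum>k | k \<in> K \<and> m - t < (\<Sum>j=1..d * s. level L k j). (cmod (c k))\<^sup>2) \<le> (\<Sum>k\<in>H. (cmod (c k))\<^sup>2)"
    by (rule sum_mono2[OF finH]) (unfold K_def H_def, blast, rule zero_le_power2)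
  also have "\<dots> \<le> (\<Sum>k\<in>H. 2 * (cmod (\<phi> k))\<^sup>2 + 2 * (cmod (\<epsilon> k))\<^sup>2)"
  proof (rule sum_mono)
    fix k assume "k \<in> H"
    then have "k \<in> grid L \<rightarrow>\<^sub>E {..<b}" unfolding H_def by blast
    then show "(cmod (c k))\<^sup>2 \<le> 2 * (cmod (\<phi> k))\<^sup>2 + 2 * (cmod (\<epsilon> k))\<^sup>2"
      using cmod_add_square_le[of "\<phi> k" "- \<epsilon> k"] by (simp only: ck norm_minus_cancel)
  qed
  also have "\<dots> = 2 * (\<Sum>k\<in>H. (cmod (\<phi> k))\<^sup>2) + 2 * (\<Sum>k\<in>H. (cmod (\<epsilon> k))\<^sup>2)"
    by (simp only: sum.distrib sum_distrib_left)
  also have "\<dots> \<le> 2 * B + 2 * err 0"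
  proof -
    have "(\<Sum>k\<in>H. (cmod (\<phi> k))\<^sup>2) \<le> B"
      unfolding H_def \<phi>_def B_def by (rule sum_walsh_coefficients_le[OF f \<alpha>])
    moreover have "(\<Sum>k\<in>H. (cmod (\<epsilon> k))\<^sup>2) \<le> err 0"
      unfolding \<epsilon>_def err
      by (rule Om.bessel_inequality[OF finH bounded_measurable_W[OF grid(2)] _ bm_e])
         (unfold H_def mem_Collect_eq, elim conjE, rule expectation_W_orthonormal[OF grid])
    ultimately show ?thesis by linarith
  qed
  finally have coef: "(\<Sum>k | k \<in> K \<and> m - t < (\<Sum>j=1..d * s. level L k j). (cmod (c k))\<^sup>2) \<le> 2 * B + 2 * err 0" .
  have "Om.expectation (\<lambda>\<omega>. (cmod (Z \<omega>))\<^sup>2) \<le> G * (2 * B + 2 * err 0)"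
  proof -
    have "Om.expectation (\<lambda>\<omega>. (cmod (Z \<omega>))\<^sup>2) \<le>
        G * (\<Sum>k | k \<in> K \<and> m - t < (\<Sum>j=1..d * s. level L k j). (cmod (c k))\<^sup>2)"
      unfolding Z_def G_def K_def by (rule expectation_walsh_polynomial_le)
    also have "\<dots> \<le> G * (2 * B + 2 * err 0)"
      by (rule mult_left_mono[OF coef]) (simp add: G_def)
    finally show ?thesis .
  qed
  then have "2 * Om.expectation (\<lambda>\<omega>. (cmod (Z \<omega>))\<^sup>2) \<le> 4 * G * B + 4 * G * err 0"
    by (simp add: algebra_simps)
  then show ?thesis using 1 2 by linarith
qed

text \<open>The variance does not involve \<open>L\<close>, so the limit in \<open>L\<close> removes
  all truncation errors.\<close>

lemma point_estimator_variance_le: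
  assumes f: "cube_smooth {1..s} f" and \<alpha>: "\<alpha> \<ge> 1"
  shows "complex_variance \<Omega> (\<lambda>\<omega>. (\<Sum>n<b ^ m. f (point n \<omega>)) / of_nat (b ^ m))
    \<le> 4 * (real b ^ (d * s) / real b ^ (m - t)) * (decay_const b d (d * s) * level_const (d * s) * (smooth_norm s \<alpha> f)\<^sup>2 *
      (real (m - t + 2) ^ (d * s - 1) / real b ^ (2 * min \<alpha> d * (m - t))))"
    (is "?V \<le> 4 * ?G * ?B")
proof (rule LIMSEQ_le_const)
  let ?err = "\<lambda>L n. Om.expectation (\<lambda>\<omega>. (cmod (f (point n \<omega>) - f (truncated_point L n \<omega>)))\<^sup>2)"
  have err: "(\<lambda>L. ?err L n) \<longlonglongrightarrow> 0" for n
    by (rule truncation_error_tendsto_0[OF cube_smooth_continuous[OF f]])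
  have "(\<lambda>L. 4 * ?G * ?B + (4 * ?G * ?err L 0 + 2 * ((\<Sum>n<b ^ m. ?err L n) / real (b ^ m))))
      \<longlonglongrightarrow> 4 * ?G * ?B + (4 * ?G * 0 + 2 * ((\<Sum>n<b ^ m. 0) / real (b ^ m)))"
    by (intro tendsto_add tendsto_const tendsto_mult tendsto_divide tendsto_sum err) (use b0 in simp)
  then show "(\<lambda>L. 4 * ?G * ?B + (4 * ?G * ?err L 0 + 2 * ((\<Sum>n<b ^ m. ?err L n) / real (b ^ m)))) \<longlonglongrightarrow> 4 * ?G * ?B"
    by (simp only: sum.neutral_const div_0 mult_zero_right add_0_right)
  show "\<exists>N. \<forall>L\<ge>N. ?V \<le> 4 * ?G * ?B + (4 * ?G * ?err L 0 + 2 * ((\<Sum>n<b ^ m. ?err L n) / real (b ^ m)))"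
    by (intro exI allI impI) (rule point_estimator_variance_le_truncation[OF f \<alpha>])
qed

end

section \<open>Sobolev functions\<close>

context net_scrambling
begin

lemma
  assumes g: "square_integrable s g"
  shows measurable_square_integrable_point: "(\<lambda>\<omega>. g (point n \<omega>)) \<in> borel_measurable \<Omega>"
    and integrable_square_integrable_point: "integrable \<Omega> (\<lambda>\<omega>. (cmod (g (point n \<omega>)))\<^sup>2)"
    and expectation_square_integrable_point:
      "Om.expectation (\<lambda>\<omega>. (cmod (g (point n \<omega>)))\<^sup>2) = (LINT x|cube {1..s}. (cmod (g x))\<^sup>2)"
proof -
  have g': "g \<in> borel_measurable (cube {1..s})" "integrable (cube {1..s}) (\<lambda>x. (cmod (g x))\<^sup>2)"
    using g unfolding square_integrable_def by blast+
  show "(\<lambda>\<omega>. g (point n \<omega>)) \<in> borel_measurable \<Omega>"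
    by (rule measurable_compose[OF measurable_point g'(1)])
  show "integrable \<Omega> (\<lambda>\<omega>. (cmod (g (point n \<omega>)))\<^sup>2)"
    by (rule integrable_distr[OF measurable_point]) (unfold distr_point(2), rule g'(2))
  have "Om.expectation (\<lambda>\<omega>. (cmod (g (point n \<omega>)))\<^sup>2) =
      (LINT x|distr \<Omega> (cube {1..s}) (point n). (cmod (g x))\<^sup>2)"
    by (rule integral_distr[OF measurable_point borel_measurable_integrable[OF g'(2)], symmetric])
  then show "Om.expectation (\<lambda>\<omega>. (cmod (g (point n \<omega>)))\<^sup>2) = (LINT x|cube {1..s}. (cmod (g x))\<^sup>2)"
    unfolding distr_point(2) .
qed

text \<open>Each point is uniform on the cube, so by Cauchy-Schwarz averaging over the net is a
  contraction in mean square. Approximation of the integrand thus carries over to the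
  estimator.\<close>

lemma
  assumes g: "square_integrable s g"
  shows measurable_point_estimator:
      "(\<lambda>\<omega>. (\<Sum>n<b ^ m. g (point n \<omega>)) / of_nat (b ^ m)) \<in> borel_measurable \<Omega>" (is "?est \<in> _")
    and integrable_point_estimator:
      "integrable \<Omega> (\<lambda>\<omega>. (cmod ((\<Sum>n<b ^ m. g (point n \<omega>)) / of_nat (b ^ m)))\<^sup>2)"
    and expectation_point_estimator_le:
      "Om.expectation (\<lambda>\<omega>. (cmod ((\<Sum>n<b ^ m. g (point n \<omega>)) / of_nat (b ^ m)))\<^sup>2)
        \<le> (LINT x|cube {1..s}. (cmod (g x))\<^sup>2)"
proof -
  have N: "b ^ m > 0" using b0 by simp
  let ?I = "LINT x|cube {1..s}. (cmod (g x))\<^sup>2"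
  let ?mean = "\<lambda>\<omega>. (\<Sum>n<b ^ m. (cmod (g (point n \<omega>)))\<^sup>2) / real (b ^ m)"
  show meas: "?est \<in> borel_measurable \<Omega>"
    by (intro borel_measurable_divide borel_measurable_sum measurable_square_integrable_point[OF g]
        borel_measurable_const)
  have le: "(cmod (?est \<omega>))\<^sup>2 \<le> ?mean \<omega>" for \<omega>
    by (rule cmod_mean_square_le[OF N])
  have int: "integrable \<Omega> ?mean"
    by (intro integrable_divide_zero Bochner_Integration.integrable_sum integrable_square_integrable_point[OF g])
  show int_est: "integrable \<Omega> (\<lambda>\<omega>. (cmod (?est \<omega>))\<^sup>2)"
  proof (rule Bochner_Integration.integrable_bound[OF int])
    show "(\<lambda>\<omega>. (cmod (?est \<omega>))\<^sup>2) \<in> borel_measurable \<Omega>"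
      by (intro borel_measurable_power measurable_compose[OF meas borel_measurable_norm])
    show "AE \<omega> in \<Omega>. norm ((cmod (?est \<omega>))\<^sup>2) \<le> norm (?mean \<omega>)"
    proof (rule AE_I2)
      fix \<omega>
      have "norm ((cmod (?est \<omega>))\<^sup>2) = (cmod (?est \<omega>))\<^sup>2" by (simp only: real_norm_def abs_power2)
      also have "\<dots> \<le> ?mean \<omega>" by (rule le)
      also have "\<dots> \<le> norm (?mean \<omega>)" by (simp only: real_norm_def abs_ge_self)
      finally show "norm ((cmod (?est \<omega>))\<^sup>2) \<le> norm (?mean \<omega>)" .
    qed
  qed
  have "Om.expectation (\<lambda>\<omega>. (cmod (?est \<omega>))\<^sup>2) \<le> Om.expectation ?mean"
    by (rule integral_mono[OF int_est int le])
  also have "\<dots> = Om.expectation (\<lambda>\<omega>. \<Sum>n<b ^ m. (cmod (g (point n \<omega>)))\<^sup>2) / real (b ^ m)"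
    by (rule integral_divide_zero)
  also have "Om.expectation (\<lambda>\<omega>. \<Sum>n<b ^ m. (cmod (g (point n \<omega>)))\<^sup>2) = (\<Sum>n<b ^ m. ?I)"
    by (subst Bochner_Integration.integral_sum[OF integrable_square_integrable_point[OF g]])
       (simp only: expectation_square_integrable_point[OF g])
  also have "(\<Sum>n<b ^ m. ?I) / real (b ^ m) = ?I"
    using b0 by simp
  finally show "Om.expectation (\<lambda>\<omega>. (cmod (?est \<omega>))\<^sup>2) \<le> ?I" .
qed

lemma complex_variance_estimator_eq:
  assumes f: "f \<in> borel_measurable (cube {1..s})"
  shows "complex_variance \<Omega> (estimator b s d m C f) =
    complex_variance \<Omega> (\<lambda>\<omega>. (\<Sum>n<b ^ m. f (point n \<omega>)) / of_nat (b ^ m))" (is "_ = complex_variance \<Omega> ?est")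
proof -
  have e: "estimator b s d m C f \<in> borel_measurable \<Omega>"
    unfolding estimator_def[abs_def]
    by (intro borel_measurable_divide borel_measurable_sum borel_measurable_const
        measurable_compose[OF measurable_interlace_scramble f])
  have p: "?est \<in> borel_measurable \<Omega>"
    by (intro borel_measurable_divide borel_measurable_sum borel_measurable_const
        measurable_compose[OF measurable_point f])
  have "AE \<omega> in \<Omega>. \<forall>n. interlace b s d (scramble b \<omega> (net_point b m C n)) = point n \<omega>"
    unfolding AE_all_countable by (intro allI AE_interlace_scramble digit_net_point base)
  then have ae: "AE \<omega> in \<Omega>. estimator b s d m C f \<omega> = ?est \<omega>"
  proof (rule eventually_mono)
    fix \<omega> assume "\<forall>n. interlace b s d (scramble b \<omega> (net_point b m C n)) = point n \<omega>"
    then show "estimator b s d m C f \<omega> = ?est \<omega>" by (simp only: estimator_def)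
  qed
  have mean: "Om.expectation (estimator b s d m C f) = Om.expectation ?est"
    by (rule integral_cong_AE[OF e p ae])
  show ?thesis
    unfolding complex_variance_def mean
  proof (rule integral_cong_AE)
    show "AE \<omega> in \<Omega>. (cmod (estimator b s d m C f \<omega> - Om.expectation ?est))\<^sup>2 = (cmod (?est \<omega> - Om.expectation ?est))\<^sup>2"
      using ae by (rule eventually_mono) (simp only:)
  qed (intro borel_measurable_power measurable_compose[OF _ borel_measurable_norm] borel_measurable_diff
      borel_measurable_const e p)+
qed

text \<open>The variance is compared with that of a smooth approximant, at the price of a factor 2
  and the mean square error of approximation; in the limit the error vanishes and the norms converge
  to \<open>c\<close>. This turns the factor 4 of the smooth case into 8.\<close>

lemma complex_variance_estimator_le:
  assumes f: "has_sobolev_norm s \<alpha> f c" and \<alpha>: "\<alpha> \<ge> 1"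
  shows "complex_variance \<Omega> (estimator b s d m C f)
    \<le> 8 * (real b ^ (d * s) / real b ^ (m - t)) * (decay_const b d (d * s) * level_const (d * s) * c\<^sup>2 *
      (real (m - t + 2) ^ (d * s - 1) / real b ^ (2 * min \<alpha> d * (m - t))))"
proof -
  from f obtain F where sq: "square_integrable s f" and F: "\<And>k. smooth_on_cube s (F k)"
    and L2: "(\<lambda>k. LINT x|cube {1..s}. (cmod (F k x - f x))\<^sup>2) \<longlonglongrightarrow> 0"
    and norms: "(\<lambda>k. smooth_norm s \<alpha> (F k)) \<longlonglongrightarrow> c"
    unfolding has_sobolev_norm_def by blast
  let ?est = "\<lambda>g \<omega>. (\<Sum>n<b ^ m. g (point n \<omega>)) / of_nat (b ^ m)"
  let ?\<delta> = "\<lambda>k. LINT x|cube {1..s}. (cmod (F k x - f x))\<^sup>2"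
  define B where "B x = 4 * (real b ^ (d * s) / real b ^ (m - t)) * (decay_const b d (d * s) * level_const (d * s) * x\<^sup>2 *
      (real (m - t + 2) ^ (d * s - 1) / real b ^ (2 * min \<alpha> d * (m - t))))" for x
  have fm: "f \<in> borel_measurable (cube {1..s})" "integrable (cube {1..s}) (\<lambda>x. (cmod (f x))\<^sup>2)"
    using sq unfolding square_integrable_def by blast+
  have le: "complex_variance \<Omega> (?est f) \<le> 2 * ?\<delta> k + 2 * B (smooth_norm s \<alpha> (F k))" for k
  proof -
    have Fk: "cube_smooth {1..s} (F k)" using F[of k] unfolding smooth_on_cube_iff .
    have cont: "continuous_on ({1..s} \<rightarrow>\<^sub>E {0..1}) (F k)" by (rule cube_smooth_continuous[OF Fk])
    note Fm = borel_measurable_continuous_on_cube[OF cont] integrable_cmod_square_continuous_on_cube[OF cont]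
    have sqF: "square_integrable s (F k)"
      unfolding square_integrable_def by (intro conjI Fm)
    have sqD: "square_integrable s (\<lambda>x. F k x - f x)"
      unfolding square_integrable_def
      by (intro conjI borel_measurable_diff Fm fm
          prob_space.integrable_cmod_square_diff[OF prob_space_cube])
    let ?\<mu> = "Om.expectation (?est (F k))"
    have i1: "integrable \<Omega> (\<lambda>\<omega>. (cmod (?est (\<lambda>x. F k x - f x) \<omega>))\<^sup>2)"
      by (rule integrable_point_estimator[OF sqD])
    have i2: "integrable \<Omega> (\<lambda>\<omega>. (cmod (?est (F k) \<omega> - ?\<mu>))\<^sup>2)"
      by (rule Om.integrable_cmod_square_diff[OF measurable_point_estimator[OF sqF] integrable_point_estimator[OF sqF]])
         simp_all
    have i3: "integrable \<Omega> (\<lambda>\<omega>. (cmod (?est f \<omega> - ?\<mu>))\<^sup>2)"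
      by (rule Om.integrable_cmod_square_diff[OF measurable_point_estimator[OF sq] integrable_point_estimator[OF sq]])
         simp_all
    have "complex_variance \<Omega> (?est f) \<le> Om.expectation (\<lambda>\<omega>. (cmod (?est f \<omega> - ?\<mu>))\<^sup>2)"
      by (rule Om.complex_variance_le[OF measurable_point_estimator[OF sq] integrable_point_estimator[OF sq]])
    also have "\<dots> \<le> Om.expectation (\<lambda>\<omega>. 2 * (cmod (?est (\<lambda>x. F k x - f x) \<omega>))\<^sup>2 + 2 * (cmod (?est (F k) \<omega> - ?\<mu>))\<^sup>2)"
    proof (rule integral_mono[OF i3])
      show "integrable \<Omega> (\<lambda>\<omega>. 2 * (cmod (?est (\<lambda>x. F k x - f x) \<omega>))\<^sup>2 + 2 * (cmod (?est (F k) \<omega> - ?\<mu>))\<^sup>2)"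
        by (intro Bochner_Integration.integrable_add integrable_mult_right i1 i2)
      fix \<omega>
      have "?est f \<omega> - ?\<mu> = - ?est (\<lambda>x. F k x - f x) \<omega> + (?est (F k) \<omega> - ?\<mu>)"
        unfolding sum_subtractf diff_divide_distrib by simp
      then show "(cmod (?est f \<omega> - ?\<mu>))\<^sup>2 \<le> 2 * (cmod (?est (\<lambda>x. F k x - f x) \<omega>))\<^sup>2 + 2 * (cmod (?est (F k) \<omega> - ?\<mu>))\<^sup>2"
        using cmod_add_square_le[of "- ?est (\<lambda>x. F k x - f x) \<omega>" "?est (F k) \<omega> - ?\<mu>"]
        by (simp only: norm_minus_cancel)
    qed
    also have "\<dots> = 2 * Om.expectation (\<lambda>\<omega>. (cmod (?est (\<lambda>x. F k x - f x) \<omega>))\<^sup>2) + 2 * complex_variance \<Omega> (?est (F k))"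
      unfolding complex_variance_def
      by (simp only: Bochner_Integration.integral_add[OF integrable_mult_right[OF i1] integrable_mult_right[OF i2]]
          integral_mult_right_zero)
    also have "\<dots> \<le> 2 * ?\<delta> k + 2 * B (smooth_norm s \<alpha> (F k))"
      using expectation_point_estimator_le[OF sqD] point_estimator_variance_le[OF Fk \<alpha>]
      unfolding B_def by (intro add_mono mult_left_mono) simp_all
    finally show ?thesis .
  qed
  have "(\<lambda>k. 2 * ?\<delta> k + 2 * B (smooth_norm s \<alpha> (F k))) \<longlonglongrightarrow> 2 * 0 + 2 * B c"
    unfolding B_def by (intro tendsto_add tendsto_mult tendsto_const tendsto_power L2 norms)
  then have "complex_variance \<Omega> (?est f) \<le> 2 * 0 + 2 * B c"
    by (rule LIMSEQ_le_const) (intro exI allI impI le)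
  then show ?thesis
    unfolding complex_variance_estimator_eq[OF fm(1)] B_def by (simp only: mult_zero_right add_0_left mult.assoc[symmetric])
qed

end

theorem theorem6p2:
  fixes b s d \<alpha> :: nat
  assumes "prime b" and "s \<ge> 1" and "d \<ge> 1" and "\<alpha> \<ge> 1"
  shows "\<exists>K::real. K > 0 \<and>
    (\<forall>(m::nat) (t::nat) (C :: nat \<Rightarrow> nat \<Rightarrow> nat \<Rightarrow> nat) (f :: (nat \<Rightarrow> real) \<Rightarrow> complex) (c::real).
       m \<ge> 1 \<longrightarrow> t \<le> m \<longrightarrow> digital_net b t m (d * s) C \<longrightarrow> has_sobolev_norm s \<alpha> f c \<longrightarrow>
       complex_variance (scramble_space b (d * s)) (estimator b s d m C f)
         \<le> K * c\<^sup>2 * (1 / real b ^ ((2 * min \<alpha> d + 1) * (m - t)))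
             * real (m - t + 2) ^ (d * s - 1))"
proof -
  have b: "b \<ge> 2" by (rule prime_ge_2_nat[OF assms(1)])
  \<comment> \<open>The 8 stems from the three splittings of squares, \<open>b ^ (d * s)\<close>
    from the gain of net means, and the other two factors from the decay within a class of levels
    and the sum over the classes.\<close>
  define K where "K = 8 * real b ^ (d * s) * decay_const b d (d * s) * level_const (d * s)"
  have "K > 0"
    unfolding K_def using b decay_const_pos[of b d "d * s"] level_const_pos[of "d * s"] by simp
  moreover have "complex_variance (scramble_space b (d * s)) (estimator b s d m C f)
      \<le> K * c\<^sup>2 * (1 / real b ^ ((2 * min \<alpha> d + 1) * (m - t))) * real (m - t + 2) ^ (d * s - 1)"
    if net: "digital_net b t m (d * s) C" and f: "has_sobolev_norm s \<alpha> f c" for m t C f c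
  proof -
    interpret net_scrambling b s d m t C
      by (rule net_scrambling.intro[OF b assms(2,3) net])
    have "real b ^ ((2 * min \<alpha> d + 1) * (m - t)) = real b ^ (2 * min \<alpha> d * (m - t)) * real b ^ (m - t)"
      by (simp only: add_mult_distrib power_add mult_1)
    then show ?thesis
      using complex_variance_estimator_le[OF f assms(4)] by (simp add: K_def mult_ac)
  qed
  ultimately show ?thesis by blast
qed

end
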